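(* Let $\mathcal{A}\subset\mathbb{R}^d$ be a finite action set of size $K$, let $T$ be the horizon and $\delta\in(0,1)$. In the stochastic linear bandit with parameter noise model (context), with probability at least $1-3\delta$ the regret of the VASE algorithm (context) run on $\mathcal{A}$ is bounded by $$\widetilde{O}\Big(d^2+\sqrt{dT\log(K/\delta)\,M_\sigma}\Big),\qquad M_\sigma=\min\Big\{\max_{a\in\mathcal{A}}a^\top\Sigma a,\ \max_{a\in\mathcal{A}}\|a\|_2^2\,\mathrm{tr}(\Sigma)\Big\}.$$ Here $\widetilde O$ hides logarithmic factors.
   Context: Stochastic linear bandits with parameter noise: there is a fixed unknown distribution $\nu$ on $\mathbb{R}^d$ with mean $\theta^\star$ and covariance matrix $\Sigma$. For $t=1,\dots,T$ the learner chooses $a_t\in\mathcal{A}$, the environment draws $\theta_t\sim\nu$ independently of the past, and the learner observes reward $X_t=a_t^\top\theta_t$. It is assumed that $|a^\top\theta|\le 1$ almost surely for $\theta\sim\nu$ and all $a\in\mathcal{A}$. The (pseudo-)regret is $\mathcal{R}_T=\sum_{t=1}^T(a^\star-a_t)^\top\theta^\star$ with $a^\star\in\arg\max_{a\in\mathcal{A}}a^\top\theta^\star$. For $a\in\mathcal{A}$, $\sigma^2(a)=a^\top\Sigma a$. A design on a finite set $\mathcal{B}$ is a probability vector $\pi$ on $\mathcal{B}$; with $V(\pi)=\sum_a\pi(a)aa^\top$, a G-optimal design minimizes $\max_{a\in\mathcal{B}}\|a\|_{V(\pi)^{-1}}$ (its minimal value is $\sqrt d$ and a minimizer with support of size at most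 $d(d+1)/2$ exists; the algorithm uses such a minimizer, working in the span of $\mathcal{B}$ if needed). The Stopping Rule algorithm $\mathcal{SR}(\bar\varepsilon,\bar\delta)$ (Dagum et al.) repeatedly samples a $[0,1]$-valued random variable with mean $\mu>0$ and outputs $\hat\mu$ with $|\hat\mu-\mu|\le\bar\varepsilon\mu$ with probability $1-\bar\delta$, using $O(\log(1/\bar\delta)/(\bar\varepsilon^2\mu))$ samples with probability $1-\bar\delta$. Variance estimation of action $a$ with threshold $\tau$, confidence $\bar\delta$, error $\bar\varepsilon$: each sample is $Z(a)=\max\{\tfrac14(X_s-X_{s+1})^2,\tau/2\}$ where $X_s,X_{s+1}$ are rewards of playing $a$ twice; run $\mathcal{SR}(\bar\varepsilon,\bar\delta)$ on these samples and output its estimate. VASE: set $\mathcal{A}_1=\mathcal{A}$, $t=1$, and for phases $\ell=1,2,\dots$ while $t\le T$: put $\varepsilon_\ell=2^{-\ell}$, $\delta_\ell=\delta/(K\ell(\ell+1))$, $\gamma_\ell=2\delta/(\ell(\ell+1)d(d+1))$; find a G-optimal design $\pi_\ell$ on $\mathcal{A}_\ell$; for each $a\in\mathrm{Supp}(\pi_\ell)$ run variance estimation with threshold $\varepsilon_\ell$, confidence $\gamma_\ell$, error $1/2$, obtaining $\hat\sigma^2_\ell(a)$; play each $a\in\mathrm{Supp}(\pi_\ell)$ exactly $T_\ell(a)=\lceil \tfrac{49d}{\varepsilon_\ell^2}\log(1/\delta_\ell)\hat\sigma_\ell^2(a)\pi_\ell(a)\rceil$ times; compute the weighted least squares estimator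 $\hat\theta^{(\ell)}=V_\ell^{-1}\sum_s\hat\sigma_\ell^2(a_s)^{-1}a_sX_s$ with $V_\ell=\sum_s\hat\sigma_\ell^2(a_s)^{-1}a_sa_s^\top$ (sums over these $T_\ell=\sum_aT_\ell(a)$ rounds); set $\mathcal{A}_{\ell+1}=\{a\in\mathcal{A}_\ell:\max_{b\in\mathcal{A}_\ell}(b-a)^\top\hat\theta^{(\ell)}\le 2\varepsilon_\ell\}$; increase $t$ by $T_\ell$. *)

theory Defs
  imports "HOL-Probability.Probability"
begin

text \<open>Vectors of R^d are represented as functions nat => real; only the
coordinates 0..d-1 matter. The dimension d is an explicit natural number so
that the hidden constants in the O-tilde bound are uniform in d.\<close>

type_synonym vec = "nat \<Rightarrow> real"

definition ip :: "nat \<Rightarrow> vec \<Rightarrow> vec \<Rightarrow> real" where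
  "ip d a x = (\<Sum>i<d. a i * x i)"

definition is_design :: "vec set \<Rightarrow> (vec \<Rightarrow> real) \<Rightarrow> bool" where
  "is_design B \<pi> \<longleftrightarrow> (\<forall>a. 0 \<le> \<pi> a) \<and> (\<forall>a. a \<notin> B \<longrightarrow> \<pi> a = 0) \<and> (\<Sum>a\<in>B. \<pi> a) = 1"

text \<open>Squared norm of a in the (pseudo-)inverse of V(pi) = sum_b pi(b) b b^T:
  a^T V^+ a = sup_x (2 a.x - x^T V x) for a in the range of V (the span of the
  support), and +infinity otherwise.\<close>
definition gnorm2 :: "nat \<Rightarrow> vec set \<Rightarrow> (vec \<Rightarrow> real) \<Rightarrow> vec \<Rightarrow> ereal" where
  "gnorm2 d B \<pi> a = (SUP x. ereal (2 * ip d a x - (\<Sum>b\<in>B. \<pi> b * (ip d b x)^2)))"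

definition gval :: "nat \<Rightarrow> vec set \<Rightarrow> (vec \<Rightarrow> real) \<Rightarrow> ereal" where
  "gval d B \<pi> = (MAX a\<in>B. gnorm2 d B \<pi> a)"

definition G_optimal :: "nat \<Rightarrow> vec set \<Rightarrow> (vec \<Rightarrow> real) \<Rightarrow> bool" where
  "G_optimal d B \<pi> \<longleftrightarrow> is_design B \<pi> \<and> card {a\<in>B. \<pi> a \<noteq> 0} \<le> d * (d + 1) div 2
     \<and> (\<forall>\<pi>'. is_design B \<pi>' \<longrightarrow> gval d B \<pi> \<le> gval d B \<pi>')"

subsection \<open>Stopping Rule Algorithm (Dagum et al.)\<close>

definition SR :: "real \<Rightarrow> real \<Rightarrow> (nat \<Rightarrow> real) \<Rightarrow> real \<times> nat" where
  "SR \<epsilon> \<delta> Z = (let U = 4 * (exp 1 - 2) * ln (2 / \<delta>) / \<epsilon>^2;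
                     U1 = 1 + (1 + \<epsilon>) * U;
                     N = (LEAST n. U1 \<le> (\<Sum>i<n. Z i))
                 in (U1 / real N, N))"

definition varest :: "nat \<Rightarrow> real \<Rightarrow> real \<Rightarrow> real \<Rightarrow> (nat \<Rightarrow> vec) \<Rightarrow> vec \<Rightarrow> nat \<Rightarrow> real \<times> nat" where
  "varest d \<tau> db eb \<omega> a t0 =
     (let Z = (\<lambda>i. max ((ip d a (\<omega> (t0 + 2*i)) - ip d a (\<omega> (t0 + 2*i + 1)))^2 / 4) (\<tau> / 2))
      in (fst (SR eb db Z), 2 * snd (SR eb db Z)))"

fun vest :: "nat \<Rightarrow> real \<Rightarrow> real \<Rightarrow> (nat \<Rightarrow> vec) \<Rightarrow> vec list \<Rightarrow> nat
             \<Rightarrow> (vec \<Rightarrow> real) \<times> vec list" where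
  "vest d \<tau> \<gamma> \<omega> [] t = ((\<lambda>_. 0), [])"
| "vest d \<tau> \<gamma> \<omega> (a # as) t =
     (let r = varest d \<tau> \<gamma> (1/2) \<omega> a t;
          rest = vest d \<tau> \<gamma> \<omega> as (t + snd r)
      in ((fst rest)(a := fst r), replicate (snd r) a @ snd rest))"

definition phase :: "nat \<Rightarrow> nat \<Rightarrow> real \<Rightarrow> (nat \<Rightarrow> vec) \<Rightarrow> nat \<Rightarrow> vec set \<Rightarrow> nat
                     \<Rightarrow> vec list \<times> vec set" where
  "phase d K \<delta> \<omega> l S t0 =
    (let \<epsilon> = (1/2::real)^l;
         \<delta>l = \<delta> / (real K * real l * (real l + 1));
         \<gamma> = 2 * \<delta> / (real l * (real l + 1) * real d * (real d + 1));
         \<pi> = (SOME \<pi>. G_optimal d S \<pi>);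
         xs = (SOME xs. distinct xs \<and> set xs = {a\<in>S. \<pi> a \<noteq> 0});
         ve = vest d \<epsilon> \<gamma> \<omega> xs t0;
         \<sigma>2 = fst ve;
         t1 = t0 + length (snd ve);
         Tl = (\<lambda>a. nat \<lceil>49 * real d / \<epsilon>^2 * ln (1 / \<delta>l) * \<sigma>2 a * \<pi> a\<rceil>);
         P = concat (map (\<lambda>a. replicate (Tl a) a) xs);
         X = (\<lambda>j. ip d (P ! j) (\<omega> (t1 + j)));
         \<theta>h = (SOME x. \<forall>i<d.
                 (\<Sum>j<length P. (P ! j) i * ip d (P ! j) x / \<sigma>2 (P ! j))
               = (\<Sum>j<length P. (P ! j) i * X j / \<sigma>2 (P ! j)));
         S' = {a\<in>S. (MAX b\<in>S. ip d b \<theta>h - ip d a \<theta>h) \<le> 2 * \<epsilon>}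
     in (snd ve @ P, S'))"

text \<open>State after n phases: (active set, next round, actions played so far).
  Rounds are numbered from 1; the parameter at round t is omega t.\<close>
primrec vase_state :: "nat \<Rightarrow> real \<Rightarrow> vec set \<Rightarrow> (nat \<Rightarrow> vec) \<Rightarrow> nat
                      \<Rightarrow> vec set \<times> nat \<times> vec list" where
  "vase_state d \<delta> A \<omega> 0 = (A, 1, [])"
| "vase_state d \<delta> A \<omega> (Suc n) =
     (case vase_state d \<delta> A \<omega> n of (S, t, acts) \<Rightarrow>
        (let r = phase d (card A) \<delta> \<omega> (Suc n) S t
         in (snd r, t + length (fst r), acts @ fst r)))"

text \<open>Action played at round t (1 <= t <= T): every phase plays at least one round,
  so T phases suffice to cover rounds 1..T.\<close>
definition vase_action :: "nat \<Rightarrow> real \<Rightarrow> vec set \<Rightarrow> (nat \<Rightarrow> vec) \<Rightarrow> nat \<Rightarrow> nat \<Rightarrow> vec" where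
  "vase_action d \<delta> A \<omega> T t = snd (snd (vase_state d \<delta> A \<omega> T)) ! (t - 1)"

definition vase_regret :: "nat \<Rightarrow> real \<Rightarrow> vec set \<Rightarrow> nat \<Rightarrow> (nat \<Rightarrow> vec) \<Rightarrow> vec \<Rightarrow> real" where
  "vase_regret d \<delta> A T \<omega> \<theta>s =
     (\<Sum>t=1..T. (MAX a\<in>A. ip d a \<theta>s) - ip d (vase_action d \<delta> A \<omega> T t) \<theta>s)"

definition param_mean :: "nat \<Rightarrow> vec measure \<Rightarrow> vec" where
  "param_mean d \<nu> = (\<lambda>i. if i < d then (\<integral>\<theta>. \<theta> i \<partial>\<nu>) else 0)"

definition param_cov :: "nat \<Rightarrow> vec measure \<Rightarrow> nat \<Rightarrow> nat \<Rightarrow> real" where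
  "param_cov d \<nu> i j = (\<integral>\<theta>. (\<theta> i - param_mean d \<nu> i) * (\<theta> j - param_mean d \<nu> j) \<partial>\<nu>)"

definition M_sigma :: "nat \<Rightarrow> vec set \<Rightarrow> vec measure \<Rightarrow> real" where
  "M_sigma d A \<nu> = min (MAX a\<in>A. (\<Sum>i<d. \<Sum>j<d. a i * param_cov d \<nu> i j * a j))
                        ((MAX a\<in>A. (\<Sum>i<d. (a i)^2)) * (\<Sum>i<d. param_cov d \<nu> i i))"

end

theory Submission
  imports Defs
begin

text \<open>
  A G-optimal design has value at most \<open>d\<close> and its support can be reduced by linear dependence, so
  in phase \<open>l\<close> every active \<open>b\<close> satisfies
  \<open>b\<^sup>T V\<^sub>l\<^sup>-\<^sup>1 b \<le> \<epsilon>\<^sub>l\<^sup>2 / (49 log(1/\<delta>\<^sub>l))\<close>. The stopping rule gives variance estimates that are correct up to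
  constants and at least \<open>\<epsilon>\<^sub>l / 4\<close>, so Bernstein's inequality bounds the error of the least
  squares estimate by \<open>\<epsilon>\<^sub>l\<close> on every active action. Hence the best action survives and phase \<open>l\<close>
  only plays actions with gap at most \<open>8 \<epsilon>\<^sub>l\<close>.

  All data that one stage passes to the next take countably many values (the variance
  estimates are determined by stopping times), so conditioning on the past is a countable sum over
  events that depend on finitely many rounds, and the failure probabilities add up to \<open>3 \<delta>\<close>.

  A good phase \<open>l\<close> has length at least \<open>2\<^sup>l\<close> and at most \<open>D / \<epsilon>\<^sub>l + Q / \<epsilon>\<^sub>l\<^sup>2\<close>, where \<open>D\<close> is of order
  \<open>d\<^sup>2\<close> and \<open>Q\<close> of order \<open>d log(K/\<delta>) M\<^sub>\<sigma>\<close> up to logarithms. So there are logarithmically many phases,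
  and each costs at most \<open>8 min {\<epsilon>\<^sub>l T, D + Q / \<epsilon>\<^sub>l} \<le> 8 (D + sqrt (Q T))\<close>.
\<close>

subsection \<open>Weighted Gram--Schmidt orthonormalization and the Kiefer--Wolfowitz theorem\<close>

text \<open>The estimator is a \<open>SOME\<close>-chosen solution of normal equations whose matrix
  may be singular, so measurability of it as a vector is out of reach. What saves the argument is
  that elimination only looks at \<open>ip d b\<close> of the estimate for active \<open>b\<close>.
  Such \<open>b\<close> lie in the span of the played actions, and there the value is a linear
  combination of the rewards with coefficients fixed in advance. The set of survivors is then one of
  finitely many sets, each with a measurable event. For the same reason no inverse matrix occurs: V
  is a possibly degenerate bilinear form, and V^-1 b is replaced by any x with x^T V y = b.y for all
  y. The 49 in the number of plays leaves room for a variance proxy that is off by a factor 4: the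
  Bernstein exponent becomes 49/16 log(1/\<delta>_l). The clipping of the variance samples does
  double duty: it caps the cost of the stopping rule and makes good phases exponentially long. No
  separate event controls the running time of the stopping rule, since the number of samples is the
  stopping level divided by the estimate.\<close>

lemma ip_add: "ip d a (\<lambda>i. x i + y i) = ip d a x + ip d a y"
  by (simp add: ip_def algebra_simps sum.distrib)

lemma ip_diff: "ip d a (\<lambda>i. x i - y i) = ip d a x - ip d a y"
  by (simp add: ip_def algebra_simps sum_subtractf)

lemma ip_scale: "ip d a (\<lambda>i. c * x i) = c * ip d a x"
  by (simp add: ip_def sum_distrib_left algebra_simps)

lemma ip_sum: "ip d a (\<lambda>i. \<Sum>k\<in>I. c k * e k i) = (\<Sum>k\<in>I. c k * ip d a (e k))"
proof -
  have "ip d a (\<lambda>i. \<Sum>k\<in>I. c k * e k i) = (\<Sum>i<d. \<Sum>k\<in>I. c k * (a i * e k i))"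
    by (simp add: ip_def sum_distrib_left algebra_simps)
  also have "\<dots> = (\<Sum>k\<in>I. c k * ip d a (e k))"
    by (subst sum.swap) (simp add: ip_def sum_distrib_left)
  finally show ?thesis .
qed

lemma ip_cong: "(\<And>i. i < d \<Longrightarrow> x i = y i) \<Longrightarrow> ip d a x = ip d a y"
  by (simp add: ip_def)

text \<open>The form x^T V y with V = \<Sum> w j (v j)(v j)^T. The index type is arbitrary because
  the form serves both designs, indexed by actions, and lists of plays, where an action occurs many
  times and the indices are positions.\<close>

definition bil :: "nat \<Rightarrow> 'j set \<Rightarrow> ('j \<Rightarrow> real) \<Rightarrow> ('j \<Rightarrow> vec) \<Rightarrow> vec \<Rightarrow> vec \<Rightarrow> real" where
  "bil d J w v x y = (\<Sum>j\<in>J. w j * ip d (v j) x * ip d (v j) y)"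

lemma bil_cong: 
  "(\<And>j. j \<in> J \<Longrightarrow> ip d (v j) x = ip d (v j) x') \<Longrightarrow> bil d J w v x y = bil d J w v x' y"
  "(\<And>j. j \<in> J \<Longrightarrow> ip d (v j) y = ip d (v j) y') \<Longrightarrow> bil d J w v x y = bil d J w v x y'"
  by (simp_all add: bil_def)

lemma bil_comm: "bil d J w v x y = bil d J w v y x"
  by (simp add: bil_def mult.commute mult.left_commute)

lemma bil_add: "bil d J w v (\<lambda>i. x i + y i) z = bil d J w v x z + bil d J w v y z"
  by (simp add: bil_def ip_add algebra_simps sum.distrib)

lemma bil_diff: "bil d J w v (\<lambda>i. x i - y i) z = bil d J w v x z - bil d J w v y z"
  by (simp add: bil_def ip_diff algebra_simps sum_subtractf)

lemma bil_scale: "bil d J w v (\<lambda>i. c * x i) z = c * bil d J w v x z"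
  by (simp add: bil_def ip_scale sum_distrib_left algebra_simps)

lemma bil_scale_right: "bil d J w v z (\<lambda>i. c * x i) = c * bil d J w v z x"
  by (simp add: bil_def ip_scale sum_distrib_left algebra_simps)

lemma bil_sum: "bil d J w v (\<lambda>i. \<Sum>k\<in>I. c k * e k i) z = (\<Sum>k\<in>I. c k * bil d J w v (e k) z)"
proof -
  have "bil d J w v (\<lambda>i. \<Sum>k\<in>I. c k * e k i) z
      = (\<Sum>j\<in>J. \<Sum>k\<in>I. c k * (w j * ip d (v j) (e k) * ip d (v j) z))"
    by (simp add: bil_def ip_sum sum_distrib_left sum_distrib_right algebra_simps)
  also have "\<dots> = (\<Sum>k\<in>I. c k * bil d J w v (e k) z)"
    by (subst sum.swap) (simp add: bil_def sum_distrib_left)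
  finally show ?thesis .
qed

lemma bil_self: "bil d J w v x x = (\<Sum>j\<in>J. w j * (ip d (v j) x)^2)"
  by (simp add: bil_def power2_eq_square mult.assoc)

lemma bil_self_eq_0_iff:
  assumes "finite J" "\<And>j. j \<in> J \<Longrightarrow> 0 < w j"
  shows "bil d J w v x x = 0 \<longleftrightarrow> (\<forall>j\<in>J. ip d (v j) x = 0)"
proof -
  have "bil d J w v x x = 0 \<longleftrightarrow> (\<forall>j\<in>J. w j * (ip d (v j) x)^2 = 0)"
    unfolding bil_self using assms by (intro sum_nonneg_eq_0_iff) (auto simp: less_imp_le)
  also have "\<dots> \<longleftrightarrow> (\<forall>j\<in>J. ip d (v j) x = 0)"
    using assms(2) by fastforce
  finally show ?thesis .
qed

lemma bil_self_nonneg: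
  assumes "\<And>j. j \<in> J \<Longrightarrow> 0 < w j"
  shows "0 \<le> bil d J w v x x"
  unfolding bil_self using assms by (intro sum_nonneg) (auto simp: less_imp_le)

text \<open>Gram-Schmidt on the first \<open>k\<close> unit vectors, for a form that may be
  degenerate: a residual of norm zero is discarded, hence \<open>r \<le> k\<close>, and
  \<open>x\<close> equals its expansion only after pairing with each \<open>v j\<close>, that is, up
  to null vectors.\<close>

lemma gram_schmidt:
  fixes d :: nat and v :: "'j \<Rightarrow> vec"
  assumes J: "finite J" and w: "\<And>j. j \<in> J \<Longrightarrow> 0 < w j"
  shows "\<exists>(r::nat) e. r \<le> k \<and> (\<forall>i<r. \<forall>j<r. bil d J w v (e i) (e j) = (if i = j then 1 else 0))
     \<and> (\<forall>x. (\<forall>i\<ge>k. x i = 0) \<longrightarrow>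
          (\<forall>j\<in>J. ip d (v j) x = ip d (v j) (\<lambda>i. \<Sum>l<r. bil d J w v x (e l) * e l i)))"
proof (induction k)
  case 0
  show ?case by (intro exI[of _ 0]) (auto simp: ip_def)
next
  case (Suc k)
  let ?b = "bil d J w v"
  obtain r e where r: "r \<le> k"
    and on: "\<And>i j. i < r \<Longrightarrow> j < r \<Longrightarrow> ?b (e i) (e j) = (if i = j then 1 else 0)"
    and sp: "\<And>x j. (\<forall>i\<ge>k. x i = 0) \<Longrightarrow> j \<in> J \<Longrightarrow>
       ip d (v j) x = ip d (v j) (\<lambda>i. \<Sum>l<r. ?b x (e l) * e l i)"
    using Suc.IH by blast
  define u :: vec where "u = (\<lambda>i. if i = k then 1 else 0)"
  define z :: vec where "z = (\<lambda>i. u i - (\<Sum>l<r. ?b u (e l) * e l i))"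
  define x' :: "vec \<Rightarrow> vec" where "x' x = (\<lambda>i. if i = k then 0 else x i)" for x
  have x': "x = (\<lambda>i. x' x i + x k * u i)" for x
    by (auto simp: x'_def u_def)
  have x'0: "\<forall>i\<ge>k. x' x i = 0" if "\<forall>i\<ge>Suc k. x i = 0" for x
    using that by (auto simp: x'_def)
  have ze: "?b z (e i) = 0" if "i < r" for i
  proof -
    have "(\<Sum>l<r. ?b u (e l) * ?b (e l) (e i)) = (\<Sum>l<r. if l = i then ?b u (e l) else 0)"
      using on that by (intro sum.cong) auto
    then show ?thesis
      unfolding z_def bil_diff bil_sum using that by simp
  qed
  \<comment> \<open>modulo null vectors, the residual of x is x k times the residual z of u\<close>
  have res: "ip d (v j) x = (\<Sum>l<r. ?b x (e l) * ip d (v j) (e l)) + x k * ip d (v j) z"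
    if "\<forall>i\<ge>Suc k. x i = 0" "j \<in> J" for x j
  proof -
    have "ip d (v j) x = ip d (v j) (x' x) + x k * ip d (v j) u"
      by (subst x'[of x]) (simp only: ip_add ip_scale)
    also have "ip d (v j) (x' x) = (\<Sum>l<r. ?b (x' x) (e l) * ip d (v j) (e l))"
      using sp[OF x'0[OF that(1)] that(2)] by (simp only: ip_sum)
    also have "ip d (v j) u = ip d (v j) z + (\<Sum>l<r. ?b u (e l) * ip d (v j) (e l))"
      unfolding z_def ip_diff ip_sum by simp
    also have "(\<Sum>l<r. ?b (x' x) (e l) * ip d (v j) (e l))
        + x k * (ip d (v j) z + (\<Sum>l<r. ?b u (e l) * ip d (v j) (e l)))
      = (\<Sum>l<r. (?b (x' x) (e l) + x k * ?b u (e l)) * ip d (v j) (e l)) + x k * ip d (v j) z"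
      by (simp add: algebra_simps sum.distrib sum_distrib_left)
    also have "(\<lambda>l. ?b (x' x) (e l) + x k * ?b u (e l)) = (\<lambda>l. ?b x (e l))"
      by (subst (2) x'[of x]) (simp only: bil_add bil_scale)
    finally show ?thesis .
  qed
  show ?case
  proof (cases "?b z z = 0")
    case True
    then have "\<forall>j\<in>J. ip d (v j) z = 0" 
      using bil_self_eq_0_iff[where J=J and w=w, OF J w] by blast
    then show ?thesis using r on res
      by (intro exI[of _ r] exI[of _ e]) (auto simp: ip_sum)
  next
    case False
    define c where "c = sqrt (?b z z)"
    have c: "c > 0" "c * c = ?b z z" using False bil_self_nonneg[where J=J and w=w, OF w, of d v z]
      by (auto simp: c_def)
    define er :: vec where "er = (\<lambda>i. inverse c * z i)"
    define e' where "e' = (\<lambda>l. if l = r then er else e l)"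
    have ere: "?b er (e i) = 0" "?b (e i) er = 0" if "i < r" for i
      using ze[OF that] bil_comm[of d J w v z "e i"] unfolding er_def bil_scale bil_scale_right by auto
    have erer: "?b er er = 1"
      using c(1) unfolding er_def bil_scale bil_scale_right c(2)[symmetric] by (simp add: field_simps)
    have on': "?b (e' i) (e' j) = (if i = j then 1 else 0)" if "i < Suc r" "j < Suc r" for i j
      using that on ere erer by (auto simp: e'_def less_Suc_eq)
    have sp': "ip d (v j) x = ip d (v j) (\<lambda>i. \<Sum>l<Suc r. ?b x (e' l) * e' l i)"
      if x: "\<forall>i\<ge>Suc k. x i = 0" and j: "j \<in> J" for x j
    proof -
      have "?b x er = ?b (\<lambda>i. (\<Sum>l<r. ?b x (e l) * e l i) + x k * z i) er"
        by (rule bil_cong) (simp add: res[OF x] ip_add ip_sum ip_scale)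
      also have "\<dots> = x k * ?b z er"
        unfolding bil_add bil_sum bil_scale using ere by simp
      also have "?b z er = c"
        using c(1) unfolding er_def bil_scale_right c(2)[symmetric] by simp
      finally have "?b x er * ip d (v j) er = x k * ip d (v j) z"
        using c by (simp add: er_def ip_scale)
      moreover have "ip d (v j) (\<lambda>i. \<Sum>l<Suc r. ?b x (e' l) * e' l i)
         = (\<Sum>l<r. ?b x (e l) * ip d (v j) (e l)) + ?b x er * ip d (v j) er"
        unfolding ip_sum by (simp add: e'_def)
      ultimately show ?thesis using res[OF x j] by simp
    qed
    show ?thesis using r on' sp' by (intro exI[of _ "Suc r"] exI[of _ e']) auto
  qed
qed

lemma orthonormal_system:
  fixes d :: nat and v :: "'j \<Rightarrow> vec"
  assumes J: "finite J" and w: "\<And>j. j \<in> J \<Longrightarrow> 0 < w j"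
  obtains r :: nat and e where "r \<le> d"
    "\<And>i j. i < r \<Longrightarrow> j < r \<Longrightarrow> bil d J w v (e i) (e j) = (if i = j then 1 else 0)"
    "\<And>x j. j \<in> J \<Longrightarrow> ip d (v j) x = ip d (v j) (\<lambda>i. \<Sum>l<r. bil d J w v x (e l) * e l i)"
proof -
  obtain r e where r: "r \<le> d"
    and on: "\<And>i j. i < r \<Longrightarrow> j < r \<Longrightarrow> bil d J w v (e i) (e j) = (if i = j then 1 else 0)"
    and sp: "\<And>x j. (\<forall>i\<ge>d. x i = 0) \<Longrightarrow> j \<in> J \<Longrightarrow>
       ip d (v j) x = ip d (v j) (\<lambda>i. \<Sum>l<r. bil d J w v x (e l) * e l i)"
    using gram_schmidt[where J=J and w=w, OF J w, of d d v] by blast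
  have "ip d (v j) x = ip d (v j) (\<lambda>i. \<Sum>l<r. bil d J w v x (e l) * e l i)" if "j \<in> J" for x j
  proof -
    define y :: vec where "y = (\<lambda>i. if i < d then x i else 0)"
    have y: "ip d a x = ip d a y" for a by (rule ip_cong) (simp add: y_def)
    have "bil d J w v x z = bil d J w v y z" for z by (rule bil_cong) (rule y)
    then show ?thesis using sp[of y j] that y by (simp add: y_def)
  qed
  with r on show ?thesis using that by blast
qed

text \<open>The representer is \<Sum> (a.e l) e l. The assumption on \<open>a\<close> says that it
  annihilates the null space of the form, so the part of \<open>y\<close> outside the orthonormal
  system contributes nothing to \<open>ip d a y\<close>.\<close>

lemma riesz_representer:
  fixes d :: nat and v :: "'j \<Rightarrow> vec"
  assumes J: "finite J" and w: "\<And>j. j \<in> J \<Longrightarrow> 0 < w j"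
    and a: "\<And>z. (\<forall>j\<in>J. ip d (v j) z = 0) \<Longrightarrow> ip d a z = 0"
  obtains x where "\<And>y. bil d J w v x y = ip d a y"
proof -
  obtain r :: nat and e where "r \<le> d"
    and "\<And>i j. i < r \<Longrightarrow> j < r \<Longrightarrow> bil d J w v (e i) (e j) = (if i = j then 1 else 0)"
    and sp: "\<And>x j. j \<in> J \<Longrightarrow> ip d (v j) x = ip d (v j) (\<lambda>i. \<Sum>l<r. bil d J w v x (e l) * e l i)"
    using orthonormal_system[where J=J and w=w and v=v and d=d, OF J w] by blast
  have "bil d J w v (\<lambda>i. \<Sum>l<r. ip d a (e l) * e l i) y = ip d a y" for y
  proof -
    have "ip d a (\<lambda>i. y i - (\<Sum>l<r. bil d J w v y (e l) * e l i)) = 0"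
    proof (intro a ballI)
      fix j assume "j \<in> J"
      from sp[OF this, of y]
      show "ip d (v j) (\<lambda>i. y i - (\<Sum>l<r. bil d J w v y (e l) * e l i)) = 0"
        unfolding ip_diff by linarith
    qed
    then have "ip d a y = (\<Sum>l<r. bil d J w v y (e l) * ip d a (e l))"
      by (simp add: ip_diff ip_sum)
    then show ?thesis
      unfolding bil_sum by (auto intro!: sum.cong simp: bil_comm[of d J w v y "e _"])
  qed
  then show ?thesis using that by blast
qed

text \<open>The leverage scores \<open>f a\<close> play the role of \<open>a\<^sup>T V(w)\<^sup>-\<^sup>1 a\<close>; their weighted sum is the
  rank of \<open>V(w)\<close>.\<close>

lemma leverage_scores:
  assumes J: "finite B" and w: "\<And>b. b \<in> B \<Longrightarrow> 0 < w b"
    and nz: "\<And>a. a \<in> B \<Longrightarrow> \<exists>x. ip d a x \<noteq> 0"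
  shows "\<exists>f. (\<forall>a\<in>B. 0 < f a \<and> (\<forall>x. (ip d a x)^2 \<le> f a * (\<Sum>b\<in>B. w b * (ip d b x)^2)))
    \<and> (\<Sum>a\<in>B. w a * f a) \<le> real d"
proof -
  let ?b = "bil d B w (\<lambda>b. b)"
  obtain r :: nat and e where r: "r \<le> d"
    and on: "\<And>i j. i < r \<Longrightarrow> j < r \<Longrightarrow> ?b (e i) (e j) = (if i = j then 1 else 0)"
    and sp: "\<And>x a. a \<in> B \<Longrightarrow> ip d a x = ip d a (\<lambda>i. \<Sum>l<r. ?b x (e l) * e l i)"
    using orthonormal_system[where J=B and w=w and v="\<lambda>b. b" and d=d, OF J w] by blast
  \<comment> \<open>This is a^T V(w)^+ a in orthonormal coordinates. Parseval (\<open>q\<close>) and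
    Cauchy-Schwarz give \<open>le\<close>; swapping sums gives the trace \<open>r\<close> of the
    Gram matrix.\<close>
  define f where "f a = (\<Sum>l<r. (ip d a (e l))^2)" for a
  have q: "(\<Sum>b\<in>B. w b * (ip d b x)^2) = (\<Sum>l<r. (?b x (e l))^2)" for x
  proof -
    have "(\<Sum>b\<in>B. w b * (ip d b x)^2) = ?b x x" by (simp add: bil_self)
    also have "\<dots> = ?b (\<lambda>i. \<Sum>l<r. ?b x (e l) * e l i) x"
      by (rule bil_cong) (rule sp)
    also have "\<dots> = (\<Sum>l<r. (?b x (e l))^2)"
      unfolding bil_sum power2_eq_square by (auto intro!: sum.cong simp: bil_comm[of d B w _ x "e _"])
    finally show ?thesis .
  qed
  have le: "(ip d a x)^2 \<le> f a * (\<Sum>b\<in>B. w b * (ip d b x)^2)" if "a \<in> B" for a x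
  proof -
    have "(ip d a x)^2 = (\<Sum>l<r. ?b x (e l) * ip d a (e l))^2"
      by (subst sp[OF that]) (simp add: ip_sum)
    also have "\<dots> \<le> (\<Sum>l<r. (?b x (e l))^2) * (\<Sum>l<r. (ip d a (e l))^2)"
      by (rule Cauchy_Schwarz_ineq_sum)
    finally show ?thesis by (simp add: q f_def mult.commute)
  qed
  have f0: "0 < f a" if "a \<in> B" for a
  proof -
    have "f a \<ge> 0" by (simp add: f_def sum_nonneg)
    moreover have "f a \<noteq> 0"
    proof
      assume "f a = 0"
      then have "(ip d a x)^2 \<le> 0" for x using le[OF that, of x] by simp
      then show False using nz[OF that] by auto
    qed
    ultimately show ?thesis by simp
  qed
  have "(\<Sum>a\<in>B. w a * f a) = (\<Sum>l<r. ?b (e l) (e l))"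
    unfolding f_def bil_self sum_distrib_left by (rule sum.swap)
  also have "\<dots> = real r" using on by simp
  finally show ?thesis using f0 le r by (intro exI[of _ f]) auto
qed

text \<open>Kiefer--Wolfowitz up to any factor above 1. Multiply each weight by its leverage score and
  iterate. The product of the scores of \<open>a\<close> telescopes, and the logarithm of a score is convex in
  the weights, so the average of the iterates has all scores at most \<open>(card B)\<^sup>1\<^sup>/\<^sup>N\<close>.\<close>

lemma near_optimal_weights:
  fixes N :: nat
  assumes B: "finite B" "B \<noteq> {}" and d: "1 \<le> d" and N: "0 < N"
    and nz: "\<And>a. a \<in> B \<Longrightarrow> \<exists>x. ip d a x \<noteq> 0"
  shows "\<exists>\<pi>. is_design B \<pi> \<and>
    (\<forall>a\<in>B. \<forall>x. (ip d a x)^2 \<le> root N (card B) * d * (\<Sum>b\<in>B. \<pi> b * (ip d b x)^2))"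
proof -
  let ?ok = "\<lambda>w f. (\<forall>a\<in>B. 0 < f a \<and> (\<forall>x. (ip d a x)^2 \<le> f a * (\<Sum>b\<in>B. w b * (ip d b x)^2)))
    \<and> (\<Sum>a\<in>B. w a * f a) \<le> real d"
  define F where "F w = (SOME f. ?ok w f)" for w
  have F: "?ok w (F w)" if "\<And>b. b \<in> B \<Longrightarrow> 0 < w b" for w
    unfolding F_def using someI_ex[OF leverage_scores[OF B(1) that nz]] .
  have card: "0 < real (card B)" using B by (simp add: card_gt_0_iff)
  \<comment> \<open>Uniform start with total mass \<open>d\<close>; every later iterate has total at
    most \<open>d\<close>, being the weighted sum of the previous leverage scores.\<close>
  define W where "W k = ((\<lambda>w a. w a * F w a) ^^ k) (\<lambda>_. real d / card B)" for k
  have W0: "W 0 = (\<lambda>_. real d / card B)" by (simp add: W_def)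
  have WS: "W (Suc k) a = W k a * F (W k) a" for k a by (simp add: W_def)
  have Wpos: "0 < W k b" if "b \<in> B" for k b
  proof -
    have "\<forall>b\<in>B. 0 < W k b"
    proof (induction k)
      case 0 then show ?case using d card by (simp add: W0)
    next
      case (Suc k) then show ?case using F[of "W k"] by (simp add: WS)
    qed
    then show ?thesis using that by blast
  qed
  have FW: "?ok (W k) (F (W k))" for k by (rule F) (rule Wpos)
  have Wsum: "(\<Sum>a\<in>B. W k a) \<le> real d" for k
  proof (cases k)
    case 0 then show ?thesis using card by (simp add: W0)
  next
    case (Suc j) then show ?thesis using FW[of j] by (simp add: WS)
  qed
  have Wle: "W k a \<le> real d" if "a \<in> B" for k a
    using member_le_sum[of a B "W k"] that B Wpos[of _ k] Wsum[of k] by (force intro: less_imp_le)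
  have prodF: "(\<Prod>k<n. F (W k) a) = W n a / W 0 a" if "a \<in> B" for n a
  proof (induction n)
    case 0 then show ?case using Wpos[OF that, of 0] by simp
  next
    case (Suc n) then show ?case by (simp add: WS)
  qed
  define q where "q k x = (\<Sum>b\<in>B. W k b * (ip d b x)^2)" for k x
  define W' where "W' b = (\<Sum>k<N. W k b) / N" for b
  have q0: "0 \<le> q k x" for k x
    unfolding q_def using Wpos[of _ k] by (intro sum_nonneg mult_nonneg_nonneg) (auto intro: less_imp_le)
  have qavg: "(\<Sum>k<N. q k x) / N = (\<Sum>b\<in>B. W' b * (ip d b x)^2)" for x
    unfolding q_def by (subst sum.swap) (simp add: W'_def sum_divide_distrib sum_distrib_right)
  have key: "(ip d a x)^2 \<le> root N (card B) * (\<Sum>b\<in>B. W' b * (ip d b x)^2)" if a: "a \<in> B" for a x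
  proof -
    let ?q = "\<Sum>b\<in>B. W' b * (ip d b x)^2"
    have q'0: "0 \<le> ?q" unfolding qavg[symmetric] by (simp add: q0 sum_nonneg)
    have "((ip d a x)^2) ^ N = (\<Prod>k<N. (ip d a x)^2)" by simp
    also have "\<dots> \<le> (\<Prod>k<N. F (W k) a * q k x)"
      using FW a by (intro prod_mono) (auto simp: q_def)
    also have "\<dots> = W N a / W 0 a * (\<Prod>k<N. q k x)"
      by (simp add: prod.distrib prodF[OF a])
    also have "\<dots> \<le> card B * ?q ^ N"
    proof (rule mult_mono)
      \<comment> \<open>\<open>W N a\<close> is at most the total \<open>d\<close>, and
        \<open>W 0 a\<close> is \<open>d / card B\<close>: all N steps together lose one factor
        \<open>card B\<close>, of which the N-th root is taken.\<close>
      show "W N a / W 0 a \<le> card B"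
        using Wle[OF a, of N] card d by (simp add: W0 field_simps)
      \<comment> \<open>AM-GM over the iterates passes from the product of the forms to the form of
        the averaged weights.\<close>
      have "root N (\<Prod>k<N. q k x) \<le> (\<Sum>k<N. q k x) / N"
        using arith_geom_mean[of "{..<N}" "\<lambda>k. q k x"] N q0 by (simp add: root_powr_inverse sum_divide_distrib prod_nonneg lessThan_empty_iff)
      then have "root N (\<Prod>k<N. q k x) ^ N \<le> ?q ^ N"
        unfolding qavg using N q0 by (intro power_mono) (auto simp: prod_nonneg)
      then show "(\<Prod>k<N. q k x) \<le> ?q ^ N"
        using N q0 by (simp add: prod_nonneg)
    qed (use q0 in \<open>auto simp: prod_nonneg\<close>)
    also have "\<dots> = (root N (card B) * ?q) ^ N"
      using N by (simp add: power_mult_distrib)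
    finally have "((ip d a x)^2) ^ N \<le> (root N (card B) * ?q) ^ N" .
    moreover have "0 \<le> root N (card B) * ?q" using q'0 N by (intro mult_nonneg_nonneg) (auto intro: real_root_ge_zero)
    ultimately show ?thesis using N by (simp add: power_mono_iff)
  qed
  have W'pos: "0 < W' b" if "b \<in> B" for b
    unfolding W'_def using N Wpos[OF that] by (intro divide_pos_pos sum_pos) (auto simp: lessThan_empty_iff)
  \<comment> \<open>Renormalizing to mass one costs the factor \<open>m \<le> d\<close>, which is
    the \<open>d\<close> in the final bound.\<close>
  define m where "m = (\<Sum>b\<in>B. W' b)"
  have m0: "0 < m" unfolding m_def using B W'pos by (intro sum_pos) auto
  have md: "m \<le> d"
  proof -
    have "m = (\<Sum>k<N. \<Sum>b\<in>B. W k b) / N"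
      unfolding m_def W'_def by (subst sum.swap) (simp add: sum_divide_distrib)
    also have "\<dots> \<le> (\<Sum>k<N. real d) / N"
      by (intro divide_right_mono sum_mono Wsum) auto
    finally show ?thesis using N by simp
  qed
  define \<pi> where "\<pi> b = (if b \<in> B then W' b / m else 0)" for b
  have "is_design B \<pi>"
    unfolding is_design_def using W'pos m0
    by (auto simp: \<pi>_def less_imp_le m_def sum_divide_distrib[symmetric])
  moreover have "(ip d a x)^2 \<le> root N (card B) * d * (\<Sum>b\<in>B. \<pi> b * (ip d b x)^2)" if a: "a \<in> B" for a x
  proof -
    have "(\<Sum>b\<in>B. W' b * (ip d b x)^2) = m * (\<Sum>b\<in>B. \<pi> b * (ip d b x)^2)"
      using m0 by (simp add: sum_distrib_left \<pi>_def)
    also have "\<dots> \<le> d * (\<Sum>b\<in>B. \<pi> b * (ip d b x)^2)"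
      using md W'pos m0 by (intro mult_right_mono sum_nonneg) (auto simp: \<pi>_def less_imp_le)
    finally have "root N (card B) * (\<Sum>b\<in>B. W' b * (ip d b x)^2)
        \<le> root N (card B) * (d * (\<Sum>b\<in>B. \<pi> b * (ip d b x)^2))"
      using N by (intro mult_left_mono) (auto intro: real_root_ge_zero)
    then show ?thesis using key[OF a, of x] by (simp add: mult.assoc)
  qed
  ultimately show ?thesis by blast
qed


text \<open>Elimination: an equation with a nonzero coefficient at \<open>a0\<close> is solved for
  \<open>c a0\<close> and substituted into the others, which leaves one equation and one unknown
  less.\<close>

lemma homogeneous_system_nontrivial:
  fixes \<phi> :: "'k \<Rightarrow> 'a \<Rightarrow> real"
  assumes "finite I" "finite S" "card I < card S"
  shows "\<exists>c. (\<exists>a\<in>S. c a \<noteq> 0) \<and> (\<forall>k\<in>I. (\<Sum>a\<in>S. c a * \<phi> k a) = 0)"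
  using assms
proof (induction I arbitrary: S \<phi> rule: finite_induct)
  case empty
  then obtain a where "a \<in> S" by fastforce
  then show ?case by (intro exI[of _ "\<lambda>_. 1"]) auto
next
  case (insert k I)
  show ?case
  proof (cases "\<forall>a\<in>S. \<phi> k a = 0")
    case True
    obtain c where "\<exists>a\<in>S. c a \<noteq> 0" "\<forall>k\<in>I. (\<Sum>a\<in>S. c a * \<phi> k a) = 0"
      using insert.IH[of S \<phi>] insert.prems insert.hyps by auto
    with True show ?thesis by (intro exI[of _ c]) auto
  next
    case False
    then obtain a0 where a0: "a0 \<in> S" "\<phi> k a0 \<noteq> 0" by blast
    define S' where "S' = S - {a0}"
    have S': "S = insert a0 S'" "a0 \<notin> S'" "finite S'" "card I < card S'"
      using a0 insert.prems insert.hyps by (auto simp: S'_def)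
    obtain c where c: "\<exists>a\<in>S'. c a \<noteq> 0"
      "\<And>i. i \<in> I \<Longrightarrow> (\<Sum>a\<in>S'. c a * (\<phi> i a - \<phi> i a0 / \<phi> k a0 * \<phi> k a)) = 0"
      using insert.IH[of S' "\<lambda>i a. \<phi> i a - \<phi> i a0 / \<phi> k a0 * \<phi> k a"] S' by blast
    define c' where "c' = c(a0 := - (\<Sum>a\<in>S'. c a * \<phi> k a) / \<phi> k a0)"
    have sum: "(\<Sum>a\<in>S. c' a * \<phi> i a) = - (\<Sum>a\<in>S'. c a * \<phi> k a) / \<phi> k a0 * \<phi> i a0 + (\<Sum>a\<in>S'. c a * \<phi> i a)" for i
    proof -
      have "(\<Sum>a\<in>S'. c' a * \<phi> i a) = (\<Sum>a\<in>S'. c a * \<phi> i a)"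
        using S'(2) by (intro sum.cong) (auto simp: c'_def)
      then show ?thesis using S' by (simp add: c'_def)
    qed
    have "(\<Sum>a\<in>S. c' a * \<phi> i a) = 0" if "i \<in> insert k I" for i
    proof (cases "i = k")
      case True then show ?thesis using a0 by (simp add: sum)
    next
      case False
      then have "(\<Sum>a\<in>S'. c a * (\<phi> i a - \<phi> i a0 / \<phi> k a0 * \<phi> k a)) = 0" using that c by blast
      moreover have "(\<Sum>a\<in>S'. c a * (\<phi> i a - \<phi> i a0 / \<phi> k a0 * \<phi> k a))
        = (\<Sum>a\<in>S'. c a * \<phi> i a) - \<phi> i a0 / \<phi> k a0 * (\<Sum>a\<in>S'. c a * \<phi> k a)"
        by (simp add: algebra_simps sum_subtractf sum_distrib_left)
      ultimately show ?thesis by (simp add: sum)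
    qed
    moreover have "\<exists>a\<in>S. c' a \<noteq> 0"
      using c(1) S' by (auto simp: c'_def)
    ultimately show ?thesis by blast
  qed
qed

section \<open>Existence and value of G-optimal designs\<close>

definition qform :: "nat \<Rightarrow> vec set \<Rightarrow> (vec \<Rightarrow> real) \<Rightarrow> vec \<Rightarrow> real" where
  "qform d B \<pi> x = (\<Sum>b\<in>B. \<pi> b * (ip d b x)^2)"

lemma gval_le_iff:
  assumes "finite B" "B \<noteq> {}"
  shows "gval d B \<pi> \<le> c \<longleftrightarrow> (\<forall>a\<in>B. \<forall>x. ereal (2 * ip d a x - qform d B \<pi> x) \<le> c)"
  unfolding gval_def gnorm2_def qform_def using assms by (simp add: SUP_le_iff)

lemma gval_mono:
  assumes "finite B" "B \<noteq> {}" "\<And>x. qform d B \<pi> x \<le> qform d B \<pi>' x"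
  shows "gval d B \<pi>' \<le> gval d B \<pi>"
  unfolding gval_le_iff[OF assms(1,2)]
proof (intro ballI allI)
  fix a x assume a: "a \<in> B"
  have "ereal (2 * ip d a x - qform d B \<pi>' x) \<le> ereal (2 * ip d a x - qform d B \<pi> x)"
    using assms(3)[of x] by simp
  also have "\<dots> \<le> gval d B \<pi>"
    using gval_le_iff[OF assms(1,2), of d \<pi> "gval d B \<pi>"] a by blast
  finally show "ereal (2 * ip d a x - qform d B \<pi>' x) \<le> gval d B \<pi>" .
qed

text \<open>Scaling \<open>x\<close> by \<open>t\<close> turns the supremum into a quadratic in
  \<open>t\<close>, maximal at t = (a.x) / (x^T V x). If x^T V x = 0 the expression is linear in
  \<open>t\<close> and bounded above, so a.x = 0.\<close>

lemma gval_le_realD: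
  assumes "finite B" "B \<noteq> {}" "is_design B \<pi>" "gval d B \<pi> \<le> ereal c" "a \<in> B"
  shows "(ip d a x)^2 \<le> c * qform d B \<pi> x"
proof -
  have le: "2 * (t * ip d a x) - t^2 * qform d B \<pi> x \<le> c" for t
  proof -
    have "qform d B \<pi> (\<lambda>i. t * x i) = t^2 * qform d B \<pi> x"
      by (simp add: qform_def ip_scale power_mult_distrib sum_distrib_left algebra_simps)
    moreover have "2 * ip d a (\<lambda>i. t * x i) - qform d B \<pi> (\<lambda>i. t * x i) \<le> c"
      using assms(4,5) unfolding gval_le_iff[OF assms(1,2)] ereal_less_eq by blast
    ultimately show ?thesis by (simp add: ip_scale)
  qed
  have q0: "0 \<le> qform d B \<pi> x"
    using assms(3) by (auto simp: qform_def is_design_def intro!: sum_nonneg)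
  show ?thesis
  proof (cases "qform d B \<pi> x = 0")
    case True
    have "ip d a x = 0"
    proof (rule ccontr)
      assume nz: "ip d a x \<noteq> 0"
      \<comment> \<open>With this \<open>t\<close> the linear expression equals c + 1.\<close>
      show False using le[of "(c + 1) / (2 * ip d a x)"] nz True by simp
    qed
    then show ?thesis using True by simp
  next
    case False
    then have "qform d B \<pi> x > 0" using q0 by simp
    then show ?thesis using le[of "ip d a x / qform d B \<pi> x"]
      by (simp add: field_simps power2_eq_square)
  qed
qed

text \<open>Completing the square, (a.x - c)^2 \<ge> 0, gives the converse of
  \<open>gval_le_realD\<close>.\<close>

lemma gval_le_realI:
  assumes "finite B" "B \<noteq> {}" "0 < c" "\<And>a x. a \<in> B \<Longrightarrow> (ip d a x)^2 \<le> c * qform d B \<pi> x"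
  shows "gval d B \<pi> \<le> ereal c"
  unfolding gval_le_iff[OF assms(1,2)] ereal_less_eq
proof (intro ballI allI)
  fix a x assume "a \<in> B"
  from assms(4)[OF this, of x] have "c * (2 * ip d a x - qform d B \<pi> x) \<le> 2 * c * ip d a x - (ip d a x)^2"
    by (simp add: algebra_simps)
  also have "\<dots> \<le> c * c"
    using zero_le_power2[of "ip d a x - c"] by (simp add: power2_eq_square algebra_simps)
  finally show "2 * ip d a x - qform d B \<pi> x \<le> c" using assms(3) by simp
qed

text \<open>\<open>gval\<close> is a supremum of continuous functions and can be infinite, so only
  lower semicontinuity in the design is at hand. Without a minimum, the open sets where
  \<open>f\<close> exceeds \<open>f y\<close> would cover \<open>D\<close>; in a finite subcover the
  \<open>y\<close> with least \<open>f y\<close> lies in no member.\<close>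

lemma compact_lower_semicontinuous_attains_min:
  fixes f :: "'a::topological_space \<Rightarrow> 'b::linorder"
  assumes "compact D" "D \<noteq> {}" "\<And>c. closed {x. f x \<le> c}"
  shows "\<exists>x\<in>D. \<forall>y\<in>D. f x \<le> f y"
proof (rule ccontr)
  assume "\<not> ?thesis"
  then have ex: "\<forall>x\<in>D. \<exists>y\<in>D. f y < f x" by (auto simp: not_le)
  have op: "\<And>y. y \<in> D \<Longrightarrow> open (- {x. f x \<le> f y})" using assms(3) by (intro open_Compl)
  have cov: "D \<subseteq> (\<Union>y\<in>D. - {x. f x \<le> f y})" using ex by (auto simp: not_le)
  obtain D' where D': "D' \<subseteq> D" "finite D'" "D \<subseteq> (\<Union>y\<in>D'. - {x. f x \<le> f y})"
    using compactE_image[OF assms(1) op cov] by blast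
  then have ne: "D' \<noteq> {}" using assms(2) by auto
  obtain y where y: "y \<in> D'" "\<And>z. z \<in> D' \<Longrightarrow> f y \<le> f z"
    using arg_min_if_finite(1)[OF D'(2) ne, of f] arg_min_least[OF D'(2) ne, of _ f] by blast
  then have "y \<in> D" using D' by blast
  with D'(3) obtain z where "z \<in> D'" "\<not> f y \<le> f z" by blast
  with y show False by blast
qed

text \<open>Designs are functions on all vectors, so compactness is Tychonoff's theorem for a
  product that is {0} outside \<open>B\<close>, intersected with the closed condition on the
  total.\<close>

lemma compact_designs:
  assumes "finite B"
  shows "compact {\<pi>. is_design B \<pi>}"
proof -
  define X where "X a = (if a \<in> B then {0..1::real} else {0})" for a
  have "compactin (product_topology (\<lambda>_::vec. euclidean) UNIV) (PiE UNIV X)"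
    unfolding compactin_PiE by (auto simp: X_def)
  then have 1: "compact (PiE UNIV X)"
    by (simp add: euclidean_product_topology)
  have 2: "closed {\<pi>::vec \<Rightarrow> real. (\<Sum>a\<in>B. \<pi> a) = 1}"
    by (intro closed_Collect_eq continuous_on_sum continuous_on_product_coordinates continuous_on_const)
  have "{\<pi>. is_design B \<pi>} = PiE UNIV X \<inter> {\<pi>. (\<Sum>a\<in>B. \<pi> a) = 1}"
  proof (intro set_eqI iffI)
    fix \<pi> assume "\<pi> \<in> {\<pi>. is_design B \<pi>}"
    then have d: "is_design B \<pi>" by simp
    have "\<pi> a \<le> 1" if "a \<in> B" for a
      using member_le_sum[of a B \<pi>] assms that d by (auto simp: is_design_def)
    then show "\<pi> \<in> PiE UNIV X \<inter> {\<pi>. (\<Sum>a\<in>B. \<pi> a) = 1}"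
      using d by (auto simp: is_design_def X_def PiE_iff)
  next
    fix \<pi> assume "\<pi> \<in> PiE UNIV X \<inter> {\<pi>. (\<Sum>a\<in>B. \<pi> a) = 1}"
    then have 1: "\<And>a. \<pi> a \<in> X a" "(\<Sum>a\<in>B. \<pi> a) = 1" by (auto simp: PiE_iff)
    have "0 \<le> \<pi> a" "a \<notin> B \<longrightarrow> \<pi> a = 0" for a using 1(1)[of a] by (auto simp: X_def split: if_splits)
    then show "\<pi> \<in> {\<pi>. is_design B \<pi>}" using 1(2) by (simp add: is_design_def)
  qed
  then show ?thesis using compact_Int_closed[OF 1 2] by simp
qed

lemma point_mass_design:
  assumes "finite B" "b \<in> B"
  shows "is_design B (\<lambda>a. if a = b then 1 else 0)"
  using assms by (auto simp: is_design_def)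

lemma exists_min_design:
  assumes B: "finite B" "B \<noteq> {}"
  shows "\<exists>\<pi>. is_design B \<pi> \<and> (\<forall>\<pi>'. is_design B \<pi>' \<longrightarrow> gval d B \<pi> \<le> gval d B \<pi>')"
proof -
  have "closed {\<pi>. gval d B \<pi> \<le> c}" for c
  proof -
    have "{\<pi>. gval d B \<pi> \<le> c} = (\<Inter>a\<in>B. \<Inter>x. {\<pi>. ereal (2 * ip d a x - qform d B \<pi> x) \<le> c})"
      using gval_le_iff[OF B] by auto
    also have "closed \<dots>"
      unfolding qform_def
      by (intro closed_INT ballI closed_Collect_le continuous_on_ereal continuous_on_diff
          continuous_on_sum continuous_on_mult continuous_on_product_coordinates continuous_on_const)
    finally show ?thesis .
  qed
  then show ?thesis
    using compact_lower_semicontinuous_attains_min[OF compact_designs[OF B(1)], of "gval d B"]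
      point_mass_design[OF B(1)] B(2) by blast
qed

text \<open>Actions on which \<open>ip d a\<close> vanishes identically have no positive leverage
  score and are removed first; their inequality is trivial. If nothing is left, any point mass will
  do.\<close>

lemma exists_design_gval_le:
  assumes B: "finite B" "B \<noteq> {}" and d: "1 \<le> d" and N: "0 < N"
  shows "\<exists>\<pi>. is_design B \<pi> \<and> gval d B \<pi> \<le> ereal (root N (card B) * d)"
proof -
  define B' where "B' = {a\<in>B. \<exists>x. ip d a x \<noteq> 0}"
  have card: "1 \<le> real (card B)" using B by (simp add: Suc_leI card_gt_0_iff)
  have c: "0 < root N (card B) * d" using card N d by simp
  show ?thesis
  proof (cases "B' = {}")
    case True
    obtain b where b: "b \<in> B" using B by blast
    have "gval d B (\<lambda>a. if a = b then 1 else 0) \<le> ereal (root N (card B) * d)"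
    proof (rule gval_le_realI[OF B c])
      fix a x assume "a \<in> B"
      then have "ip d a x = 0" using True by (auto simp: B'_def)
      then show "(ip d a x)^2 \<le> root N (card B) * d * qform d B (\<lambda>a. if a = b then 1 else 0) x"
        using c by (simp add: qform_def sum_nonneg)
    qed
    then show ?thesis using point_mass_design[OF B(1) b] by blast
  next
    case False
    have B': "finite B'" "B' \<subseteq> B" using B by (auto simp: B'_def)
    obtain \<pi> where \<pi>: "is_design B' \<pi>"
      "\<And>a x. a \<in> B' \<Longrightarrow> (ip d a x)^2 \<le> root N (card B') * d * (\<Sum>b\<in>B'. \<pi> b * (ip d b x)^2)"
      using near_optimal_weights[OF B'(1) False d N] by (auto simp: B'_def)
    have eq: "(\<Sum>b\<in>B'. \<pi> b * f b) = (\<Sum>b\<in>B. \<pi> b * f b)" for f :: "vec \<Rightarrow> real"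
      using \<pi>(1) B' B by (intro sum.mono_neutral_left) (auto simp: is_design_def)
    have q0: "0 \<le> qform d B \<pi> x" for x
      using \<pi>(1) by (auto simp: qform_def is_design_def intro!: sum_nonneg)
    have des: "is_design B \<pi>" using \<pi>(1) eq[of "\<lambda>_. 1"] B' by (auto simp: is_design_def)
    have "gval d B \<pi> \<le> ereal (root N (card B) * d)"
    proof (rule gval_le_realI[OF B c])
      fix a x assume a: "a \<in> B"
      show "(ip d a x)^2 \<le> root N (card B) * d * qform d B \<pi> x"
      proof (cases "a \<in> B'")
        case True
        have "(ip d a x)^2 \<le> root N (card B') * d * qform d B \<pi> x"
          using \<pi>(2)[OF True, of x] by (simp add: qform_def eq)
        also have "\<dots> \<le> root N (card B) * d * qform d B \<pi> x"
          using q0[of x] N card_mono[OF B(1) B'(2)] by (intro mult_right_mono) auto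
        finally show ?thesis .
      next
        case False
        then have "ip d a x = 0" using a by (auto simp: B'_def)
        then show ?thesis using c q0[of x] by simp
      qed
    qed
    with des show ?thesis by blast
  qed
qed

text \<open>A minimizer beats the near-optimal design for every \<open>N\<close>, and the N-th root
  of \<open>card B\<close> tends to 1.\<close>

lemma G_optimal_value_le:
  assumes B: "finite B" "B \<noteq> {}" and d: "1 \<le> d"
    and min: "\<And>\<pi>'. is_design B \<pi>' \<Longrightarrow> gval d B \<pi> \<le> gval d B \<pi>'"
  shows "gval d B \<pi> \<le> ereal d"
proof -
  have 1: "gval d B \<pi> \<le> ereal (root (Suc N) (card B) * d)" for N
    using exists_design_gval_le[OF B d, of "Suc N"] min by (meson order_trans zero_less_Suc)
  have "(\<lambda>N. root N (card B)) \<longlonglongrightarrow> 1"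
    using B by (intro LIMSEQ_root_const) (simp add: card_gt_0_iff)
  then have "(\<lambda>N. root (Suc N) (card B)) \<longlonglongrightarrow> 1" by (rule LIMSEQ_Suc)
  then have "(\<lambda>N. ereal (root (Suc N) (card B) * d)) \<longlonglongrightarrow> ereal (1 * real d)"
    by (intro tendsto_intros)
  then show ?thesis using 1 by (intro LIMSEQ_le_const[where X="\<lambda>N. ereal (root (Suc N) (card B) * d)"]) auto
qed

section \<open>Shrinking the support of a design\<close>

lemma card_upper_triangle: "card {(i, j). j < d \<and> i \<le> j} = d * (d + 1) div (2::nat)"
proof -
  have "{(i, j). j < d \<and> i \<le> j} = (\<lambda>(j, i). (i, j)) ` (SIGMA j:{..<d}. {..j})" by auto
  then have "card {(i, j). j < d \<and> i \<le> j} = card (SIGMA j:{..<d}. {..j})"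
    by (simp add: card_image inj_on_def)
  also have "\<dots> = (\<Sum>j<d. Suc j)" by simp
  also have "\<dots> = d * (d + 1) div 2" by (induction d) auto
  finally show ?thesis .
qed

text \<open>A linear dependence among the matrices \<open>b b\<^sup>T\<close> lets one shift weight without changing
  \<open>V(\<pi>)\<close>; if this lowers the total mass, renormalizing only increases \<open>V(\<pi>)\<close>.\<close>

lemma reduce_design_support:
  assumes B: "finite B" "B \<noteq> {}" and d: "1 \<le> d" and \<pi>: "is_design B \<pi>"
    and big: "d * (d + 1) div 2 < card {a\<in>B. \<pi> a \<noteq> 0}"
  shows "\<exists>\<pi>'. is_design B \<pi>' \<and> gval d B \<pi>' \<le> gval d B \<pi>
     \<and> card {a\<in>B. \<pi>' a \<noteq> 0} < card {a\<in>B. \<pi> a \<noteq> 0}"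
proof -
  define S where "S = {a\<in>B. \<pi> a \<noteq> 0}"
  have S: "finite S" "S \<subseteq> B" using B by (auto simp: S_def)
  have \<pi>0: "0 < \<pi> a" if "a \<in> S" for a using \<pi> that by (auto simp: S_def is_design_def less_le)
  have fin: "finite {(i, j). j < d \<and> i \<le> j}"
    by (rule finite_subset[of _ "{..<d} \<times> {..<d}"]) auto
  obtain c0 where c0: "\<exists>a\<in>S. c0 a \<noteq> 0"
    "\<And>i j. j < d \<Longrightarrow> i \<le> j \<Longrightarrow> (\<Sum>a\<in>S. c0 a * (a i * a j)) = 0"
    using homogeneous_system_nontrivial[OF fin S(1), of "\<lambda>(i, j) a. a i * a j"] big
    unfolding card_upper_triangle S_def[symmetric] by auto
  \<comment> \<open>The sign is chosen so that moving along -c cannot increase the total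
    mass.\<close>
  define c where "c = (if (\<Sum>a\<in>S. c0 a) \<ge> 0 then c0 else (\<lambda>a. - c0 a))"
  have c1: "\<exists>a\<in>S. c a \<noteq> 0" using c0(1) by (auto simp: c_def)
  have c2: "(\<Sum>a\<in>S. c a) \<ge> 0" by (auto simp: c_def sum_negf)
  have c3: "(\<Sum>a\<in>S. c a * (a i * a j)) = 0" if "i < d" "j < d" for i j
  proof (cases "i \<le> j")
    case True then show ?thesis using c0(2)[OF that(2) True] by (auto simp: c_def sum_negf)
  next
    case False
    then show ?thesis using c0(2)[OF that(1), of j] by (auto simp: c_def sum_negf mult.commute[of "_ i"])
  qed
  have c4: "(\<Sum>a\<in>S. c a * (ip d a x)^2) = 0" for x
  proof -
    have "(\<Sum>a\<in>S. c a * (ip d a x)^2) = (\<Sum>a\<in>S. \<Sum>i<d. \<Sum>j<d. x i * x j * (c a * (a i * a j)))"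
      unfolding ip_def power2_eq_square sum_product sum_distrib_left
      by (intro sum.cong refl) (simp add: sum_distrib_left ac_simps)
    also have "\<dots> = (\<Sum>i<d. \<Sum>j<d. \<Sum>a\<in>S. x i * x j * (c a * (a i * a j)))"
      by (subst sum.swap, rule sum.cong[OF refl], rule sum.swap)
    also have "\<dots> = 0"
      by (simp add: sum_distrib_left[symmetric] c3)
    finally show ?thesis .
  qed
  have c5: "\<exists>a\<in>S. c a > 0"
  proof (rule ccontr)
    assume "\<not> ?thesis"
    then have "\<forall>a\<in>S. c a \<le> 0" by auto
    moreover obtain a where "a \<in> S" "c a < 0" using c1 calculation by (auto simp: less_le)
    ultimately have "(\<Sum>a\<in>S. c a) < (\<Sum>a\<in>S. 0)" using S(1) by (intro sum_strict_mono_ex1) auto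
    then show False using c2 by simp
  qed
  define P where "P = {a\<in>S. c a > 0}"
  have P: "finite P" "P \<noteq> {}" "P \<subseteq> S" using S c5 by (auto simp: P_def)
  \<comment> \<open>Ratio test: the largest step \<open>t\<close> that keeps all weights nonnegative
    makes the weight of \<open>a0\<close> vanish.\<close>
  obtain a0 where a0: "a0 \<in> P" "\<And>a. a \<in> P \<Longrightarrow> \<pi> a0 / c a0 \<le> \<pi> a / c a"
    using arg_min_if_finite(1)[OF P(1,2), of "\<lambda>a. \<pi> a / c a"]
      arg_min_least[OF P(1,2), of _ "\<lambda>a. \<pi> a / c a"] by blast
  define t where "t = \<pi> a0 / c a0"
  have t: "0 < t" using a0(1) \<pi>0 by (auto simp: t_def P_def)
  define \<rho> where "\<rho> a = (if a \<in> S then \<pi> a - t * c a else 0)" for a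
  have \<rho>0: "0 \<le> \<rho> a" for a
  proof (cases "a \<in> P")
    case True
    then show ?thesis using a0(2)[OF True] by (auto simp: \<rho>_def t_def P_def pos_le_divide_eq mult.commute)
  next
    case False
    then have "t * c a \<le> 0" if "a \<in> S" using that t by (auto simp: P_def not_less mult_nonneg_nonpos)
    then show ?thesis using \<pi>0[of a] by (auto simp: \<rho>_def)
  qed
  have \<rho>a0: "\<rho> a0 = 0" using a0(1) P by (auto simp: \<rho>_def t_def P_def)
  define m where "m = (\<Sum>a\<in>B. \<rho> a)"
  have sumB: "(\<Sum>a\<in>B. g a) = (\<Sum>a\<in>S. g a)" if "\<And>a. a \<notin> S \<Longrightarrow> g a = 0" for g :: "vec \<Rightarrow> real"
    using S B that by (intro sum.mono_neutral_right) auto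
  have \<pi>1: "(\<Sum>a\<in>S. \<pi> a) = 1"
    using \<pi> sumB[of \<pi>] by (auto simp: is_design_def S_def)
  have m: "m = 1 - t * (\<Sum>a\<in>S. c a)"
    unfolding m_def by (subst sumB) (auto simp: \<rho>_def sum_subtractf sum_distrib_left \<pi>1)
  have m1: "m \<le> 1" using m t c2 by simp
  have m0: "0 \<le> m" unfolding m_def by (intro sum_nonneg \<rho>0)
  have q\<pi>: "qform d B \<pi> x = qform d B \<rho> x" for x
  proof -
    have "qform d B \<pi> x = (\<Sum>a\<in>S. \<pi> a * (ip d a x)^2)"
      unfolding qform_def using \<pi> by (subst sumB) (auto simp: S_def is_design_def)
    moreover have "qform d B \<rho> x = (\<Sum>a\<in>S. \<pi> a * (ip d a x)^2) - t * (\<Sum>a\<in>S. c a * (ip d a x)^2)"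
      unfolding qform_def by (subst sumB) (auto simp: \<rho>_def sum_subtractf sum_distrib_left algebra_simps)
    ultimately show ?thesis by (simp add: c4)
  qed
  show ?thesis
  proof (cases "m = 0")
    \<comment> \<open>No mass is left although \<open>qform\<close> is unchanged, so V(\<pi>) = 0,
      and a point mass does at least as well with a support of size one.\<close>
    case True
    then have "\<rho> a = 0" if "a \<in> B" for a
      using that \<rho>0 B unfolding m_def by (simp add: sum_nonneg_eq_0_iff)
    then have q0: "qform d B \<pi> x = 0" for x unfolding q\<pi> by (simp add: qform_def)
    obtain b where b: "b \<in> B" using B by blast
    let ?\<delta> = "\<lambda>a. if a = b then 1 else (0::real)"
    have "gval d B ?\<delta> \<le> gval d B \<pi>"
      by (rule gval_mono[OF B]) (simp add: q0, simp add: qform_def sum_nonneg)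
    moreover have "card {a\<in>B. ?\<delta> a \<noteq> 0} < card S"
    proof -
      have "{a\<in>B. ?\<delta> a \<noteq> 0} = {b}" using b by auto
      moreover have "2 \<le> d * (d + 1)" using mult_le_mono[OF d, of 2 "d + 1"] d by simp
      ultimately show ?thesis using big unfolding S_def[symmetric] by simp
    qed
    ultimately show ?thesis using point_mass_design[OF B(1) b] unfolding S_def by blast
  next
    case False
    then have mp: "0 < m" using m0 by simp
    define \<pi>' where "\<pi>' a = \<rho> a / m" for a
    have "is_design B \<pi>'"
      unfolding is_design_def \<pi>'_def sum_divide_distrib[symmetric] m_def[symmetric]
      using \<rho>0 mp S by (auto simp: \<rho>_def[of "_::vec"])
    moreover have "gval d B \<pi>' \<le> gval d B \<pi>"
    proof (rule gval_mono[OF B])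
      fix x
      have "qform d B \<pi>' x = qform d B \<rho> x / m"
        by (simp add: qform_def \<pi>'_def sum_divide_distrib)
      moreover have "0 \<le> qform d B \<rho> x" unfolding qform_def by (intro sum_nonneg) (simp add: \<rho>0)
      ultimately show "qform d B \<pi> x \<le> qform d B \<pi>' x"
        unfolding q\<pi> using mp m1 by (simp add: pos_le_divide_eq mult_left_le)
    qed
    moreover have "card {a\<in>B. \<pi>' a \<noteq> 0} < card S"
    proof (rule psubset_card_mono[OF S(1)])
      show "{a\<in>B. \<pi>' a \<noteq> 0} \<subset> S"
        using a0(1) P \<rho>a0 by (auto simp: \<pi>'_def \<rho>_def split: if_splits)
    qed
    ultimately show ?thesis unfolding S_def by blast
  qed
qed

text \<open>Among the designs of minimal value one with the smallest support is taken;
  \<open>reduce_design_support\<close> would shrink it if it exceeded d(d+1)/2.\<close>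

lemma exists_G_optimal:
  assumes B: "finite B" "B \<noteq> {}" and d: "1 \<le> d"
  shows "\<exists>\<pi>. G_optimal d B \<pi>"
proof -
  let ?M = "\<lambda>\<pi>. is_design B \<pi> \<and> (\<forall>\<pi>'. is_design B \<pi>' \<longrightarrow> gval d B \<pi> \<le> gval d B \<pi>')"
  obtain \<pi> where \<pi>: "?M \<pi>" "\<And>\<pi>'. ?M \<pi>' \<Longrightarrow> card {a\<in>B. \<pi> a \<noteq> 0} \<le> card {a\<in>B. \<pi>' a \<noteq> 0}"
    using ex_has_least_nat[where P="?M" and m="\<lambda>\<pi>. card {a\<in>B. \<pi> a \<noteq> 0}"] exists_min_design[OF B, of d] by blast
  have "card {a\<in>B. \<pi> a \<noteq> 0} \<le> d * (d + 1) div 2"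
  proof (rule ccontr)
    assume "\<not> ?thesis"
    then obtain \<pi>' where \<pi>': "is_design B \<pi>'" "gval d B \<pi>' \<le> gval d B \<pi>"
     "card {a\<in>B. \<pi>' a \<noteq> 0} < card {a\<in>B. \<pi> a \<noteq> 0}"
      using reduce_design_support[OF B d, of \<pi>] \<pi>(1) by (auto simp: not_le)
    then have "?M \<pi>'" using \<pi>(1) order_trans by blast
    then show False using \<pi>(2)[of \<pi>'] \<pi>'(3) by simp
  qed
  then show ?thesis using \<pi>(1) by (auto simp: G_optimal_def)
qed

lemma G_optimal_bound:
  assumes B: "finite B" "B \<noteq> {}" and d: "1 \<le> d" and \<pi>: "G_optimal d B \<pi>" and a: "a \<in> B"
  shows "(ip d a x)^2 \<le> real d * qform d B \<pi> x"
  using gval_le_realD[OF B _ G_optimal_value_le[OF B d] a] \<pi> by (auto simp: G_optimal_def)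

subsection \<open>Stopping rules for independent sequences\<close>

definition sshift :: "nat \<Rightarrow> (nat \<Rightarrow> 'a) \<Rightarrow> nat \<Rightarrow> 'a" where
  "sshift n \<omega> = (\<lambda>i. \<omega> (n + i))"

lemma sshift_0 [simp]: "sshift 0 \<omega> = \<omega>"
  by (simp add: sshift_def)

lemma sshift_sshift [simp]: "sshift m (sshift n \<omega>) = sshift (n + m) \<omega>"
  by (simp add: sshift_def add.assoc)

lemma sshift_comb_seq: "sshift n (comb_seq n \<omega> \<omega>') = \<omega>'"
  by (auto simp: sshift_def comb_seq_def)

context sequence_space
begin

lemma measurable_sshift [measurable]: "sshift n \<in> measurable S S"
  unfolding sshift_def by (rule measurable_PiM_single') (auto simp: space_PiM PiE_iff)

lemma sshift_in_space: "\<omega> \<in> space S \<Longrightarrow> sshift n \<omega> \<in> space S"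
  using measurable_sshift[of n] by (auto simp: measurable_def)

text \<open>Independence of the first \<open>n\<close> coordinates and the rest: gluing two
  independent sequences with \<open>comb_seq\<close> reproduces the product measure.\<close>

lemma nn_integral_prefix_suffix:
  assumes [measurable]: "f \<in> borel_measurable S" "g \<in> borel_measurable S"
    and f: "\<And>\<omega> \<omega>'. (\<And>i. i < n \<Longrightarrow> \<omega> i = \<omega>' i) \<Longrightarrow> f \<omega> = f \<omega>'"
  shows "(\<integral>\<^sup>+\<omega>. f \<omega> * g (sshift n \<omega>) \<partial>S) = (\<integral>\<^sup>+\<omega>. f \<omega> \<partial>S) * (\<integral>\<^sup>+\<omega>. g \<omega> \<partial>S)"
proof -
  have "(\<integral>\<^sup>+\<omega>. f \<omega> * g (sshift n \<omega>) \<partial>S)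
      = (\<integral>\<^sup>+\<omega>. f \<omega> * g (sshift n \<omega>) \<partial>distr (S \<Otimes>\<^sub>M S) S (\<lambda>(\<omega>, \<omega>'). comb_seq n \<omega> \<omega>'))"
    by (simp add: PiM_comb_seq)
  also have "\<dots> = (\<integral>\<^sup>+x. (case x of (\<omega>, \<omega>') \<Rightarrow> f (comb_seq n \<omega> \<omega>') * g \<omega>') \<partial>(S \<Otimes>\<^sub>M S))"
    by (subst nn_integral_distr) (auto simp: split_beta' sshift_comb_seq measurable_comb_seq)
  also have "\<dots> = (\<integral>\<^sup>+x. (case x of (\<omega>, \<omega>') \<Rightarrow> f \<omega> * g \<omega>') \<partial>(S \<Otimes>\<^sub>M S))"
    by (intro nn_integral_cong) (auto intro!: arg_cong2[where f="(*)"] f simp: comb_seq_less)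
  also have "\<dots> = (\<integral>\<^sup>+\<omega>. \<integral>\<^sup>+\<omega>'. f \<omega> * g \<omega>' \<partial>S \<partial>S)"
    by (subst P.nn_integral_fst[symmetric]) auto
  also have "\<dots> = (\<integral>\<^sup>+\<omega>. f \<omega> \<partial>S) * (\<integral>\<^sup>+\<omega>. g \<omega> \<partial>S)"
    by (simp add: nn_integral_cmult nn_integral_multc)
  finally show ?thesis .
qed

text \<open>Consecutive blocks of \<open>k\<close> rounds are independent. Variance samples use k =
  2, single rewards k = 1.\<close>

lemma nn_integral_prod_blocks:
  assumes [measurable]: "\<And>i. h i \<in> borel_measurable S"
    and h: "\<And>i \<omega> \<omega>'. (\<And>j. j < k \<Longrightarrow> \<omega> j = \<omega>' j) \<Longrightarrow> h i \<omega> = h i \<omega>'"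
  shows "(\<integral>\<^sup>+\<omega>. (\<Prod>i<n. h i (sshift (k * i) \<omega>)) \<partial>S) = (\<Prod>i<n. \<integral>\<^sup>+\<omega>. h i \<omega> \<partial>S)"
proof (induction n)
  case 0 then show ?case by (simp add: P.emeasure_space_1)
next
  case (Suc n)
  have "(\<integral>\<^sup>+\<omega>. (\<Prod>i<n. h i (sshift (k * i) \<omega>)) * h n (sshift (k * n) \<omega>) \<partial>S)
      = (\<integral>\<^sup>+\<omega>. (\<Prod>i<n. h i (sshift (k * i) \<omega>)) \<partial>S) * (\<integral>\<^sup>+\<omega>. h n \<omega> \<partial>S)"
  proof (rule nn_integral_prefix_suffix)
    fix \<omega> \<omega>' :: "nat \<Rightarrow> 'a" assume eq: "\<And>i. i < k * n \<Longrightarrow> \<omega> i = \<omega>' i"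
    show "(\<Prod>i<n. h i (sshift (k * i) \<omega>)) = (\<Prod>i<n. h i (sshift (k * i) \<omega>'))"
    proof (intro prod.cong refl h)
      fix i j assume "i \<in> {..<n}" "j < k"
      then have "k * i + j < k * i + k" "k * Suc i \<le> k * n" by (auto intro: mult_le_mono2 simp del: mult_Suc_right)
      then have "k * i + j < k * n" by simp
      then show "sshift (k * i) \<omega> j = sshift (k * i) \<omega>' j" by (simp add: sshift_def eq)
    qed
  qed auto
  then show ?case using Suc.IH by simp
qed

text \<open>The random objects of the algorithm are sets, lists and functions without a convenient
  sigma-algebra. Discrete measurability with countable range is preserved by arbitrary maps and
  splits events into countable unions over the values.\<close>

definition countable_valued :: "((nat \<Rightarrow> 'a) \<Rightarrow> 'x) \<Rightarrow> bool" where
  "countable_valued f \<longleftrightarrow> countable (f ` space S) \<and> (\<forall>x. {\<omega>\<in>space S. f \<omega> = x} \<in> sets S)"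

lemma countable_valuedI:
  assumes "countable X" "\<And>\<omega>. \<omega> \<in> space S \<Longrightarrow> f \<omega> \<in> X"
    "\<And>x. x \<in> X \<Longrightarrow> {\<omega>\<in>space S. f \<omega> = x} \<in> sets S"
  shows "countable_valued f"
proof -
  have "{\<omega>\<in>space S. f \<omega> = x} \<in> sets S" for x
  proof (cases "x \<in> X")
    case False
    then have "{\<omega>\<in>space S. f \<omega> = x} = {}" using assms(2) by auto
    then show ?thesis by (simp only: sets.empty_sets)
  qed (rule assms(3))
  moreover have "countable (f ` space S)" by (rule countable_subset[OF _ assms(1)]) (use assms(2) in auto)
  ultimately show ?thesis by (simp add: countable_valued_def)
qed

lemma countable_valued_const: "countable_valued (\<lambda>_. c)"
  by (rule countable_valuedI[of "{c}"]) auto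

lemma countable_valued_nat:
  assumes "f \<in> measurable S (count_space (UNIV :: nat set))"
  shows "countable_valued f"
proof (rule countable_valuedI[of UNIV])
  fix x
  have "f -` {x} \<inter> space S \<in> sets S" using assms by (rule measurable_sets) simp
  then show "{\<omega>\<in>space S. f \<omega> = x} \<in> sets S"
    by (rule back_subst[where P="\<lambda>X. X \<in> sets S"]) auto
qed simp_all

lemma sets_countable_valued_bind:
  assumes f: "countable_valued f" and B: "\<And>x. x \<in> f ` space S \<Longrightarrow> B x \<in> sets S"
  shows "{\<omega>\<in>space S. sshift (n (f \<omega>)) \<omega> \<in> B (f \<omega>)} \<in> sets S"
proof -
  have "{\<omega>\<in>space S. sshift (n (f \<omega>)) \<omega> \<in> B (f \<omega>)}
      = (\<Union>x\<in>f ` space S. {\<omega>\<in>space S. f \<omega> = x} \<inter> (sshift (n x) -` B x \<inter> space S))"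
    by auto
  also have "\<dots> \<in> sets S"
    using f B by (intro sets.countable_UN' sets.Int measurable_sets[OF measurable_sshift]) (auto simp: countable_valued_def)
  finally show ?thesis .
qed

text \<open>The shape of every stage: \<open>g\<close>, chosen by the outcome of \<open>f\<close>,
  runs on the sequence shifted by \<open>n (f \<omega>)\<close>.\<close>

lemma countable_valued_bind:
  assumes f: "countable_valued f" and g: "\<And>x. x \<in> f ` space S \<Longrightarrow> countable_valued (g x)"
  shows "countable_valued (\<lambda>\<omega>. g (f \<omega>) (sshift (n (f \<omega>)) \<omega>))"
proof (rule countable_valuedI[of "\<Union>x\<in>f ` space S. g x ` space S"])
  show "countable (\<Union>x\<in>f ` space S. g x ` space S)"
    using f g unfolding countable_valued_def by (intro countable_UN) blast+
  fix y
  have "{\<omega>\<in>space S. sshift (n (f \<omega>)) \<omega> \<in> {\<omega>'\<in>space S. g (f \<omega>) \<omega>' = y}} \<in> sets S"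
    using g by (intro sets_countable_valued_bind[OF f, where B="\<lambda>x. {\<omega>\<in>space S. g x \<omega> = y}"]) (simp add: countable_valued_def)
  then show "{\<omega>\<in>space S. g (f \<omega>) (sshift (n (f \<omega>)) \<omega>) = y} \<in> sets S"
    by (rule back_subst[where P="\<lambda>X. X \<in> sets S"]) (auto simp: sshift_in_space)
qed (use sshift_in_space in blast)

lemma countable_valued_map: "countable_valued f \<Longrightarrow> countable_valued (\<lambda>\<omega>. h (f \<omega>))"
  by (rule countable_valued_bind[of f "\<lambda>x _. h x" "\<lambda>_. 0"]) (simp_all add: countable_valued_const)

text \<open>If the value of \<open>f\<close> is determined by the first \<open>n (f \<omega>)\<close> coordinates, then the remaining
  coordinates are fresh given that value (strong Markov property).\<close>

lemma emeasure_countable_valued_bind_le: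
  assumes f: "countable_valued f"
    and stop: "\<And>\<omega> \<omega>'. (\<And>i. i < n (f \<omega>) \<Longrightarrow> \<omega> i = \<omega>' i) \<Longrightarrow> f \<omega>' = f \<omega>"
    and B: "\<And>x. x \<in> f ` space S \<Longrightarrow> B x \<in> sets S \<and> emeasure S (B x) \<le> q"
  shows "emeasure S {\<omega>\<in>space S. sshift (n (f \<omega>)) \<omega> \<in> B (f \<omega>)} \<le> q"
proof -
  let ?I = "f ` space S"
  let ?F = "\<lambda>x. {\<omega>\<in>space S. f \<omega> = x}"
  let ?X = "\<lambda>x. ?F x \<inter> (sshift (n x) -` B x \<inter> space S)"
  have I: "countable ?I" using f by (simp add: countable_valued_def)
  have F: "?F x \<in> sets S" for x using f by (simp add: countable_valued_def)
  have X: "?X x \<in> sets S" if "x \<in> ?I" for x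
    using F B[OF that] by (intro sets.Int measurable_sets[OF measurable_sshift]) auto
  have le: "emeasure S (?X x) \<le> q * emeasure S (?F x)" if x: "x \<in> ?I" for x
  proof -
    have [measurable]: "B x \<in> sets S" "?F x \<in> sets S" using B[OF x] F by auto
    let ?G = "\<lambda>\<omega>. indicator {\<omega>. f \<omega> = x} \<omega> :: ennreal"
    have [measurable]: "?G \<in> borel_measurable S"
      by (subst measurable_cong[where g="indicator (?F x)"]) (auto simp: indicator_def)
    have "emeasure S (?X x) = (\<integral>\<^sup>+\<omega>. indicator (?X x) \<omega> \<partial>S)" using X[OF x] by simp
    also have "\<dots> = (\<integral>\<^sup>+\<omega>. ?G \<omega> * indicator (B x) (sshift (n x) \<omega>) \<partial>S)"
      by (intro nn_integral_cong) (auto simp: indicator_def)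
    also have "\<dots> = (\<integral>\<^sup>+\<omega>. ?G \<omega> \<partial>S) * (\<integral>\<^sup>+\<omega>. indicator (B x) \<omega> \<partial>S)"
    proof (rule nn_integral_prefix_suffix)
      fix \<omega> \<omega>' :: "nat \<Rightarrow> 'a" assume eq: "\<And>i. i < n x \<Longrightarrow> \<omega> i = \<omega>' i"
      \<comment> \<open>\<open>stop\<close> is used in both directions: either of the two sequences
        may be the one whose value is \<open>x\<close>.\<close>
      have "f \<omega> = x \<longleftrightarrow> f \<omega>' = x" using stop[of \<omega> \<omega>'] stop[of \<omega>' \<omega>] eq by auto
      then show "?G \<omega> = ?G \<omega>'" by (simp add: indicator_def)
    qed auto
    also have "(\<integral>\<^sup>+\<omega>. ?G \<omega> \<partial>S) = (\<integral>\<^sup>+\<omega>. indicator (?F x) \<omega> \<partial>S)"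
      by (intro nn_integral_cong) (auto simp: indicator_def)
    finally show ?thesis using B[OF x] F by (simp add: mult.commute mult_right_mono)
  qed
  have disj: "disjoint_family_on ?X ?I" "disjoint_family_on ?F ?I"
    by (auto simp: disjoint_family_on_def)
  have "{\<omega>\<in>space S. sshift (n (f \<omega>)) \<omega> \<in> B (f \<omega>)} = (\<Union>x\<in>?I. ?X x)" by auto
  then have "emeasure S {\<omega>\<in>space S. sshift (n (f \<omega>)) \<omega> \<in> B (f \<omega>)}
      = (\<integral>\<^sup>+x. emeasure S (?X x) \<partial>count_space ?I)"
    using emeasure_UN_countable[OF X I disj(1)] by simp
  also have "\<dots> \<le> (\<integral>\<^sup>+x. q * emeasure S (?F x) \<partial>count_space ?I)"
    by (intro nn_integral_mono le) auto
  also have "\<dots> = q * (\<integral>\<^sup>+x. emeasure S (?F x) \<partial>count_space ?I)"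
    by (simp add: nn_integral_cmult)
  also have "(\<integral>\<^sup>+x. emeasure S (?F x) \<partial>count_space ?I) = emeasure S (\<Union>x\<in>?I. ?F x)"
    using emeasure_UN_countable[OF F I disj(2)] by simp
  also have "q * \<dots> \<le> q * 1" by (intro mult_left_mono P.emeasure_le_1) simp
  finally show ?thesis by simp
qed

section \<open>Single rounds and the Chernoff method\<close>

lemma nn_integral_coordinate:
  assumes "f \<in> borel_measurable M"
  shows "(\<integral>\<^sup>+\<omega>. f (\<omega> i) \<partial>S) = (\<integral>\<^sup>+x. f x \<partial>M)"
proof -
  have "(\<integral>\<^sup>+x. f x \<partial>M) = (\<integral>\<^sup>+x. f x \<partial>distr S M (\<lambda>\<omega>. \<omega> i))" using PiM_component[of i] by simp
  also have "\<dots> = (\<integral>\<^sup>+\<omega>. f (\<omega> i) \<partial>S)" using assms by (subst nn_integral_distr) auto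
  finally show ?thesis by simp
qed

text \<open>Markov's inequality for the exponential of the sum, whose expectation factorizes over
  independent blocks. The Chernoff parameter is left inside \<open>Y\<close>.\<close>

lemma chernoff_sum:
  assumes [measurable]: "\<And>i. Y i \<in> borel_measurable S"
    and Y: "\<And>i \<omega> \<omega>'. (\<And>j. j < k \<Longrightarrow> \<omega> j = \<omega>' j) \<Longrightarrow> Y i \<omega> = Y i \<omega>'"
    and mgf: "\<And>i. i < n \<Longrightarrow> (\<integral>\<^sup>+\<omega>. ennreal (exp (Y i \<omega>)) \<partial>S) \<le> ennreal (exp (c i))"
  shows "emeasure S {\<omega>\<in>space S. u \<le> (\<Sum>i<n. Y i (sshift (k * i) \<omega>))} \<le> ennreal (exp ((\<Sum>i<n. c i) - u))"
proof -
  let ?Y = "\<lambda>\<omega>. \<Sum>i<n. Y i (sshift (k * i) \<omega>)"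
  have "emeasure S {\<omega>\<in>space S. u \<le> ?Y \<omega>} = (\<integral>\<^sup>+\<omega>. indicator {\<omega>\<in>space S. u \<le> ?Y \<omega>} \<omega> \<partial>S)"
    by (subst nn_integral_indicator) auto
  also have "\<dots> \<le> (\<integral>\<^sup>+\<omega>. ennreal (exp (- u)) * (\<Prod>i<n. ennreal (exp (Y i (sshift (k * i) \<omega>)))) \<partial>S)"
  proof (rule nn_integral_mono)
    fix \<omega>
    have "ennreal (exp (- u)) * (\<Prod>i<n. ennreal (exp (Y i (sshift (k * i) \<omega>)))) = ennreal (exp (?Y \<omega> - u))"
      by (simp add: prod_ennreal exp_sum ennreal_mult[symmetric] prod_nonneg exp_diff exp_minus divide_inverse mult.commute)
    then show "indicator {\<omega>\<in>space S. u \<le> ?Y \<omega>} \<omega>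
       \<le> ennreal (exp (- u)) * (\<Prod>i<n. ennreal (exp (Y i (sshift (k * i) \<omega>))))"
      by (auto simp: indicator_def intro!: ennreal_leI[of 1, simplified])
  qed
  also have "\<dots> = ennreal (exp (- u)) * (\<Prod>i<n. \<integral>\<^sup>+\<omega>. ennreal (exp (Y i \<omega>)) \<partial>S)"
  proof (subst nn_integral_cmult)
    show "ennreal (exp (- u)) * (\<integral>\<^sup>+\<omega>. (\<Prod>i<n. ennreal (exp (Y i (sshift (k * i) \<omega>)))) \<partial>S)
        = ennreal (exp (- u)) * (\<Prod>i<n. \<integral>\<^sup>+\<omega>. ennreal (exp (Y i \<omega>)) \<partial>S)"
    proof (rule arg_cong[where f="\<lambda>x. ennreal (exp (- u)) * x"],
        rule nn_integral_prod_blocks[where h="\<lambda>i \<omega>. ennreal (exp (Y i \<omega>))"])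
      fix i and \<omega> \<omega>' :: "nat \<Rightarrow> 'a" assume eq: "\<And>j. j < k \<Longrightarrow> \<omega> j = \<omega>' j"
      have "Y i \<omega> = Y i \<omega>'" by (rule Y) (rule eq)
      then show "ennreal (exp (Y i \<omega>)) = ennreal (exp (Y i \<omega>'))" by simp
    qed measurable
  qed measurable
  also have "\<dots> \<le> ennreal (exp (- u)) * (\<Prod>i<n. ennreal (exp (c i)))"
  proof (rule mult_left_mono)
    have "(\<Prod>i<m. \<integral>\<^sup>+\<omega>. ennreal (exp (Y i \<omega>)) \<partial>S) \<le> (\<Prod>i<m. ennreal (exp (c i)))" if "m \<le> n" for m
      using that by (induction m) (auto intro!: mult_mono mgf)
    then show "(\<Prod>i<n. \<integral>\<^sup>+\<omega>. ennreal (exp (Y i \<omega>)) \<partial>S) \<le> (\<Prod>i<n. ennreal (exp (c i)))" by simp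
  qed simp
  also have "\<dots> = ennreal (exp ((\<Sum>i<n. c i) - u))"
    by (simp add: prod_ennreal exp_sum ennreal_mult[symmetric] prod_nonneg exp_diff exp_minus divide_inverse mult.commute)
  finally show ?thesis .
qed

end

subsection \<open>Moment bounds for the noise\<close>

text \<open>For y = -t with t \<ge> 0, multiply by exp t: the product of 1 - t + t^2 with the Taylor
  lower bound 1 + t + t^2/2 of exp t is at least 1.\<close>

lemma exp_le_quadratic:
  fixes y :: real
  assumes "\<bar>y\<bar> \<le> 1"
  shows "exp y \<le> 1 + y + y^2"
proof (cases "0 \<le> y")
  case True then show ?thesis using assms by (intro exp_bound) auto
next
  case False
  define t where "t = - y"
  have t: "0 \<le> t" using False by (simp add: t_def)
  have "1 \<le> (1 - t + t^2) * (1 + t + t^2 / 2)"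
  proof -
    have "(1 - t + t^2) * (1 + t + t^2 / 2) = 1 + t^2 / 2 + t^3 / 2 + t^4 / 2"
      by (simp add: field_simps power2_eq_square power3_eq_cube power4_eq_xxxx)
    then show ?thesis using t by simp
  qed
  also have "\<dots> \<le> (1 - t + t^2) * exp t"
  proof (rule mult_left_mono)
    show "1 + t + t^2 / 2 \<le> exp t" using exp_lower_Taylor_quadratic[OF t] by simp
    have "1 - t + t^2 = (1 - t / 2)^2 + 3 / 4 * t^2" by (simp add: field_simps power2_eq_square)
    then show "0 \<le> 1 - t + t^2" by simp
  qed
  finally have "exp (- t) \<le> 1 - t + t^2"
    by (simp add: exp_minus field_simps)
  then show ?thesis by (simp add: t_def)
qed

lemma exp_chord:
  fixes z s :: real
  assumes "0 \<le> z" "z \<le> 1"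
  shows "exp (s * z) \<le> 1 + (exp s - 1) * z"
proof -
  have "convex_on UNIV (exp :: real \<Rightarrow> real)" by (rule exp_convex)
  from convex_onD[OF this assms, of 0 s] show ?thesis by (simp add: algebra_simps)
qed

context prob_space
begin

text \<open>The chord of exp on [0,1] compares \<open>Z\<close> with a Bernoulli variable of the
  same mean, so deviations are controlled relative to the mean, as the multiplicative error of the
  stopping rule requires.\<close>

lemma mgf_unit_interval_le:
  fixes Z :: "'a \<Rightarrow> real"
  assumes [measurable]: "random_variable borel Z" and Z: "AE x in M. 0 \<le> Z x \<and> Z x \<le> 1"
  shows "(\<integral>\<^sup>+x. ennreal (exp (s * Z x)) \<partial>M) \<le> ennreal (exp ((exp s - 1) * expectation Z))"
proof -
  have int: "integrable M Z"
    by (rule integrable_const_bound[where B=1]) (use Z in auto)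
  have nn: "AE x in M. 0 \<le> 1 + (exp s - 1) * Z x"
    using Z by eventually_elim (use exp_chord[of _ s] exp_gt_zero in \<open>meson less_imp_le order_trans\<close>)
  have "(\<integral>\<^sup>+x. ennreal (exp (s * Z x)) \<partial>M) \<le> (\<integral>\<^sup>+x. ennreal (1 + (exp s - 1) * Z x) \<partial>M)"
    by (rule nn_integral_mono_AE) (use Z in eventually_elim, auto intro!: ennreal_leI exp_chord)
  also have "\<dots> = ennreal (\<integral>x. 1 + (exp s - 1) * Z x \<partial>M)"
    using int nn by (intro nn_integral_eq_integral) auto
  also have "(\<integral>x. 1 + (exp s - 1) * Z x \<partial>M) = 1 + (exp s - 1) * expectation Z"
    using int by (simp add: prob_space)
  also have "\<dots> \<le> exp ((exp s - 1) * expectation Z)" by (rule exp_ge_add_one_self)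
  finally show ?thesis by (simp add: ennreal_leI)
qed

text \<open>Bernstein's version: the second moment, not the range, stands in the exponent. This is
  what makes weighting by the inverse variance pay off.\<close>

lemma mgf_bounded_centered_le:
  fixes Y :: "'a \<Rightarrow> real"
  assumes [measurable]: "random_variable borel Y" and Y: "AE x in M. \<bar>t * Y x\<bar> \<le> 1"
    and int: "integrable M Y" "integrable M (\<lambda>x. (Y x)^2)" and Y0: "expectation Y = 0"
  shows "(\<integral>\<^sup>+x. ennreal (exp (t * Y x)) \<partial>M) \<le> ennreal (exp (t^2 * expectation (\<lambda>x. (Y x)^2)))"
proof -
  have nn: "AE x in M. 0 \<le> 1 + t * Y x + t^2 * (Y x)^2"
    using Y by eventually_elim auto
  have "(\<integral>\<^sup>+x. ennreal (exp (t * Y x)) \<partial>M) \<le> (\<integral>\<^sup>+x. ennreal (1 + t * Y x + t^2 * (Y x)^2) \<partial>M)"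
  proof (rule nn_integral_mono_AE, use Y in eventually_elim)
    case (elim x)
    from exp_le_quadratic[OF this] show ?case by (intro ennreal_leI) (simp add: power_mult_distrib)
  qed
  also have "\<dots> = ennreal (\<integral>x. 1 + t * Y x + t^2 * (Y x)^2 \<partial>M)"
    using int nn by (intro nn_integral_eq_integral) auto
  also have "(\<integral>x. 1 + t * Y x + t^2 * (Y x)^2 \<partial>M) = 1 + t^2 * expectation (\<lambda>x. (Y x)^2)"
    using int by (simp add: prob_space Y0)
  also have "\<dots> \<le> exp (t^2 * expectation (\<lambda>x. (Y x)^2))" by (rule exp_ge_add_one_self)
  finally show ?thesis by (simp add: ennreal_leI)
qed

end

context sequence_space
begin

lemma integrable_coordinate_iff:
  fixes f :: "'a \<Rightarrow> real"
  assumes "f \<in> borel_measurable M"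
  shows "integrable S (\<lambda>\<omega>. f (\<omega> i)) \<longleftrightarrow> integrable M f"
  using integrable_distr_eq[of "\<lambda>\<omega>. \<omega> i" S M f] assms PiM_component[of i] by simp

lemma integral_coordinate:
  fixes f :: "'a \<Rightarrow> real"
  assumes "f \<in> borel_measurable M"
  shows "(\<integral>\<omega>. f (\<omega> i) \<partial>S) = (\<integral>x. f x \<partial>M)"
  using integral_distr[of "\<lambda>\<omega>. \<omega> i" S M f] assms PiM_component[of i] by simp

lemma AE_coordinate:
  assumes "AE x in M. Q x"
  shows "AE \<omega> in S. Q (\<omega> i)"
  using AE_component[of i Q] assms by simp

lemma integral_coordinates_0_1:
  fixes f g :: "'a \<Rightarrow> real"
  assumes [measurable]: "f \<in> borel_measurable M" "g \<in> borel_measurable M"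
    and int: "integrable S (\<lambda>\<omega>. f (\<omega> 0) * g (\<omega> 1))"
  shows "(\<integral>\<omega>. f (\<omega> 0) * g (\<omega> 1) \<partial>S) = (\<integral>x. f x \<partial>M) * (\<integral>x. g x \<partial>M)"
proof -
  interpret PS: pair_sigma_finite M S ..
  have m: "(\<lambda>(s, \<omega>). case_nat s \<omega>) \<in> measurable (M \<Otimes>\<^sub>M S) S" by measurable
  have int': "integrable (M \<Otimes>\<^sub>M S) (\<lambda>x. f (fst x) * g (snd x 0))"
  proof -
    have "integrable (distr (M \<Otimes>\<^sub>M S) S (\<lambda>(s, \<omega>). case_nat s \<omega>)) (\<lambda>\<omega>. f (\<omega> 0) * g (\<omega> 1))"
      using int by (simp add: PiM_iter)
    then show ?thesis by (subst (asm) integrable_distr_eq[OF m]) (auto simp: split_beta')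
  qed
  have "(\<integral>\<omega>. f (\<omega> 0) * g (\<omega> 1) \<partial>S) = (\<integral>\<omega>. f (\<omega> 0) * g (\<omega> 1) \<partial>distr (M \<Otimes>\<^sub>M S) S (\<lambda>(s, \<omega>). case_nat s \<omega>))"
    by (simp add: PiM_iter)
  also have "\<dots> = (\<integral>x. f (fst x) * g (snd x 0) \<partial>(M \<Otimes>\<^sub>M S))"
    by (subst integral_distr[OF m]) (auto simp: split_beta')
  also have "\<dots> = (\<integral>x. \<integral>\<omega>. f x * g (\<omega> 0) \<partial>S \<partial>M)"
    using PS.integral_fst'[OF int'] by simp
  also have "\<dots> = (\<integral>x. f x \<partial>M) * (\<integral>x. g x \<partial>M)"
    by (simp add: integral_coordinate)
  finally show ?thesis .
qed

end

section \<open>The reward model: variances and variance samples\<close>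

locale parameter_noise = sequence_space \<nu> for \<nu> :: "vec measure" +
  fixes d :: nat and A :: "vec set"
  assumes d: "1 \<le> d" and A: "finite A" "A \<noteq> {}"
    and sets_\<nu>: "sets \<nu> = sets (\<Pi>\<^sub>M i\<in>{..<d}. (borel :: real measure))"
    and int_coord: "\<And>i. i < d \<Longrightarrow> integrable \<nu> (\<lambda>\<theta>. \<theta> i)" "\<And>i. i < d \<Longrightarrow> integrable \<nu> (\<lambda>\<theta>. (\<theta> i)^2)"
    and bounded: "AE \<theta> in \<nu>. \<forall>a\<in>A. \<bar>ip d a \<theta>\<bar> \<le> 1"
begin

abbreviation "mean a \<equiv> ip d a (param_mean d \<nu>)"

definition "rvar a = (\<integral>\<theta>. (ip d a \<theta> - mean a)^2 \<partial>\<nu>)"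

lemma measurable_coord [measurable]: "i < d \<Longrightarrow> (\<lambda>\<theta>. \<theta> i) \<in> borel_measurable \<nu>"
  using measurable_cong_sets[OF sets_\<nu> refl] by (auto intro: measurable_component_singleton)

lemma measurable_ip [measurable]: "ip d a \<in> borel_measurable \<nu>"
proof -
  have "(\<lambda>\<theta>. \<Sum>i<d. a i * \<theta> i) \<in> borel_measurable \<nu>"
    by (intro borel_measurable_sum borel_measurable_times measurable_coord) auto
  then show ?thesis by (simp add: ip_def[abs_def])
qed

lemma integrable_ip: "integrable \<nu> (ip d a)"
proof -
  have "integrable \<nu> (\<lambda>\<theta>. \<Sum>i<d. a i * \<theta> i)" using int_coord(1) by auto
  then show ?thesis by (simp add: ip_def[abs_def])
qed

lemma integral_ip: "(\<integral>\<theta>. ip d a \<theta> \<partial>\<nu>) = mean a"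
  unfolding ip_def param_mean_def using int_coord(1) by simp

lemma integrable_centered_product:
  assumes "i < d" "j < d"
  shows "integrable \<nu> (\<lambda>\<theta>. (\<theta> i - x) * (\<theta> j - y))"
proof (rule Bochner_Integration.integrable_bound)
  show "integrable \<nu> (\<lambda>\<theta>. 2 * ((\<theta> i)^2 + x^2 + (\<theta> j)^2 + y^2))"
    using int_coord(2) assms by auto
  have "\<bar>(p - x) * (q - y)\<bar> \<le> 2 * (p^2 + x^2 + q^2 + y^2)" for p q :: real
  proof -
    have "2 * \<bar>(p - x) * (q - y)\<bar> \<le> (p - x)^2 + (q - y)^2"
      using sum_squares_bound[of "\<bar>p - x\<bar>" "\<bar>q - y\<bar>"] by (simp add: abs_mult)
    moreover have "(p - x)^2 \<le> 2 * (p^2 + x^2)" "(q - y)^2 \<le> 2 * (q^2 + y^2)"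
      using zero_le_power2[of "p + x"] zero_le_power2[of "q + y"]
      by (simp_all add: power2_eq_square algebra_simps)
    ultimately show ?thesis using abs_ge_zero[of "(p - x) * (q - y)"] zero_le_power2[of p] zero_le_power2[of q] zero_le_power2[of x] zero_le_power2[of y] by argo
  qed
  then show "AE \<theta> in \<nu>. norm ((\<theta> i - x) * (\<theta> j - y)) \<le> norm (2 * ((\<theta> i)^2 + x^2 + (\<theta> j)^2 + y^2))"
    by (intro AE_I2) (simp add: order_trans[OF _ abs_ge_self])
qed (use assms in measurable)

lemma centered_ip_square:
  "(ip d a \<theta> - mean a)^2 = (\<Sum>i<d. \<Sum>j<d. a i * ((\<theta> i - param_mean d \<nu> i) * (\<theta> j - param_mean d \<nu> j)) * a j)"
proof -
  have "ip d a \<theta> - mean a = (\<Sum>i<d. a i * (\<theta> i - param_mean d \<nu> i))"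
    by (simp add: ip_def sum_subtractf algebra_simps)
  then show ?thesis
    by (simp add: power2_eq_square sum_product algebra_simps)
qed

lemma integrable_centered_ip_square: "integrable \<nu> (\<lambda>\<theta>. (ip d a \<theta> - mean a)^2)"
  unfolding centered_ip_square
  by (intro Bochner_Integration.integrable_sum integrable_mult_left integrable_mult_right integrable_centered_product) auto

lemma rvar_eq: "rvar a = (\<Sum>i<d. \<Sum>j<d. a i * param_cov d \<nu> i j * a j)"
proof -
  have int: "integrable \<nu> (\<lambda>\<theta>. a i * ((\<theta> i - param_mean d \<nu> i) * (\<theta> j - param_mean d \<nu> j)) * a j)"
    if "i \<in> {..<d}" "j \<in> {..<d}" for i j
    using that by (intro integrable_mult_left integrable_mult_right integrable_centered_product) auto
  show ?thesis
    unfolding rvar_def centered_ip_square param_cov_def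
    by (subst Bochner_Integration.integral_sum, intro Bochner_Integration.integrable_sum int, assumption+,
        intro sum.cong refl, subst Bochner_Integration.integral_sum, intro int, assumption+, simp)
qed

lemma rvar_nonneg: "0 \<le> rvar a"
  by (simp add: rvar_def)

text \<open>Cauchy-Schwarz pointwise for \<open>a\<close> and the centered parameter, then
  integration.\<close>

lemma rvar_le_trace: "rvar a \<le> (\<Sum>i<d. (a i)^2) * (\<Sum>i<d. param_cov d \<nu> i i)"
proof -
  have int: "integrable \<nu> (\<lambda>\<theta>. (\<theta> i - param_mean d \<nu> i)^2)" if "i < d" for i
    using integrable_centered_product[OF that that] by (simp add: power2_eq_square)
  have "rvar a \<le> (\<integral>\<theta>. (\<Sum>i<d. (a i)^2) * (\<Sum>i<d. (\<theta> i - param_mean d \<nu> i)^2) \<partial>\<nu>)"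
    unfolding rvar_def
  proof (rule integral_mono)
    show "integrable \<nu> (\<lambda>\<theta>. (\<Sum>i<d. (a i)^2) * (\<Sum>i<d. (\<theta> i - param_mean d \<nu> i)^2))"
      using int by auto
    fix \<theta>
    have "ip d a \<theta> - mean a = (\<Sum>i<d. a i * (\<theta> i - param_mean d \<nu> i))"
      by (simp add: ip_def sum_subtractf algebra_simps)
    then show "(ip d a \<theta> - mean a)^2 \<le> (\<Sum>i<d. (a i)^2) * (\<Sum>i<d. (\<theta> i - param_mean d \<nu> i)^2)"
      using Cauchy_Schwarz_ineq_sum[of a "\<lambda>i. \<theta> i - param_mean d \<nu> i" "{..<d}"] by simp
  qed (rule integrable_centered_ip_square)
  also have "\<dots> = (\<Sum>i<d. (a i)^2) * (\<Sum>i<d. param_cov d \<nu> i i)"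
    using int by (simp add: param_cov_def power2_eq_square)
  finally show ?thesis .
qed

lemma rvar_le_M_sigma:
  assumes a: "a \<in> A"
  shows "rvar a \<le> M_sigma d A \<nu>"
  unfolding M_sigma_def
proof (rule min.boundedI)
  show "rvar a \<le> (MAX a\<in>A. \<Sum>i<d. \<Sum>j<d. a i * param_cov d \<nu> i j * a j)"
    unfolding rvar_eq using A a by (intro Max_ge) auto
  have "(\<Sum>i<d. (a i)^2) \<le> (MAX a\<in>A. \<Sum>i<d. (a i)^2)"
    using A a by (intro Max_ge) auto
  moreover have "0 \<le> (\<Sum>i<d. param_cov d \<nu> i i)"
    unfolding param_cov_def by (intro sum_nonneg integral_nonneg_AE) auto
  ultimately show "rvar a \<le> (MAX a\<in>A. \<Sum>i<d. (a i)^2) * (\<Sum>i<d. param_cov d \<nu> i i)"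
    using rvar_le_trace[of a] by (meson mult_right_mono order_trans)
qed

lemma M_sigma_nonneg: "0 \<le> M_sigma d A \<nu>"
  using A rvar_le_M_sigma rvar_nonneg by (metis all_not_in_conv order_trans)

lemma bounded_reward: "a \<in> A \<Longrightarrow> AE \<theta> in \<nu>. \<bar>ip d a \<theta>\<bar> \<le> 1"
  using bounded by eventually_elim auto

lemma abs_mean_le_1:
  assumes a: "a \<in> A"
  shows "\<bar>mean a\<bar> \<le> 1"
proof -
  have "\<bar>\<integral>\<theta>. ip d a \<theta> \<partial>\<nu>\<bar> \<le> (\<integral>\<theta>. \<bar>ip d a \<theta>\<bar> \<partial>\<nu>)" by (rule integral_abs_bound)
  also have "\<dots> \<le> (\<integral>\<theta>. 1 \<partial>\<nu>)"
    using bounded_reward[OF a] integrable_ip[of a] by (intro integral_mono_AE) auto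
  finally show ?thesis by (simp add: integral_ip M.prob_space)
qed

definition "zsample \<tau> a \<omega> = max ((ip d a (\<omega> 0) - ip d a (\<omega> (1::nat)))^2 / 4) (\<tau> / 2)"

definition "zmean \<tau> a = (\<integral>\<omega>. zsample \<tau> a \<omega> \<partial>S)"

lemma measurable_zsample [measurable]: "zsample \<tau> a \<in> borel_measurable S"
  unfolding zsample_def[abs_def] by measurable

lemma zsample_bounded:
  assumes a: "a \<in> A" and \<tau>: "0 < \<tau>" "\<tau> \<le> 1"
  shows "AE \<omega> in S. 0 \<le> zsample \<tau> a \<omega> \<and> zsample \<tau> a \<omega> \<le> 1"
  using AE_coordinate[OF bounded_reward[OF a], of 0] AE_coordinate[OF bounded_reward[OF a], of 1]
proof eventually_elim
  case (elim \<omega>)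
  then have "\<bar>ip d a (\<omega> 0) - ip d a (\<omega> 1)\<bar> \<le> 2" by linarith
  then have "\<bar>ip d a (\<omega> 0) - ip d a (\<omega> 1)\<bar>^2 \<le> 2^2" by (intro power_mono) auto
  then show ?case using \<tau> by (auto simp: zsample_def)
qed

lemma integrable_zsample:
  assumes "a \<in> A" "0 < \<tau>" "\<tau> \<le> 1"
  shows "integrable S (zsample \<tau> a)"
  by (rule P.integrable_const_bound[where B=1]) (use zsample_bounded[OF assms] in auto)

text \<open>Independence of the two rounds kills the cross term of the centered rewards.\<close>

lemma integral_difference_square:
  "integrable S (\<lambda>\<omega>. (ip d a (\<omega> 0) - ip d a (\<omega> 1))^2)"
  "(\<integral>\<omega>. (ip d a (\<omega> 0) - ip d a (\<omega> 1))^2 \<partial>S) = 2 * rvar a"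
proof -
  define Y where "Y \<theta> = ip d a \<theta> - mean a" for \<theta>
  have [measurable]: "Y \<in> borel_measurable \<nu>" unfolding Y_def[abs_def] by measurable
  have Y2: "integrable \<nu> (\<lambda>\<theta>. (Y \<theta>)^2)" using integrable_centered_ip_square by (simp add: Y_def)
  have Y0: "(\<integral>\<theta>. Y \<theta> \<partial>\<nu>) = 0"
    using integrable_ip by (simp add: Y_def integral_ip M.prob_space)
  have i0: "integrable S (\<lambda>\<omega>. (Y (\<omega> i))^2)" for i
    using integrable_coordinate_iff[of "\<lambda>\<theta>. (Y \<theta>)^2" i] Y2 by simp
  have i01: "integrable S (\<lambda>\<omega>. Y (\<omega> 0) * Y (\<omega> 1))"
  proof (rule Bochner_Integration.integrable_bound)
    show "integrable S (\<lambda>\<omega>. (Y (\<omega> 0))^2 + (Y (\<omega> 1))^2)" using i0 by auto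
    have "\<bar>p * q\<bar> \<le> p^2 + q^2" for p q :: real
      using sum_squares_bound[of "\<bar>p\<bar>" "\<bar>q\<bar>"] abs_ge_zero[of "p * q"] unfolding power2_abs abs_mult by linarith
    then show "AE \<omega> in S. norm (Y (\<omega> 0) * Y (\<omega> 1)) \<le> norm ((Y (\<omega> 0))^2 + (Y (\<omega> 1))^2)"
      by (intro AE_I2) simp
  qed measurable
  have eq: "(ip d a (\<omega> 0) - ip d a (\<omega> 1))^2 = (Y (\<omega> 0))^2 + (Y (\<omega> 1))^2 - 2 * (Y (\<omega> 0) * Y (\<omega> 1))" for \<omega> :: "nat \<Rightarrow> vec"
    by (simp add: Y_def power2_eq_square algebra_simps)
  show "integrable S (\<lambda>\<omega>. (ip d a (\<omega> 0) - ip d a (\<omega> 1))^2)"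
    unfolding eq using i0 i01 by auto
  have "(\<integral>\<omega>. (Y (\<omega> i))^2 \<partial>S) = rvar a" for i
    using integral_coordinate[of "\<lambda>\<theta>. (Y \<theta>)^2" i] by (simp add: Y_def rvar_def)
  moreover have "(\<integral>\<omega>. Y (\<omega> 0) * Y (\<omega> 1) \<partial>S) = 0"
    using integral_coordinates_0_1[OF _ _ i01] Y0 by simp
  ultimately show "(\<integral>\<omega>. (ip d a (\<omega> 0) - ip d a (\<omega> 1))^2 \<partial>S) = 2 * rvar a"
    unfolding eq using i0[of 0] i0[of 1] i01 by simp
qed

text \<open>The larger of two nonnegative numbers lies between each of them and their sum; here the
  numbers have means rvar a / 2 and \<tau> / 2.\<close>

lemma zmean_bounds:
  assumes a: "a \<in> A" and \<tau>: "0 < \<tau>" "\<tau> \<le> 1"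
  shows "rvar a / 2 \<le> zmean \<tau> a" "\<tau> / 2 \<le> zmean \<tau> a" "zmean \<tau> a \<le> rvar a / 2 + \<tau> / 2" "zmean \<tau> a \<le> 1"
proof -
  let ?D = "\<lambda>\<omega>. (ip d a (\<omega> 0) - ip d a (\<omega> 1))^2 / 4"
  note intz = integrable_zsample[OF assms]
  have D: "integrable S ?D" "(\<integral>\<omega>. ?D \<omega> \<partial>S) = rvar a / 2"
    using integral_difference_square[of a] by auto
  show "rvar a / 2 \<le> zmean \<tau> a"
    unfolding D(2)[symmetric] zmean_def using D(1) intz by (intro integral_mono) (auto simp: zsample_def)
  have "(\<integral>\<omega>. \<tau> / 2 \<partial>S) \<le> zmean \<tau> a"
    unfolding zmean_def using intz by (intro integral_mono) (auto simp: zsample_def)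
  then show "\<tau> / 2 \<le> zmean \<tau> a" by (simp add: P.prob_space)
  have "zmean \<tau> a \<le> (\<integral>\<omega>. ?D \<omega> + \<tau> / 2 \<partial>S)"
    unfolding zmean_def using D(1) intz \<tau> by (intro integral_mono) (auto simp: zsample_def)
  also have "\<dots> = rvar a / 2 + \<tau> / 2"
    using D by (subst Bochner_Integration.integral_add) (auto simp: P.prob_space)
  finally show "zmean \<tau> a \<le> rvar a / 2 + \<tau> / 2" .
  have "zmean \<tau> a \<le> (\<integral>\<omega>. 1 \<partial>S)"
    unfolding zmean_def using zsample_bounded[OF assms] intz by (intro integral_mono_AE) auto
  then show "zmean \<tau> a \<le> 1" by (simp add: P.prob_space)
qed

end

subsection \<open>Concentration of the stopping rule and of weighted noise\<close>

lemma exp_2_5_le: "exp (2/5) \<le> (3/2 :: real)"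
proof -
  have "exp (2/5) ^ 5 = (exp 1 :: real) ^ 2" by (simp add: exp_of_nat_mult[symmetric])
  also have "\<dots> \<le> (272/100)^2" using e_less_272 by (intro power_mono) auto
  also have "\<dots> \<le> (3/2)^5" by (simp add: power2_eq_square power_def)
  finally show ?thesis by (simp add: power_mono_iff)
qed

lemma exp_1_ge: "27/10 \<le> exp (1::real)"
  using abs_le_D2[OF e_approx_32] by simp

text \<open>The stopping level \<open>U1\<close> of \<open>SR\<close> at relative error 1/2. Its
  logarithm carries the factor 24 * (exp 1 - 2), which lies between 84/5 and 18.\<close>

definition sr_threshold :: "real \<Rightarrow> real" where
  "sr_threshold \<gamma> = 1 + (1 + 1/2) * (4 * (exp 1 - 2) * ln (2 / \<gamma>) / (1/2)^2)"

lemma sr_threshold_ge: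
  assumes "0 < \<gamma>" "\<gamma> < 1"
  shows "1 + 84/5 * ln (2 / \<gamma>) \<le> sr_threshold \<gamma>"
proof -
  have "0 \<le> ln (2 / \<gamma>)" using assms by simp
  then have "84/5 * ln (2 / \<gamma>) \<le> 24 * (exp 1 - 2) * ln (2 / \<gamma>)"
    using exp_1_ge by (intro mult_right_mono) auto
  then show ?thesis by (simp add: sr_threshold_def power2_eq_square algebra_simps)
qed

lemma sr_threshold_le:
  assumes "0 < \<gamma>" "\<gamma> < 1"
  shows "sr_threshold \<gamma> \<le> 1 + 18 * ln (2 / \<gamma>)"
proof -
  have "0 \<le> ln (2 / \<gamma>)" using assms by simp
  then have "24 * (exp 1 - 2) * ln (2 / \<gamma>) \<le> 18 * ln (2 / \<gamma>)"
    using e_less_272 by (intro mult_right_mono) auto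
  then show ?thesis by (simp add: sr_threshold_def power2_eq_square algebra_simps)
qed

lemma ln_2_div_ge: "0 < \<gamma> \<Longrightarrow> \<gamma> < 1 \<Longrightarrow> 2/3 \<le> ln (2 / \<gamma> :: real)"
  using ln2_ge_two_thirds ln_less_zero[of \<gamma>] by (simp add: ln_div del: ln_less_zero_iff)

section \<open>Two-sided accuracy of the stopping rule\<close>

context parameter_noise
begin

definition "stop_index \<tau> \<gamma> a \<omega> = (LEAST n. sr_threshold \<gamma> \<le> (\<Sum>i<n. zsample \<tau> a (sshift (2 * i) \<omega>)))"

lemma varest_eq:
  "varest d \<tau> \<gamma> (1/2) \<omega> a t = (sr_threshold \<gamma> / real (stop_index \<tau> \<gamma> a (sshift t \<omega>)), 2 * stop_index \<tau> \<gamma> a (sshift t \<omega>))"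
  unfolding varest_def SR_def Let_def fst_conv snd_conv sr_threshold_def[symmetric]
  by (simp add: stop_index_def zsample_def sshift_def add.assoc)

lemma zsample_ge: "\<tau> / 2 \<le> zsample \<tau> a \<omega>"
  by (simp add: zsample_def)

lemma zsample_cong: "(\<And>j. j < 2 \<Longrightarrow> \<omega> j = \<omega>' j) \<Longrightarrow> zsample \<tau> a \<omega> = zsample \<tau> a \<omega>'"
  by (simp add: zsample_def)

lemma sr_threshold_pos: "0 < \<gamma> \<Longrightarrow> \<gamma> < 1 \<Longrightarrow> 1 \<le> sr_threshold \<gamma>"
  using sr_threshold_ge[of \<gamma>] ln_2_div_ge[of \<gamma>] by simp

lemma stop_index_ex:
  assumes "0 < \<tau>"
  shows "\<exists>n. sr_threshold \<gamma> \<le> (\<Sum>i<n. zsample \<tau> a (sshift (2 * i) \<omega>))"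
proof -
  obtain n where n: "sr_threshold \<gamma> / (\<tau> / 2) \<le> real n" using real_arch_simple by blast
  have "real n * (\<tau> / 2) = (\<Sum>i<n. \<tau> / 2)" by simp
  also have "\<dots> \<le> (\<Sum>i<n. zsample \<tau> a (sshift (2 * i) \<omega>))" by (intro sum_mono zsample_ge)
  finally show ?thesis using n assms by (intro exI[of _ n]) (simp add: field_simps)
qed

lemma stop_index_reached:
  "0 < \<tau> \<Longrightarrow> sr_threshold \<gamma> \<le> (\<Sum>i<stop_index \<tau> \<gamma> a \<omega>. zsample \<tau> a (sshift (2 * i) \<omega>))"
  unfolding stop_index_def by (rule LeastI_ex[OF stop_index_ex])

lemma stop_index_not_reached:
  "n < stop_index \<tau> \<gamma> a \<omega> \<Longrightarrow> (\<Sum>i<n. zsample \<tau> a (sshift (2 * i) \<omega>)) < sr_threshold \<gamma>"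
  unfolding stop_index_def using not_less_Least by fastforce

lemma stop_index_pos:
  assumes "0 < \<tau>" "0 < \<gamma>" "\<gamma> < 1"
  shows "0 < stop_index \<tau> \<gamma> a \<omega>"
  using stop_index_reached[OF assms(1), of \<gamma> a \<omega>] sr_threshold_pos[OF assms(2,3)] by (cases "stop_index \<tau> \<gamma> a \<omega>") auto

text \<open>The stopping time property: the partial sums up to the stopping index N see only the
  first 2 N rounds.\<close>

lemma stop_index_stopping:
  assumes \<tau>: "0 < \<tau>" and eq: "\<And>i. i < 2 * stop_index \<tau> \<gamma> a \<omega> \<Longrightarrow> \<omega> i = \<omega>' i"
  shows "stop_index \<tau> \<gamma> a \<omega>' = stop_index \<tau> \<gamma> a \<omega>"
proof -
  let ?N = "stop_index \<tau> \<gamma> a \<omega>"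
  have s: "(\<Sum>i<n. zsample \<tau> a (sshift (2 * i) \<omega>')) = (\<Sum>i<n. zsample \<tau> a (sshift (2 * i) \<omega>))" if "n \<le> ?N" for n
    using that by (intro sum.cong refl zsample_cong) (auto simp: sshift_def eq)
  show ?thesis
    unfolding stop_index_def[of \<tau> \<gamma> a \<omega>']
  proof (rule Least_equality)
    show "sr_threshold \<gamma> \<le> (\<Sum>i<?N. zsample \<tau> a (sshift (2 * i) \<omega>'))"
      using s[of ?N] stop_index_reached[OF \<tau>, of \<gamma> a \<omega>] by simp
    fix n assume n: "sr_threshold \<gamma> \<le> (\<Sum>i<n. zsample \<tau> a (sshift (2 * i) \<omega>'))"
    show "?N \<le> n"
    proof (rule ccontr)
      assume "\<not> ?N \<le> n"
      then show False using n s[of n] stop_index_not_reached[of n \<tau> \<gamma> a \<omega>] by simp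
    qed
  qed
qed

lemma measurable_stop_index [measurable]: "stop_index \<tau> \<gamma> a \<in> measurable S (count_space UNIV)"
  unfolding stop_index_def[abs_def] by measurable

definition good_estimate :: "real \<Rightarrow> vec \<Rightarrow> real \<Rightarrow> bool" where
  "good_estimate \<tau> a x \<longleftrightarrow> zmean \<tau> a / 2 \<le> x \<and> x \<le> 3/2 * zmean \<tau> a"

lemma good_estimateD:
  assumes "a \<in> A" "0 < \<tau>" "\<tau> \<le> 1" "good_estimate \<tau> a x"
  shows "\<tau> / 4 \<le> x" "rvar a / 4 \<le> x" "x \<le> rvar a + \<tau>"
  using zmean_bounds[OF assms(1-3)] assms(4) rvar_nonneg[of a] assms(2) by (auto simp: good_estimate_def)

text \<open>Both deviations are covered because \<open>s\<close> may have either sign: for s < 0 the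
  event says that the sum is at most \<open>u\<close>.\<close>

lemma zsum_chernoff:
  assumes a: "a \<in> A" and \<tau>: "0 < \<tau>" "\<tau> \<le> 1"
  shows "emeasure S {\<omega>\<in>space S. s * u \<le> (\<Sum>i<k. s * zsample \<tau> a (sshift (2 * i) \<omega>))}
     \<le> ennreal (exp ((exp s - 1) * (real k * zmean \<tau> a) - s * u))"
proof -
  have "emeasure S {\<omega>\<in>space S. s * u \<le> (\<Sum>i<k. s * zsample \<tau> a (sshift (2 * i) \<omega>))}
     \<le> ennreal (exp ((\<Sum>i<k. (exp s - 1) * zmean \<tau> a) - s * u))"
  proof (rule chernoff_sum[where Y="\<lambda>i \<omega>. s * zsample \<tau> a \<omega>"])
    fix \<omega> \<omega>' :: "nat \<Rightarrow> vec" assume eq: "\<And>j. j < 2 \<Longrightarrow> \<omega> j = \<omega>' j"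
    have "zsample \<tau> a \<omega> = zsample \<tau> a \<omega>'" by (rule zsample_cong) (rule eq)
    then show "s * zsample \<tau> a \<omega> = s * zsample \<tau> a \<omega>'" by simp
  next
    show "(\<integral>\<^sup>+\<omega>. ennreal (exp (s * zsample \<tau> a \<omega>)) \<partial>S) \<le> ennreal (exp ((exp s - 1) * zmean \<tau> a))"
      unfolding zmean_def by (rule P.mgf_unit_interval_le) (use zsample_bounded[OF assms] in auto)
  qed measurable
  then show ?thesis by (simp add: algebra_simps)
qed

text \<open>An overestimate means stopping within k = floor(2 U / (3 \<mu>)) samples, so that
  \<open>k\<close> samples already sum to U although their expected sum is at most 2/3 U.\<close>

lemma stop_index_too_small:
  assumes a: "a \<in> A" and \<tau>: "0 < \<tau>" "\<tau> \<le> 1" and \<gamma>: "0 < \<gamma>" "\<gamma> < 1"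
  shows "emeasure S {\<omega>\<in>space S. 3/2 * zmean \<tau> a < sr_threshold \<gamma> / real (stop_index \<tau> \<gamma> a \<omega>)} \<le> ennreal (\<gamma> / 2)"
proof -
  let ?U = "sr_threshold \<gamma>" and ?\<mu> = "zmean \<tau> a"
  have \<mu>: "0 < ?\<mu>" using zmean_bounds(2)[OF a \<tau>] \<tau> by linarith
  have U: "1 \<le> ?U" by (rule sr_threshold_pos[OF \<gamma>])
  define k where "k = nat \<lfloor>2 * ?U / (3 * ?\<mu>)\<rfloor>"
  have k: "real k * ?\<mu> \<le> 2/3 * ?U"
  proof -
    have "real k \<le> 2 * ?U / (3 * ?\<mu>)" unfolding k_def using \<mu> U by (simp add: of_nat_nat)
    then show ?thesis using \<mu> by (simp add: field_simps)
  qed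
  have sub: "{\<omega>\<in>space S. 3/2 * ?\<mu> < ?U / real (stop_index \<tau> \<gamma> a \<omega>)}
      \<subseteq> {\<omega>\<in>space S. 2/5 * ?U \<le> (\<Sum>i<k. 2/5 * zsample \<tau> a (sshift (2 * i) \<omega>))}"
  proof safe
    fix \<omega> assume h: "3/2 * ?\<mu> < ?U / real (stop_index \<tau> \<gamma> a \<omega>)"
    let ?N = "stop_index \<tau> \<gamma> a \<omega>"
    have N: "0 < ?N" by (rule stop_index_pos[OF \<tau>(1) \<gamma>])
    have "real ?N < 2 * ?U / (3 * ?\<mu>)" using h N \<mu> by (simp add: field_simps)
    then have "?N \<le> k" unfolding k_def by linarith
    then have "(\<Sum>i<?N. zsample \<tau> a (sshift (2 * i) \<omega>)) \<le> (\<Sum>i<k. zsample \<tau> a (sshift (2 * i) \<omega>))"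
      using \<tau> zsample_ge[of \<tau> a] by (intro sum_mono2) (auto intro: order_trans[of 0 "\<tau> / 2"])
    then have "?U \<le> (\<Sum>i<k. zsample \<tau> a (sshift (2 * i) \<omega>))"
      using stop_index_reached[OF \<tau>(1), of \<gamma> a \<omega>] by linarith
    then show "2/5 * ?U \<le> (\<Sum>i<k. 2/5 * zsample \<tau> a (sshift (2 * i) \<omega>))"
      unfolding sum_distrib_left[symmetric] by linarith
  qed
  have "emeasure S {\<omega>\<in>space S. 3/2 * ?\<mu> < ?U / real (stop_index \<tau> \<gamma> a \<omega>)}
    \<le> emeasure S {\<omega>\<in>space S. 2/5 * ?U \<le> (\<Sum>i<k. 2/5 * zsample \<tau> a (sshift (2 * i) \<omega>))}"
    by (rule emeasure_mono[OF sub]) measurable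
  also have "\<dots> \<le> ennreal (exp ((exp (2/5) - 1) * (real k * ?\<mu>) - 2/5 * ?U))"
    by (rule zsum_chernoff[OF a \<tau>])
  also have "\<dots> \<le> ennreal (\<gamma> / 2)"
  proof (rule ennreal_leI)
    have "(exp (2/5) - 1) * (real k * ?\<mu>) \<le> 1/2 * (2/3 * ?U)"
      using exp_2_5_le \<mu> by (intro mult_mono[OF _ k]) auto
    \<comment> \<open>Since exp (2/5) - 1 \<le> 1/2, the exponent is at most U/3 - 2 U/5 = - U/15,
      and 84/5 exceeds 15.\<close>
    then have "(exp (2/5) - 1) * (real k * ?\<mu>) - 2/5 * ?U \<le> - ln (2 / \<gamma>)"
      using sr_threshold_ge[OF \<gamma>] ln_2_div_ge[OF \<gamma>] by linarith
    also have "- ln (2 / \<gamma>) = ln (\<gamma> / 2)" using \<gamma> by (simp add: ln_div)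
    finally show "exp ((exp (2/5) - 1) * (real k * ?\<mu>) - 2/5 * ?U) \<le> \<gamma> / 2"
      using \<gamma> by (simp add: ln_ge_iff)
  qed
  finally show ?thesis .
qed

text \<open>An underestimate means that k = floor(2 U / \<mu>) samples have not reached U although
  their expected sum is at least 2 U - 1. The parameter - ln 2 is the optimal one for falling short
  by half.\<close>

lemma stop_index_too_large:
  assumes a: "a \<in> A" and \<tau>: "0 < \<tau>" "\<tau> \<le> 1" and \<gamma>: "0 < \<gamma>" "\<gamma> < 1"
  shows "emeasure S {\<omega>\<in>space S. sr_threshold \<gamma> / real (stop_index \<tau> \<gamma> a \<omega>) < zmean \<tau> a / 2} \<le> ennreal (\<gamma> / 2)"
proof -
  let ?U = "sr_threshold \<gamma>" and ?\<mu> = "zmean \<tau> a"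
  have \<mu>: "0 < ?\<mu>" "?\<mu> \<le> 1" using zmean_bounds(2,4)[OF a \<tau>] \<tau> by linarith+
  have U: "1 \<le> ?U" by (rule sr_threshold_pos[OF \<gamma>])
  define k where "k = nat \<lfloor>2 * ?U / ?\<mu>\<rfloor>"
  have k: "2 * ?U - 1 \<le> real k * ?\<mu>"
  proof -
    have "2 * ?U / ?\<mu> - 1 \<le> real k" unfolding k_def by linarith
    then have "(2 * ?U / ?\<mu> - 1) * ?\<mu> \<le> real k * ?\<mu>" using \<mu> by (intro mult_right_mono) auto
    then show ?thesis using \<mu> by (simp add: algebra_simps)
  qed
  have sub: "{\<omega>\<in>space S. ?U / real (stop_index \<tau> \<gamma> a \<omega>) < ?\<mu> / 2}
      \<subseteq> {\<omega>\<in>space S. (- ln 2) * ?U \<le> (\<Sum>i<k. (- ln 2) * zsample \<tau> a (sshift (2 * i) \<omega>))}"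
  proof safe
    fix \<omega> assume h: "?U / real (stop_index \<tau> \<gamma> a \<omega>) < ?\<mu> / 2"
    let ?N = "stop_index \<tau> \<gamma> a \<omega>"
    have N: "0 < ?N" by (rule stop_index_pos[OF \<tau>(1) \<gamma>])
    have "2 * ?U / ?\<mu> < real ?N" using h N \<mu> by (simp add: field_simps)
    then have "k < ?N" unfolding k_def using U \<mu> N by linarith
    from stop_index_not_reached[OF this]
    show "(- ln 2) * ?U \<le> (\<Sum>i<k. (- ln 2) * zsample \<tau> a (sshift (2 * i) \<omega>))"
      unfolding sum_distrib_left[symmetric] by (intro mult_left_mono_neg) auto
  qed
  have "emeasure S {\<omega>\<in>space S. ?U / real (stop_index \<tau> \<gamma> a \<omega>) < ?\<mu> / 2}
    \<le> emeasure S {\<omega>\<in>space S. (- ln 2) * ?U \<le> (\<Sum>i<k. (- ln 2) * zsample \<tau> a (sshift (2 * i) \<omega>))}"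
    by (rule emeasure_mono[OF sub]) measurable
  also have "\<dots> \<le> ennreal (exp ((exp (- ln 2) - 1) * (real k * ?\<mu>) - (- ln 2) * ?U))"
    by (rule zsum_chernoff[OF a \<tau>])
  also have "\<dots> \<le> ennreal (\<gamma> / 2)"
  proof (rule ennreal_leI)
    have "ln 2 * ?U \<le> 25/36 * ?U" using ln2_le_25_over_36 U by (intro mult_right_mono) auto
    moreover have "(exp (- ln 2) - 1) * (real k * ?\<mu>) = - (real k * ?\<mu>) / 2" by (simp add: exp_minus)
    \<comment> \<open>By ln 2 \<le> 25/36 the exponent is at most 1/2 - 11/36 U; the 1/2, lost by
      rounding \<open>k\<close>, is absorbed by U.\<close>
    ultimately have "(exp (- ln 2) - 1) * (real k * ?\<mu>) - (- ln 2) * ?U \<le> - ln (2 / \<gamma>)"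
      using k sr_threshold_ge[OF \<gamma>] ln_2_div_ge[OF \<gamma>] by linarith
    also have "- ln (2 / \<gamma>) = ln (\<gamma> / 2)" using \<gamma> by (simp add: ln_div)
    finally show "exp ((exp (- ln 2) - 1) * (real k * ?\<mu>) - (- ln 2) * ?U) \<le> \<gamma> / 2"
      using \<gamma> by (simp only: ln_ge_iff half_gt_zero)
  qed
  finally show ?thesis .
qed

lemma bad_estimate_measure:
  assumes a: "a \<in> A" and \<tau>: "0 < \<tau>" "\<tau> \<le> 1" and \<gamma>: "0 < \<gamma>" "\<gamma> < 1"
  shows "emeasure S {\<omega>\<in>space S. \<not> good_estimate \<tau> a (sr_threshold \<gamma> / real (stop_index \<tau> \<gamma> a \<omega>))} \<le> ennreal \<gamma>"
    (is "emeasure S ?B \<le> _")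
proof -
  let ?L = "{\<omega>\<in>space S. sr_threshold \<gamma> / real (stop_index \<tau> \<gamma> a \<omega>) < zmean \<tau> a / 2}"
  let ?H = "{\<omega>\<in>space S. 3/2 * zmean \<tau> a < sr_threshold \<gamma> / real (stop_index \<tau> \<gamma> a \<omega>)}"
  have "emeasure S ?B \<le> emeasure S (?L \<union> ?H)"
    by (intro emeasure_mono) (auto simp: good_estimate_def not_le)
  also have "\<dots> \<le> emeasure S ?L + emeasure S ?H" by (rule emeasure_subadditive) measurable
  also have "\<dots> \<le> ennreal (\<gamma> / 2) + ennreal (\<gamma> / 2)"
    by (intro add_mono stop_index_too_small stop_index_too_large assms)
  also have "\<dots> = ennreal \<gamma>" using \<gamma> by (simp flip: ennreal_plus)
  finally show ?thesis .
qed

text \<open>Bernstein with a free parameter \<open>s\<close>. Centered rewards are bounded by 2,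
  hence the 2 in the condition on \<open>c\<close>.\<close>

lemma weighted_noise_tail_one_sided:
  assumes P: "\<And>j. j < n \<Longrightarrow> P j \<in> A" and s: "0 < s"
    and c: "\<And>j. j < n \<Longrightarrow> s * (2 * \<bar>c j\<bar>) \<le> 1" and v: "(\<Sum>j<n. (c j)^2 * rvar (P j)) \<le> v"
  shows "emeasure S {\<omega>\<in>space S. u \<le> (\<Sum>j<n. c j * (ip d (P j) (\<omega> j) - mean (P j)))}
    \<le> ennreal (exp (s^2 * v - s * u))"
proof -
  \<comment> \<open>Round \<open>j\<close> is written as coordinate 0 after a shift, to fit
    \<open>chernoff_sum\<close> with blocks of length one.\<close>
  have "emeasure S {\<omega>\<in>space S. s * u \<le> (\<Sum>j<n. s * c j * (ip d (P j) (sshift (1 * j) \<omega> 0) - mean (P j)))}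
    \<le> ennreal (exp ((\<Sum>j<n. (s * c j)^2 * rvar (P j)) - s * u))"
  proof (rule chernoff_sum[where Y="\<lambda>j \<omega>. s * c j * (ip d (P j) (\<omega> 0) - mean (P j))"])
    fix j assume j: "j < n"
    let ?Y = "\<lambda>\<theta>. ip d (P j) \<theta> - mean (P j)"
    have "(\<integral>\<^sup>+\<omega>. ennreal (exp (s * c j * ?Y (\<omega> 0))) \<partial>S) = (\<integral>\<^sup>+\<theta>. ennreal (exp (s * c j * ?Y \<theta>)) \<partial>\<nu>)"
      by (rule nn_integral_coordinate) measurable
    also have "\<dots> \<le> ennreal (exp ((s * c j)^2 * (\<integral>\<theta>. (?Y \<theta>)^2 \<partial>\<nu>)))"
    proof (rule M.mgf_bounded_centered_le)
      show "AE \<theta> in \<nu>. \<bar>s * c j * ?Y \<theta>\<bar> \<le> 1"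
        using bounded_reward[OF P[OF j]]
      proof eventually_elim
        case (elim \<theta>)
        then have "\<bar>?Y \<theta>\<bar> \<le> 2" using abs_mean_le_1[OF P[OF j]] by linarith
        then have "s * \<bar>c j\<bar> * \<bar>?Y \<theta>\<bar> \<le> s * \<bar>c j\<bar> * 2" using s by (intro mult_left_mono) auto
        also have "\<dots> \<le> 1" using c[OF j] by (simp only: ac_simps)
        finally show ?case using s by (simp add: abs_mult)
      qed
      show "integrable \<nu> ?Y" using integrable_ip by simp
      show "(\<integral>\<theta>. ?Y \<theta> \<partial>\<nu>) = 0" using integrable_ip by (simp add: integral_ip M.prob_space)
    qed (use integrable_centered_ip_square in auto)
    finally show "(\<integral>\<^sup>+\<omega>. ennreal (exp (s * c j * ?Y (\<omega> 0))) \<partial>S) \<le> ennreal (exp ((s * c j)^2 * rvar (P j)))"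
      by (simp add: rvar_def)
  qed auto
  also have "{\<omega>\<in>space S. s * u \<le> (\<Sum>j<n. s * c j * (ip d (P j) (sshift (1 * j) \<omega> 0) - mean (P j)))}
     = {\<omega>\<in>space S. u \<le> (\<Sum>j<n. c j * (ip d (P j) (\<omega> j) - mean (P j)))}"
    using s by (simp add: sshift_def mult.assoc sum_distrib_left[symmetric])
  also have "(\<Sum>j<n. (s * c j)^2 * rvar (P j)) = s^2 * (\<Sum>j<n. (c j)^2 * rvar (P j))"
    by (simp add: sum_distrib_left power_mult_distrib mult.assoc)
  also have "ennreal (exp (s^2 * (\<Sum>j<n. (c j)^2 * rvar (P j)) - s * u)) \<le> ennreal (exp (s^2 * v - s * u))"
    using v by (intro ennreal_leI) (simp add: mult_left_mono)
  finally show ?thesis .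
qed

lemma weighted_noise_tail:
  assumes P: "\<And>j. j < n \<Longrightarrow> P j \<in> A" and s: "0 < s"
    and c: "\<And>j. j < n \<Longrightarrow> s * (2 * \<bar>c j\<bar>) \<le> 1" and v: "(\<Sum>j<n. (c j)^2 * rvar (P j)) \<le> v"
  shows "emeasure S {\<omega>\<in>space S. u < \<bar>\<Sum>j<n. c j * (ip d (P j) (\<omega> j) - mean (P j))\<bar>}
    \<le> ennreal (2 * exp (s^2 * v - s * u))"
proof -
  let ?E = "\<lambda>c. {\<omega>\<in>space S. u \<le> (\<Sum>j<n. c j * (ip d (P j) (\<omega> j) - mean (P j)))}"
  have E: "emeasure S (?E c) \<le> ennreal (exp (s^2 * v - s * u))"
    "emeasure S (?E (\<lambda>j. - c j)) \<le> ennreal (exp (s^2 * v - s * u))"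
    by (rule weighted_noise_tail_one_sided; use assms in simp)+
  have "emeasure S {\<omega>\<in>space S. u < \<bar>\<Sum>j<n. c j * (ip d (P j) (\<omega> j) - mean (P j))\<bar>}
      \<le> emeasure S (?E c \<union> ?E (\<lambda>j. - c j))"
    by (intro emeasure_mono) (auto simp: sum_negf)
  also have "\<dots> \<le> emeasure S (?E c) + emeasure S (?E (\<lambda>j. - c j))" by (rule emeasure_subadditive) measurable
  also have "\<dots> \<le> ennreal (exp (s^2 * v - s * u)) + ennreal (exp (s^2 * v - s * u))"
    by (intro add_mono E)
  also have "\<dots> = ennreal (2 * exp (s^2 * v - s * u))" by (simp flip: ennreal_plus)
  finally show ?thesis .
qed

end

subsection \<open>Weighted least squares and variance estimation\<close>

text \<open>The estimator inside \<open>phase\<close>, isolated. If V is singular there are many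
  solutions and an arbitrary one is meant.\<close>

definition lse :: "nat \<Rightarrow> vec list \<Rightarrow> (vec \<Rightarrow> real) \<Rightarrow> (nat \<Rightarrow> real) \<Rightarrow> vec" where
  "lse d P \<sigma>2 X = (SOME x. \<forall>i<d.
      (\<Sum>j<length P. (P ! j) i * ip d (P ! j) x / \<sigma>2 (P ! j))
    = (\<Sum>j<length P. (P ! j) i * X j / \<sigma>2 (P ! j)))"

lemma lse_cong: "(\<And>j. j < length P \<Longrightarrow> X j = X' j) \<Longrightarrow> lse d P \<sigma>2 X = lse d P \<sigma>2 X'"
  unfolding lse_def by (intro arg_cong[where f=Eps] ext) (simp cong: sum.cong_simp)

text \<open>Each played action lies in the range of V, so the reward-weighted sum of their
  representers solves the normal equations and \<open>SOME\<close> does return a solution. Unit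
  vectors translate between coordinates and testing against all \<open>y\<close>.\<close>

lemma lse_normal_equations:
  assumes pos: "\<And>j. j < length P \<Longrightarrow> 0 < \<sigma>2 (P ! j)"
  shows "bil d {..<length P} (\<lambda>j. 1 / \<sigma>2 (P ! j)) (\<lambda>j. P ! j) (lse d P \<sigma>2 X) y
    = (\<Sum>j<length P. X j / \<sigma>2 (P ! j) * ip d (P ! j) y)"
proof -
  let ?J = "{..<length P}" and ?w = "\<lambda>j. 1 / \<sigma>2 (P ! j)" and ?v = "\<lambda>j. P ! j"
  have "\<exists>x. \<forall>y. bil d ?J ?w ?v x y = ip d (P ! j) y" if "j < length P" for j
  proof (rule riesz_representer[of ?J ?w d ?v "P ! j"])
    fix x assume "\<And>y. bil d ?J ?w ?v x y = ip d (P ! j) y"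
    then show ?thesis by (intro exI allI)
  qed (use that pos in auto)
  then have "\<forall>j\<in>{..<length P}. \<exists>x. \<forall>y. bil d ?J ?w ?v x y = ip d (P ! j) y" by simp
  from bchoice[OF this] obtain r
    where "\<forall>j\<in>{..<length P}. \<forall>y. bil d ?J ?w ?v (r j) y = ip d (P ! j) y" ..
  then have r: "\<And>j y. j < length P \<Longrightarrow> bil d ?J ?w ?v (r j) y = ip d (P ! j) y" by simp
  define x :: vec where "x = (\<lambda>i. \<Sum>j<length P. (X j / \<sigma>2 (P ! j)) * r j i)"
  have x: "bil d ?J ?w ?v x y = (\<Sum>j<length P. X j / \<sigma>2 (P ! j) * ip d (P ! j) y)" for y
    unfolding x_def bil_sum using r by simp
  have unit: "ip d a (\<lambda>k. if k = i then 1 else 0) = a i" if "i < d" for a i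
  proof -
    have "ip d a (\<lambda>k. if k = i then 1 else 0) = (\<Sum>k<d. if k = i then a k else 0)"
      unfolding ip_def by (intro sum.cong) auto
    then show ?thesis using that by simp
  qed
  have "\<forall>i<d. (\<Sum>j<length P. (P ! j) i * ip d (P ! j) x / \<sigma>2 (P ! j))
    = (\<Sum>j<length P. (P ! j) i * X j / \<sigma>2 (P ! j))"
  proof (intro allI impI)
    fix i assume i: "i < d"
    have "(\<Sum>j<length P. (P ! j) i * ip d (P ! j) x / \<sigma>2 (P ! j))
        = bil d ?J ?w ?v x (\<lambda>k. if k = i then 1 else 0)"
      unfolding bil_def unit[OF i] by (intro sum.cong) auto
    also have "\<dots> = (\<Sum>j<length P. (P ! j) i * X j / \<sigma>2 (P ! j))"
      unfolding x unit[OF i] by (intro sum.cong) auto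
    finally show "(\<Sum>j<length P. (P ! j) i * ip d (P ! j) x / \<sigma>2 (P ! j))
      = (\<Sum>j<length P. (P ! j) i * X j / \<sigma>2 (P ! j))" .
  qed
  from someI[where P="\<lambda>x. \<forall>i<d. (\<Sum>j<length P. (P ! j) i * ip d (P ! j) x / \<sigma>2 (P ! j))
    = (\<Sum>j<length P. (P ! j) i * X j / \<sigma>2 (P ! j))", OF this, folded lse_def]
  have eq: "(\<Sum>j<length P. (P ! j) i * ip d (P ! j) (lse d P \<sigma>2 X) / \<sigma>2 (P ! j))
    = (\<Sum>j<length P. (P ! j) i * X j / \<sigma>2 (P ! j))" if "i < d" for i
    using that by (simp only:)
  have "bil d ?J ?w ?v (lse d P \<sigma>2 X) y
      = (\<Sum>i<d. y i * (\<Sum>j<length P. (P ! j) i * ip d (P ! j) (lse d P \<sigma>2 X) / \<sigma>2 (P ! j)))"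
    unfolding bil_def sum_distrib_left ip_def[of d "P ! _" y]
    by (subst sum.swap) (simp add: ac_simps)
  also have "\<dots> = (\<Sum>i<d. y i * (\<Sum>j<length P. (P ! j) i * X j / \<sigma>2 (P ! j)))"
    by (simp add: eq)
  also have "\<dots> = (\<Sum>j<length P. X j / \<sigma>2 (P ! j) * ip d (P ! j) y)"
    unfolding sum_distrib_left ip_def[of d "P ! _" y]
    by (subst sum.swap) (simp add: ac_simps)
  finally show ?thesis .
qed

text \<open>With \<open>x\<close> the representer of \<open>b\<close>, i.e. \<open>V x = b\<close>, the coefficients are
  \<open>c j = (P ! j)\<^sup>T x / \<sigma>2 (P ! j)\<close>.\<close>

lemma lse_coefficients:
  assumes pos: "\<And>j. j < length P \<Longrightarrow> 0 < \<sigma>2 (P ! j)" and \<kappa>: "0 \<le> \<kappa>"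
    and b: "\<And>x. (ip d b x)^2 \<le> \<kappa> * (\<Sum>j<length P. 1 / \<sigma>2 (P ! j) * (ip d (P ! j) x)^2)"
    and P: "\<And>j x. j < length P \<Longrightarrow> (ip d (P ! j) x)^2 \<le> \<kappa> * (\<Sum>j<length P. 1 / \<sigma>2 (P ! j) * (ip d (P ! j) x)^2)"
  shows "\<exists>c. (\<forall>X. ip d b (lse d P \<sigma>2 X) = (\<Sum>j<length P. c j * X j))
    \<and> (\<forall>\<theta>. ip d b \<theta> = (\<Sum>j<length P. c j * ip d (P ! j) \<theta>))
    \<and> (\<Sum>j<length P. \<sigma>2 (P ! j) * (c j)^2) \<le> \<kappa>
    \<and> (\<forall>j<length P. \<sigma>2 (P ! j) * \<bar>c j\<bar> \<le> \<kappa>)"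
proof -
  let ?B = "bil d {..<length P} (\<lambda>j. 1 / \<sigma>2 (P ! j)) (\<lambda>j. P ! j)"
  obtain x where x: "\<And>y. ?B x y = ip d b y"
  proof (rule riesz_representer[of "{..<length P}" "\<lambda>j. 1 / \<sigma>2 (P ! j)" d "\<lambda>j. P ! j" b])
    fix z assume "\<forall>j\<in>{..<length P}. ip d (P ! j) z = 0"
    then have "(ip d b z)^2 \<le> 0" using b[of z] by simp
    then show "ip d b z = 0" by simp
  next
    fix x assume "\<And>y. ?B x y = ip d b y"
    then show thesis by (rule that)
  qed (use pos in auto)
  have Q: "(\<Sum>j<length P. 1 / \<sigma>2 (P ! j) * (ip d (P ! j) x)^2) = ?B x x" by (simp add: bil_self)
  have Q0: "0 \<le> ?B x x" unfolding Q[symmetric] using pos by (intro sum_nonneg) (simp add: less_imp_le)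
  \<comment> \<open>\<open>?B x x\<close> is b^T V^-1 b and also equals b.x, so the assumption on
    \<open>b\<close> at \<open>x\<close> bounds its square by \<kappa> times itself.\<close>
  have Q\<kappa>: "?B x x \<le> \<kappa>"
  proof (cases "?B x x = 0")
    case False
    have "(?B x x)^2 \<le> \<kappa> * ?B x x"
      using b[of x] unfolding Q by (simp add: x)
    then have "?B x x * ?B x x \<le> \<kappa> * ?B x x" by (simp only: power2_eq_square)
    then show ?thesis using False Q0 by simp
  qed (use \<kappa> in simp)
  define c where "c j = ip d (P ! j) x / \<sigma>2 (P ! j)" for j
  have "ip d b (lse d P \<sigma>2 X) = (\<Sum>j<length P. c j * X j)" for X
  proof -
    have "ip d b (lse d P \<sigma>2 X) = ?B (lse d P \<sigma>2 X) x" 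
      unfolding x[symmetric] by (rule bil_comm)
    then show ?thesis
      using lse_normal_equations[of P \<sigma>2 d X x, OF pos] by (simp add: c_def ac_simps)
  qed
  moreover have "ip d b \<theta> = (\<Sum>j<length P. c j * ip d (P ! j) \<theta>)" for \<theta>
    unfolding x[symmetric] by (simp add: bil_def c_def)
  moreover have "(\<Sum>j<length P. \<sigma>2 (P ! j) * (c j)^2) \<le> \<kappa>"
  proof -
    have "(\<Sum>j<length P. \<sigma>2 (P ! j) * (c j)^2) = ?B x x"
      unfolding Q[symmetric] using pos by (intro sum.cong) (auto simp: c_def power2_eq_square field_simps)
    then show ?thesis using Q\<kappa> by simp
  qed
  \<comment> \<open>The uniform bound uses the leverage of the played action itself: |(P ! j).x| is
    at most sqrt (\<kappa> \<kappa>).\<close>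
  moreover have "\<sigma>2 (P ! j) * \<bar>c j\<bar> \<le> \<kappa>" if "j < length P" for j
  proof -
    have "(ip d (P ! j) x)^2 \<le> \<kappa> * ?B x x" using P[OF that, of x] unfolding Q .
    also have "\<dots> \<le> \<kappa>^2" using Q\<kappa> \<kappa> by (simp add: power2_eq_square mult_left_mono)
    finally have "\<bar>ip d (P ! j) x\<bar> \<le> \<kappa>" using \<kappa> power2_le_imp_le[of "\<bar>ip d (P ! j) x\<bar>" \<kappa>] by simp
    then show ?thesis using pos[OF that] by (simp add: c_def)
  qed
  ultimately show ?thesis by blast
qed

section \<open>Variance estimation along a list of actions\<close>

context parameter_noise
begin

lemma vest_shift: "vest d \<tau> \<gamma> \<omega> as t = vest d \<tau> \<gamma> (sshift t \<omega>) as 0"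
proof (induction as arbitrary: \<omega> t)
  case (Cons a as)
  let ?N = "2 * stop_index \<tau> \<gamma> a (sshift t \<omega>)"
  have "vest d \<tau> \<gamma> \<omega> as (t + ?N) = vest d \<tau> \<gamma> (sshift (t + ?N) \<omega>) as 0" by (rule Cons.IH)
  also have "\<dots> = vest d \<tau> \<gamma> (sshift t \<omega>) as ?N"
    by (simp only: Cons.IH[of "sshift t \<omega>" "?N"] sshift_sshift)
  finally show ?case by (simp add: varest_eq Let_def)
qed simp

lemma vest_Cons:
  "vest d \<tau> \<gamma> \<omega> (a # as) 0 =
    (let N = stop_index \<tau> \<gamma> a \<omega>; rest = vest d \<tau> \<gamma> (sshift (2 * N) \<omega>) as 0
     in ((fst rest)(a := sr_threshold \<gamma> / real N), replicate (2 * N) a @ snd rest))"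
  by (simp add: varest_eq Let_def vest_shift[of _ _ \<omega> as "2 * _"])

lemma vest_stopping:
  assumes \<tau>: "0 < \<tau>" and eq: "\<And>i. i < length (snd (vest d \<tau> \<gamma> \<omega> as 0)) \<Longrightarrow> \<omega> i = \<omega>' i"
  shows "vest d \<tau> \<gamma> \<omega>' as 0 = vest d \<tau> \<gamma> \<omega> as 0"
  using eq
proof (induction as arbitrary: \<omega> \<omega>')
  case (Cons a as)
  let ?N = "stop_index \<tau> \<gamma> a \<omega>"
  have len: "length (snd (vest d \<tau> \<gamma> \<omega> (a # as) 0)) = 2 * ?N + length (snd (vest d \<tau> \<gamma> (sshift (2 * ?N) \<omega>) as 0))"
    by (simp only: vest_Cons Let_def) simp
  have N: "stop_index \<tau> \<gamma> a \<omega>' = ?N"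
    using Cons.prems unfolding len by (intro stop_index_stopping[OF \<tau>]) auto
  have "vest d \<tau> \<gamma> (sshift (2 * ?N) \<omega>') as 0 = vest d \<tau> \<gamma> (sshift (2 * ?N) \<omega>) as 0"
    using Cons.prems unfolding len by (intro Cons.IH) (auto simp: sshift_def)
  then show ?case by (simp only: vest_Cons Let_def N)
qed simp

lemma countable_valued_vest: "countable_valued (\<lambda>\<omega>. vest d \<tau> \<gamma> \<omega> as 0)"
proof (induction as)
  case Nil then show ?case by (simp add: countable_valued_const)
next
  case (Cons a as)
  have "countable_valued (\<lambda>\<omega>. (\<lambda>N \<omega>'. (\<lambda>rest. ((fst rest)(a := sr_threshold \<gamma> / real N), replicate (2 * N) a @ snd rest))
     (vest d \<tau> \<gamma> \<omega>' as 0)) (stop_index \<tau> \<gamma> a \<omega>) (sshift (2 * stop_index \<tau> \<gamma> a \<omega>) \<omega>))"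
    by (rule countable_valued_bind[where n="\<lambda>N. 2 * N", OF countable_valued_nat[OF measurable_stop_index]],
        rule countable_valued_map[OF Cons.IH])
  then show ?case by (simp only: vest_Cons Let_def)
qed

text \<open>The estimate is the stopping level over N and costs 2 N rounds, so accurate estimates
  also bound the number of rounds. Distinctness keeps one update from overwriting another.\<close>

lemma vest_estimates:
  assumes \<tau>: "0 < \<tau>" and \<gamma>: "0 < \<gamma>" "\<gamma> < 1" and "distinct as"
  shows "(\<forall>a\<in>set as. 0 < fst (vest d \<tau> \<gamma> \<omega> as 0) a) \<and> set (snd (vest d \<tau> \<gamma> \<omega> as 0)) \<subseteq> set as \<and>
    real (length (snd (vest d \<tau> \<gamma> \<omega> as 0))) = (\<Sum>a\<in>set as. 2 * sr_threshold \<gamma> / fst (vest d \<tau> \<gamma> \<omega> as 0) a)"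
  using \<open>distinct as\<close>
proof (induction as arbitrary: \<omega>)
  case (Cons a as)
  let ?N = "stop_index \<tau> \<gamma> a \<omega>"
  let ?r = "vest d \<tau> \<gamma> (sshift (2 * ?N) \<omega>) as 0"
  have N: "0 < ?N" by (rule stop_index_pos[OF \<tau> \<gamma>])
  have U: "1 \<le> sr_threshold \<gamma>" by (rule sr_threshold_pos[OF \<gamma>])
  have v: "fst (vest d \<tau> \<gamma> \<omega> (a # as) 0) = (fst ?r)(a := sr_threshold \<gamma> / real ?N)"
    "snd (vest d \<tau> \<gamma> \<omega> (a # as) 0) = replicate (2 * ?N) a @ snd ?r"
    by (simp_all only: vest_Cons Let_def fst_conv snd_conv)
  have a: "a \<notin> set as" using Cons.prems by simp
  have IH: "\<And>b. b \<in> set as \<Longrightarrow> 0 < fst ?r b" "set (snd ?r) \<subseteq> set as"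
    "real (length (snd ?r)) = (\<Sum>a\<in>set as. 2 * sr_threshold \<gamma> / fst ?r a)"
    using Cons.IH[of "sshift (2 * ?N) \<omega>"] Cons.prems by auto
  have "(\<Sum>b\<in>set as. 2 * sr_threshold \<gamma> / ((fst ?r)(a := sr_threshold \<gamma> / real ?N)) b)
      = (\<Sum>b\<in>set as. 2 * sr_threshold \<gamma> / fst ?r b)"
    using a by (intro sum.cong) auto
  then have "real (length (replicate (2 * ?N) a @ snd ?r))
      = (\<Sum>b\<in>set (a # as). 2 * sr_threshold \<gamma> / ((fst ?r)(a := sr_threshold \<gamma> / real ?N)) b)"
    using IH(3) N U a by simp
  moreover have "\<forall>b\<in>set (a # as). 0 < ((fst ?r)(a := sr_threshold \<gamma> / real ?N)) b"
    using IH(1) N U by simp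
  moreover have "set (replicate (2 * ?N) a @ snd ?r) \<subseteq> set (a # as)" using IH(2) N by auto
  ultimately show ?case unfolding v by blast
qed simp

text \<open>The tail of the list runs on rounds after the stopping time of the head, so its
  exceptional set is pulled back along the shift and keeps its bound. Producing a measurable
  exceptional set avoids showing that the good event is measurable.\<close>

lemma bad_vest:
  assumes \<tau>: "0 < \<tau>" "\<tau> \<le> 1" and \<gamma>: "0 < \<gamma>" "\<gamma> < 1" and "distinct as" "set as \<subseteq> A"
  shows "\<exists>E\<in>sets S. emeasure S E \<le> ennreal (real (length as) * \<gamma>) \<and>
    (\<forall>\<omega>\<in>space S - E. \<forall>a\<in>set as. good_estimate \<tau> a (fst (vest d \<tau> \<gamma> \<omega> as 0) a))"
  using assms(5,6)
proof (induction as)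
  case Nil then show ?case by (intro bexI[of _ "{}"]) auto
next
  case (Cons a as)
  obtain E where E: "E \<in> sets S" "emeasure S E \<le> ennreal (real (length as) * \<gamma>)"
    "\<And>\<omega> b. \<omega> \<in> space S - E \<Longrightarrow> b \<in> set as \<Longrightarrow> good_estimate \<tau> b (fst (vest d \<tau> \<gamma> \<omega> as 0) b)"
    using Cons by auto
  let ?B = "{\<omega>\<in>space S. \<not> good_estimate \<tau> a (sr_threshold \<gamma> / real (stop_index \<tau> \<gamma> a \<omega>))}"
  let ?C = "{\<omega>\<in>space S. sshift (2 * stop_index \<tau> \<gamma> a \<omega>) \<omega> \<in> E}"
  have B: "?B \<in> sets S" unfolding good_estimate_def by measurable
  have cv: "countable_valued (stop_index \<tau> \<gamma> a)" by (rule countable_valued_nat[OF measurable_stop_index])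
  have C: "?C \<in> sets S"
    by (rule sets_countable_valued_bind[OF cv, where n="\<lambda>N. 2 * N" and B="\<lambda>_. E"]) (rule E(1))
  have "emeasure S (?B \<union> ?C) \<le> emeasure S ?B + emeasure S ?C" by (rule emeasure_subadditive[OF B C])
  also have "\<dots> \<le> ennreal \<gamma> + ennreal (real (length as) * \<gamma>)"
  proof (rule add_mono)
    show "emeasure S ?B \<le> ennreal \<gamma>" using Cons.prems by (intro bad_estimate_measure \<tau> \<gamma>) auto
    show "emeasure S ?C \<le> ennreal (real (length as) * \<gamma>)"
    proof (rule emeasure_countable_valued_bind_le[OF cv, where n="\<lambda>N. 2 * N" and B="\<lambda>_. E"])
      fix \<omega> \<omega>' :: "nat \<Rightarrow> vec" assume "\<And>i. i < 2 * stop_index \<tau> \<gamma> a \<omega> \<Longrightarrow> \<omega> i = \<omega>' i"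
      then show "stop_index \<tau> \<gamma> a \<omega>' = stop_index \<tau> \<gamma> a \<omega>" by (rule stop_index_stopping[OF \<tau>(1)])
    qed (use E in simp)
  qed
  also have "\<dots> = ennreal (real (length (a # as)) * \<gamma>)"
    using \<gamma> by (simp add: algebra_simps flip: ennreal_plus)
  finally have m: "emeasure S (?B \<union> ?C) \<le> ennreal (real (length (a # as)) * \<gamma>)" .
  have "good_estimate \<tau> b (fst (vest d \<tau> \<gamma> \<omega> (a # as) 0) b)"
    if \<omega>: "\<omega> \<in> space S - (?B \<union> ?C)" and b: "b \<in> set (a # as)" for \<omega> b
  proof (cases "b = a")
    case True then show ?thesis using \<omega> by (simp only: vest_Cons Let_def) simp
  next
    case False
    then have "good_estimate \<tau> b (fst (vest d \<tau> \<gamma> (sshift (2 * stop_index \<tau> \<gamma> a \<omega>) \<omega>) as 0) b)"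
      using \<omega> b by (intro E(3)) (auto simp: sshift_in_space)
    then show ?thesis using False by (simp only: vest_Cons Let_def) simp
  qed
  then show ?case using m B C by (intro bexI[of _ "?B \<union> ?C"]) blast+
qed

end

subsection \<open>The VASE phases\<close>

lemma sum_concat_replicate:
  fixes h :: "'a \<Rightarrow> real"
  assumes "distinct xs"
  shows "(\<Sum>j<length (concat (map (\<lambda>a. replicate (n a) a) xs)). h (concat (map (\<lambda>a. replicate (n a) a) xs) ! j))
    = (\<Sum>a\<in>set xs. real (n a) * h a)"
proof -
  have "(\<Sum>j<length P. h (P ! j)) = sum_list (map h P)" for P
    by (simp add: sum_list_sum_nth atLeast0LessThan)
  moreover have "sum_list (map h (concat (map (\<lambda>a. replicate (n a) a) xs))) = (\<Sum>a\<leftarrow>xs. real (n a) * h a)"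
    by (induction xs) (simp_all add: sum_list_replicate)
  ultimately show ?thesis using assms by (simp add: sum_list_distinct_conv_sum_set)
qed

locale vase = parameter_noise +
  fixes \<delta> :: real
  assumes \<delta>: "0 < \<delta>" "\<delta> < 1"
begin

text \<open>From here to \<open>run_phase\<close> the ingredients of \<open>phase\<close> are named
  and read on a sequence that starts at 0; \<open>phase_eq\<close> links the two.\<close>

definition eps :: "nat \<Rightarrow> real" where "eps l = (1/2)^l"
definition delta :: "nat \<Rightarrow> real" where "delta l = \<delta> / (real (card A) * real l * (real l + 1))"
definition gam :: "nat \<Rightarrow> real" where "gam l = 2 * \<delta> / (real l * (real l + 1) * real d * (real d + 1))"
definition design :: "vec set \<Rightarrow> vec \<Rightarrow> real" where "design B = (SOME \<pi>. G_optimal d B \<pi>)"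
definition supp_list :: "vec set \<Rightarrow> vec list" where
  "supp_list B = (SOME xs. distinct xs \<and> set xs = {a\<in>B. design B a \<noteq> 0})"
definition num_plays :: "nat \<Rightarrow> vec set \<Rightarrow> (vec \<Rightarrow> real) \<Rightarrow> vec \<Rightarrow> nat" where
  "num_plays l B \<sigma>2 a = nat \<lceil>49 * real d / (eps l)^2 * ln (1 / delta l) * \<sigma>2 a * design B a\<rceil>"
definition plays :: "nat \<Rightarrow> vec set \<Rightarrow> (vec \<Rightarrow> real) \<Rightarrow> vec list" where
  "plays l B \<sigma>2 = concat (map (\<lambda>a. replicate (num_plays l B \<sigma>2 a) a) (supp_list B))"
definition survivors :: "nat \<Rightarrow> vec set \<Rightarrow> vec \<Rightarrow> vec set" where
  "survivors l B x = {a\<in>B. (MAX b\<in>B. ip d b x - ip d a x) \<le> 2 * eps l}"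
definition variance_phase :: "nat \<Rightarrow> vec set \<Rightarrow> (nat \<Rightarrow> vec) \<Rightarrow> (vec \<Rightarrow> real) \<times> vec list" where
  "variance_phase l B \<omega> = vest d (eps l) (gam l) \<omega> (supp_list B) 0"
definition estimate :: "nat \<Rightarrow> vec set \<Rightarrow> (vec \<Rightarrow> real) \<Rightarrow> (nat \<Rightarrow> vec) \<Rightarrow> vec" where
  "estimate l B \<sigma>2 \<omega> = lse d (plays l B \<sigma>2) \<sigma>2 (\<lambda>j. ip d (plays l B \<sigma>2 ! j) (\<omega> j))"
definition run_phase :: "nat \<Rightarrow> vec set \<Rightarrow> (nat \<Rightarrow> vec) \<Rightarrow> vec list \<times> vec set" where
  "run_phase l B \<omega> = (let v = variance_phase l B \<omega> in
     (snd v @ plays l B (fst v), survivors l B (estimate l B (fst v) (sshift (length (snd v)) \<omega>))))"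

lemma phase_eq: "phase d (card A) \<delta> \<omega> l B t = run_phase l B (sshift t \<omega>)"
  unfolding phase_def run_phase_def variance_phase_def estimate_def lse_def survivors_def plays_def num_plays_def
    supp_list_def design_def eps_def delta_def gam_def Let_def vest_shift[of _ _ \<omega> _ t] sshift_sshift
  by (simp only: sshift_def)

lemma card_A: "1 \<le> real (card A)"
  using A by (simp add: Suc_leI card_gt_0_iff)

lemma eps: "0 < eps l" "eps l \<le> 1"
  by (simp_all add: eps_def power_le_one)

lemma gam:
  assumes "1 \<le> l"
  shows "0 < gam l" "gam l < 1"
proof -
  have "1 * 2 \<le> real l * (real l + 1)" using assms by (intro mult_mono) auto
  moreover have "1 * 2 \<le> real d * (real d + 1)" using d by (intro mult_mono) auto
  ultimately have "2 * 2 \<le> (real l * (real l + 1)) * (real d * (real d + 1))" by (intro mult_mono) auto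
  then have p: "4 \<le> real l * (real l + 1) * real d * (real d + 1)" by (simp add: mult.assoc)
  then show "0 < gam l" using \<delta> by (simp add: gam_def)
  show "gam l < 1" unfolding gam_def using p \<delta> by (subst divide_less_eq_1_pos) auto
qed

lemma delta:
  assumes "1 \<le> l"
  shows "0 < delta l" "delta l \<le> 1/2" "2/3 \<le> ln (1 / delta l)"
proof -
  have "1 * 2 \<le> real l * (real l + 1)" using assms by (intro mult_mono) auto
  then have "1 * (1 * 2) \<le> real (card A) * (real l * (real l + 1))" using card_A by (intro mult_mono[OF card_A]) auto
  then have p: "2 \<le> real (card A) * real l * (real l + 1)" by (simp add: mult.assoc)
  then show d0: "0 < delta l" using \<delta> by (simp add: delta_def)
  show d2: "delta l \<le> 1/2"
  proof -
    have "\<delta> * 2 \<le> 1 * (real (card A) * real l * (real l + 1))" using p \<delta> by (intro mult_mono) auto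
    then show ?thesis using p by (simp add: delta_def field_simps)
  qed
  have "ln 2 \<le> ln (1 / delta l)" using d0 d2 by (subst ln_le_cancel_iff) (auto simp: field_simps)
  then show "2/3 \<le> ln (1 / delta l)" using ln2_ge_two_thirds by linarith
qed

context
  fixes B assumes B: "B \<subseteq> A" "B \<noteq> {}"
begin

lemma finite_B: "finite B"
  using B A finite_subset by blast

lemma design_G_optimal: "G_optimal d B (design B)"
  unfolding design_def by (rule someI_ex[OF exists_G_optimal[OF finite_B B(2) d]])

lemma is_design_design: "is_design B (design B)"
  using design_G_optimal by (simp add: G_optimal_def)

lemma supp_list: "distinct (supp_list B)" "set (supp_list B) = {a\<in>B. design B a \<noteq> 0}"
proof -
  have "\<exists>xs. distinct xs \<and> set xs = {a\<in>B. design B a \<noteq> 0}"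
    using finite_distinct_list[of "{a\<in>B. design B a \<noteq> 0}"] finite_B by auto
  from someI_ex[OF this] show "distinct (supp_list B)" "set (supp_list B) = {a\<in>B. design B a \<noteq> 0}"
    unfolding supp_list_def by blast+
qed

lemma supp_list_subset: "set (supp_list B) \<subseteq> B"
  using supp_list by auto

lemma design_pos: "a \<in> set (supp_list B) \<Longrightarrow> 0 < design B a"
  using supp_list is_design_design by (auto simp: is_design_def less_le)

lemma card_supp: "real (length (supp_list B)) \<le> real d * (real d + 1) / 2" "length (supp_list B) = card (set (supp_list B))"
proof -
  show l: "length (supp_list B) = card (set (supp_list B))" using supp_list(1) by (simp add: distinct_card)
  have "length (supp_list B) \<le> d * (d + 1) div 2"
    using design_G_optimal unfolding l supp_list(2) by (simp add: G_optimal_def)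
  then have "2 * length (supp_list B) \<le> d * (d + 1)" by linarith
  then have "real (2 * length (supp_list B)) \<le> real (d * (d + 1))" by (rule of_nat_mono)
  then show "real (length (supp_list B)) \<le> real d * (real d + 1) / 2" by (simp add: algebra_simps)
qed

lemma sum_design: "(\<Sum>a\<in>set (supp_list B). design B a) = 1"
proof -
  have "(\<Sum>a\<in>set (supp_list B). design B a) = (\<Sum>a\<in>B. design B a)"
    using finite_B supp_list(2) by (intro sum.mono_neutral_left) auto
  then show ?thesis using is_design_design by (simp add: is_design_def)
qed

lemma supp_list_nonempty: "supp_list B \<noteq> []"
  using sum_design by auto

lemma num_plays_bounds:
  assumes "1 \<le> l" "0 < \<sigma>2 a"
  shows "49 * real d / (eps l)^2 * ln (1 / delta l) * \<sigma>2 a * design B a \<le> real (num_plays l B \<sigma>2 a)"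
    "real (num_plays l B \<sigma>2 a) \<le> 1 + 49 * real d / (eps l)^2 * ln (1 / delta l) * \<sigma>2 a * design B a"
proof -
  have "0 \<le> 49 * real d / (eps l)^2 * ln (1 / delta l) * \<sigma>2 a * design B a"
    using assms delta(3)[OF assms(1)] is_design_design by (intro mult_nonneg_nonneg) (auto simp: is_design_def)
  then show "49 * real d / (eps l)^2 * ln (1 / delta l) * \<sigma>2 a * design B a \<le> real (num_plays l B \<sigma>2 a)"
    "real (num_plays l B \<sigma>2 a) \<le> 1 + 49 * real d / (eps l)^2 * ln (1 / delta l) * \<sigma>2 a * design B a"
    unfolding num_plays_def by linarith+
qed

lemma sum_plays:
  fixes h :: "vec \<Rightarrow> real"
  shows "(\<Sum>j<length (plays l B \<sigma>2). h (plays l B \<sigma>2 ! j)) = (\<Sum>a\<in>set (supp_list B). real (num_plays l B \<sigma>2 a) * h a)"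
  unfolding plays_def by (rule sum_concat_replicate[OF supp_list(1)])

lemma length_plays: "real (length (plays l B \<sigma>2)) = (\<Sum>a\<in>set (supp_list B). real (num_plays l B \<sigma>2 a))"
  using sum_plays[of "\<lambda>_. 1" l \<sigma>2] by simp

lemma set_plays: "set (plays l B \<sigma>2) \<subseteq> set (supp_list B)"
  by (auto simp: plays_def)

lemma nth_plays: "j < length (plays l B \<sigma>2) \<Longrightarrow> plays l B \<sigma>2 ! j \<in> set (supp_list B)"
  using set_plays nth_mem by blast

definition "kap l = (eps l)^2 / (49 * ln (1 / delta l))"

lemma kap: "1 \<le> l \<Longrightarrow> 0 < kap l"
  using delta(3)[of l] eps(1)[of l] by (simp add: kap_def)

text \<open>\<open>V\<^sub>l\<close> dominates \<open>49 d log(1/\<delta>\<^sub>l) / \<epsilon>\<^sub>l\<^sup>2\<close> times \<open>V(\<pi>\<^sub>l)\<close>.\<close>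

lemma square_le_weighted_plays:
  assumes l: "1 \<le> l" and \<sigma>2: "\<And>a. a \<in> set (supp_list B) \<Longrightarrow> 0 < \<sigma>2 a" and b: "b \<in> B"
  shows "(ip d b x)^2 \<le> kap l * (\<Sum>j<length (plays l B \<sigma>2). 1 / \<sigma>2 (plays l B \<sigma>2 ! j) * (ip d (plays l B \<sigma>2 ! j) x)^2)"
proof -
  have "(ip d b x)^2 \<le> real d * qform d B (design B) x"
    by (rule G_optimal_bound[OF finite_B B(2) d design_G_optimal b])
  also have "qform d B (design B) x = (\<Sum>a\<in>set (supp_list B). design B a * (ip d a x)^2)"
    unfolding qform_def using finite_B supp_list(2) by (intro sum.mono_neutral_right) auto
  also have "real d * \<dots> = kap l * (\<Sum>a\<in>set (supp_list B). 49 * real d / (eps l)^2 * ln (1 / delta l) * design B a * (ip d a x)^2)"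
    unfolding sum_distrib_left using delta(3)[OF l] eps(1)[of l] by (intro sum.cong) (auto simp: kap_def)
  also have "\<dots> \<le> kap l * (\<Sum>a\<in>set (supp_list B). real (num_plays l B \<sigma>2 a) * (1 / \<sigma>2 a * (ip d a x)^2))"
  proof (intro mult_left_mono sum_mono)
    fix a assume a: "a \<in> set (supp_list B)"
    have "49 * real d / (eps l)^2 * ln (1 / delta l) * \<sigma>2 a * design B a * (1 / \<sigma>2 a * (ip d a x)^2)
       \<le> real (num_plays l B \<sigma>2 a) * (1 / \<sigma>2 a * (ip d a x)^2)"
      using num_plays_bounds(1)[of l \<sigma>2 a, OF l \<sigma>2[OF a]] \<sigma>2[OF a]
      by (intro mult_right_mono) (auto simp: less_imp_le)
    then show "49 * real d / (eps l)^2 * ln (1 / delta l) * design B a * (ip d a x)^2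
       \<le> real (num_plays l B \<sigma>2 a) * (1 / \<sigma>2 a * (ip d a x)^2)"
      using \<sigma>2[OF a] by simp
  qed (use kap[OF l] in simp)
  also have "(\<Sum>a\<in>set (supp_list B). real (num_plays l B \<sigma>2 a) * (1 / \<sigma>2 a * (ip d a x)^2))
     = (\<Sum>j<length (plays l B \<sigma>2). 1 / \<sigma>2 (plays l B \<sigma>2 ! j) * (ip d (plays l B \<sigma>2 ! j) x)^2)"
    by (rule sum_plays[symmetric])
  finally show ?thesis .
qed

text \<open>The coefficients do not depend on \<omega>. That makes \<open>ip d b\<close> of the
  estimate measurable and turns its error into a weighted sum of independent centered
  rewards.\<close>

lemma estimate_coefficients:
  assumes l: "1 \<le> l" and \<sigma>2: "\<And>a. a \<in> set (supp_list B) \<Longrightarrow> 0 < \<sigma>2 a" and b: "b \<in> B"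
  shows "\<exists>c. (\<forall>\<omega>. ip d b (estimate l B \<sigma>2 \<omega>) = (\<Sum>j<length (plays l B \<sigma>2). c j * ip d (plays l B \<sigma>2 ! j) (\<omega> j)))
    \<and> (\<forall>\<theta>. ip d b \<theta> = (\<Sum>j<length (plays l B \<sigma>2). c j * ip d (plays l B \<sigma>2 ! j) \<theta>))
    \<and> (\<Sum>j<length (plays l B \<sigma>2). \<sigma>2 (plays l B \<sigma>2 ! j) * (c j)^2) \<le> kap l
    \<and> (\<forall>j<length (plays l B \<sigma>2). \<sigma>2 (plays l B \<sigma>2 ! j) * \<bar>c j\<bar> \<le> kap l)"
proof -
  have "\<exists>c. (\<forall>X. ip d b (lse d (plays l B \<sigma>2) \<sigma>2 X) = (\<Sum>j<length (plays l B \<sigma>2). c j * X j))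
    \<and> (\<forall>\<theta>. ip d b \<theta> = (\<Sum>j<length (plays l B \<sigma>2). c j * ip d (plays l B \<sigma>2 ! j) \<theta>))
    \<and> (\<Sum>j<length (plays l B \<sigma>2). \<sigma>2 (plays l B \<sigma>2 ! j) * (c j)^2) \<le> kap l
    \<and> (\<forall>j<length (plays l B \<sigma>2). \<sigma>2 (plays l B \<sigma>2 ! j) * \<bar>c j\<bar> \<le> kap l)"
  proof (rule lse_coefficients)
    fix j assume "j < length (plays l B \<sigma>2)"
    note m = nth_plays[OF this]
    show "0 < \<sigma>2 (plays l B \<sigma>2 ! j)" by (rule \<sigma>2[OF m])
    fix x
    show "(ip d (plays l B \<sigma>2 ! j) x)^2 \<le> kap l * (\<Sum>j<length (plays l B \<sigma>2). 1 / \<sigma>2 (plays l B \<sigma>2 ! j) * (ip d (plays l B \<sigma>2 ! j) x)^2)"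
      by (rule square_le_weighted_plays[OF l \<sigma>2]) (use m supp_list_subset in auto)
  next
    fix x
    show "(ip d b x)^2 \<le> kap l * (\<Sum>j<length (plays l B \<sigma>2). 1 / \<sigma>2 (plays l B \<sigma>2 ! j) * (ip d (plays l B \<sigma>2 ! j) x)^2)"
      by (rule square_le_weighted_plays[OF l \<sigma>2 b])
  qed (use kap[OF l] in simp)
  then obtain c where "\<forall>X. ip d b (lse d (plays l B \<sigma>2) \<sigma>2 X) = (\<Sum>j<length (plays l B \<sigma>2). c j * X j)"
    and r: "(\<forall>\<theta>. ip d b \<theta> = (\<Sum>j<length (plays l B \<sigma>2). c j * ip d (plays l B \<sigma>2 ! j) \<theta>))
    \<and> (\<Sum>j<length (plays l B \<sigma>2). \<sigma>2 (plays l B \<sigma>2 ! j) * (c j)^2) \<le> kap l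
    \<and> (\<forall>j<length (plays l B \<sigma>2). \<sigma>2 (plays l B \<sigma>2 ! j) * \<bar>c j\<bar> \<le> kap l)" by (elim exE conjE) (intro that conjI)
  then have "\<forall>\<omega>. ip d b (estimate l B \<sigma>2 \<omega>) = (\<Sum>j<length (plays l B \<sigma>2). c j * ip d (plays l B \<sigma>2 ! j) (\<omega> j))"
    by (simp add: estimate_def)
  with r show ?thesis by (intro exI[of _ c] conjI) auto
qed

text \<open>Good estimates satisfy rvar \<le> 4 \<sigma>2 and \<sigma>2 \<ge> eps l / 4. The first
  bounds the variance of the error by 4 * kap l, the second each coefficient by 4 * kap l / eps
  l.\<close>

lemma estimate_error_tail:
  assumes l: "1 \<le> l" and \<sigma>2: "\<And>a. a \<in> set (supp_list B) \<Longrightarrow> good_estimate (eps l) a (\<sigma>2 a)" and b: "b \<in> B"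
  shows "{\<omega>\<in>space S. eps l < \<bar>ip d b (estimate l B \<sigma>2 \<omega>) - mean b\<bar>} \<in> sets S"
    "emeasure S {\<omega>\<in>space S. eps l < \<bar>ip d b (estimate l B \<sigma>2 \<omega>) - mean b\<bar>} \<le> ennreal (2 * delta l)"
proof -
  let ?P = "plays l B \<sigma>2" and ?L = "ln (1 / delta l)"
  have sA: "a \<in> A" if "a \<in> set (supp_list B)" for a using that supp_list_subset B by blast
  have ge: "eps l / 4 \<le> \<sigma>2 a" "rvar a / 4 \<le> \<sigma>2 a" if "a \<in> set (supp_list B)" for a
    using good_estimateD[OF sA[OF that] eps[of l] \<sigma>2[OF that]] by auto
  have pos: "0 < \<sigma>2 a" if "a \<in> set (supp_list B)" for a using ge(1)[OF that] eps(1)[of l] by linarith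
  obtain c where c: "\<And>\<omega>. ip d b (estimate l B \<sigma>2 \<omega>) = (\<Sum>j<length ?P. c j * ip d (?P ! j) (\<omega> j))"
    "\<And>\<theta>. ip d b \<theta> = (\<Sum>j<length ?P. c j * ip d (?P ! j) \<theta>)"
    "(\<Sum>j<length ?P. \<sigma>2 (?P ! j) * (c j)^2) \<le> kap l"
    "\<And>j. j < length ?P \<Longrightarrow> \<sigma>2 (?P ! j) * \<bar>c j\<bar> \<le> kap l"
    using estimate_coefficients[of l \<sigma>2 b, OF l pos b] by blast
  have err: "ip d b (estimate l B \<sigma>2 \<omega>) - mean b = (\<Sum>j<length ?P. c j * (ip d (?P ! j) (\<omega> j) - mean (?P ! j)))" for \<omega>
    unfolding c(1) by (subst c(2)) (simp add: sum_subtractf algebra_simps)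
  show "{\<omega>\<in>space S. eps l < \<bar>ip d b (estimate l B \<sigma>2 \<omega>) - mean b\<bar>} \<in> sets S"
    unfolding err by measurable
  have L: "2/3 \<le> ?L" by (rule delta(3)[OF l])
  \<comment> \<open>This minimizes s^2 * (4 * kap l) - s * eps l, and is also the largest
    \<open>s\<close> that the coefficient bound permits.\<close>
  define s where "s = 49 * ?L / (8 * eps l)"
  have s: "0 < s" using L eps(1)[of l] by (simp add: s_def)
  have "emeasure S {\<omega>\<in>space S. eps l < \<bar>\<Sum>j<length ?P. c j * (ip d (?P ! j) (\<omega> j) - mean (?P ! j))\<bar>}
     \<le> ennreal (2 * exp (s^2 * (4 * kap l) - s * eps l))"
  proof (rule weighted_noise_tail[OF _ s])
    fix j assume j: "j < length ?P"
    note m = nth_plays[OF j]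
    show "?P ! j \<in> A" by (rule sA[OF m])
    have "eps l / 4 * \<bar>c j\<bar> \<le> \<sigma>2 (?P ! j) * \<bar>c j\<bar>" using ge(1)[OF m] by (intro mult_right_mono) auto
    also have "\<dots> \<le> kap l" by (rule c(4)[OF j])
    finally have "\<bar>c j\<bar> \<le> 4 * kap l / eps l" using eps(1)[of l] by (simp add: field_simps)
    also have "\<dots> = 4 * eps l / (49 * ?L)" using eps(1)[of l] by (simp add: kap_def power2_eq_square)
    finally have "s * (2 * \<bar>c j\<bar>) \<le> s * (2 * (4 * eps l / (49 * ?L)))" using s by (intro mult_left_mono) auto
    also have "\<dots> = 1" using L eps(1)[of l] by (simp add: s_def)
    finally show "s * (2 * \<bar>c j\<bar>) \<le> 1" .
  next
    have "(\<Sum>j<length ?P. (c j)^2 * rvar (?P ! j)) \<le> (\<Sum>j<length ?P. 4 * (\<sigma>2 (?P ! j) * (c j)^2))"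
    proof (rule sum_mono)
      fix j assume "j \<in> {..<length ?P}"
      then have "rvar (?P ! j) \<le> 4 * \<sigma>2 (?P ! j)" using ge(2)[OF nth_plays] by (simp add: field_simps)
      then have "(c j)^2 * rvar (?P ! j) \<le> (c j)^2 * (4 * \<sigma>2 (?P ! j))" by (intro mult_left_mono) auto
      then show "(c j)^2 * rvar (?P ! j) \<le> 4 * (\<sigma>2 (?P ! j) * (c j)^2)" by (simp only: ac_simps)
    qed
    also have "\<dots> \<le> 4 * kap l" using c(3) by (simp add: sum_distrib_left[symmetric])
    finally show "(\<Sum>j<length ?P. (c j)^2 * rvar (?P ! j)) \<le> 4 * kap l" .
  qed
  also have "ennreal (2 * exp (s^2 * (4 * kap l) - s * eps l)) \<le> ennreal (2 * delta l)"
  proof (rule ennreal_leI)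
    have "s^2 * (4 * kap l) = 49 * ?L / 16"
      using L eps(1)[of l] by (simp add: s_def kap_def power2_eq_square field_simps)
    moreover have "s * eps l = 49 * ?L / 8" using eps(1)[of l] by (simp add: s_def)
    \<comment> \<open>The exponent is 49/16 - 49/8 = -49/16 times log(1/\<delta>_l).\<close>
    ultimately have "s^2 * (4 * kap l) - s * eps l \<le> - ?L" using L by linarith
    also have "- ?L = ln (delta l)" using delta(1)[OF l] by (simp add: ln_div)
    finally have "exp (s^2 * (4 * kap l) - s * eps l) \<le> delta l" using delta(1)[OF l] by (simp add: ln_ge_iff)
    then show "2 * exp (s^2 * (4 * kap l) - s * eps l) \<le> 2 * delta l" by simp
  qed
  finally show "emeasure S {\<omega>\<in>space S. eps l < \<bar>ip d b (estimate l B \<sigma>2 \<omega>) - mean b\<bar>} \<le> ennreal (2 * delta l)"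
    unfolding err .
qed

text \<open>Union bound over at most K actions, cancelled by the K inside
  \<open>delta l\<close>.\<close>

lemma bad_estimate:
  assumes l: "1 \<le> l" and \<sigma>2: "\<And>a. a \<in> set (supp_list B) \<Longrightarrow> good_estimate (eps l) a (\<sigma>2 a)"
  shows "\<exists>E\<in>sets S. emeasure S E \<le> ennreal (2 * \<delta> / (real l * (real l + 1))) \<and>
    (\<forall>\<omega>\<in>space S - E. \<forall>b\<in>B. \<bar>ip d b (estimate l B \<sigma>2 \<omega>) - mean b\<bar> \<le> eps l)"
proof (intro bexI conjI)
  let ?E = "\<lambda>b. {\<omega>\<in>space S. eps l < \<bar>ip d b (estimate l B \<sigma>2 \<omega>) - mean b\<bar>}"
  note E = estimate_error_tail[OF l \<sigma>2]
  show "(\<Union>b\<in>B. ?E b) \<in> sets S" using E(1) finite_B by (intro sets.finite_UN) auto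
  have "emeasure S (\<Union>b\<in>B. ?E b) \<le> (\<Sum>b\<in>B. emeasure S (?E b))"
    using E(1) finite_B by (intro emeasure_subadditive_finite) auto
  also have "\<dots> \<le> (\<Sum>b\<in>B. ennreal (2 * delta l))" by (intro sum_mono E(2)) auto
  also have "\<dots> = ennreal (real (card B) * (2 * delta l))"
    using delta(1)[OF l] by (simp add: ennreal_mult ennreal_of_nat_eq_real_of_nat)
  also have "\<dots> \<le> ennreal (real (card A) * (2 * delta l))"
    using card_mono[OF A(1) B(1)] delta(1)[OF l] by (intro ennreal_leI mult_right_mono) auto
  also have "real (card A) * (2 * delta l) = 2 * \<delta> / (real l * (real l + 1))"
    using card_A by (simp add: delta_def)
  finally show "emeasure S (\<Union>b\<in>B. ?E b) \<le> ennreal (2 * \<delta> / (real l * (real l + 1)))" .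
  show "\<forall>\<omega>\<in>space S - (\<Union>b\<in>B. ?E b). \<forall>b\<in>B. \<bar>ip d b (estimate l B \<sigma>2 \<omega>) - mean b\<bar> \<le> eps l"
    by (auto simp: not_less)
qed

end

end


section \<open>A complete phase: probability, measurability and length\<close>

context vase
begin

lemma survivors_subset: "survivors l B x \<subseteq> B"
  by (auto simp: survivors_def)

lemma mem_survivors_iff:
  assumes "finite B" "B \<noteq> {}"
  shows "a \<in> survivors l B x \<longleftrightarrow> a \<in> B \<and> (\<forall>b\<in>B. ip d b x - ip d a x \<le> 2 * eps l)"
  using assms by (auto simp: survivors_def)

lemma survivors_nonempty:
  assumes "finite B" "B \<noteq> {}"
  shows "survivors l B x \<noteq> {}"
proof -
  have "Max ((\<lambda>b. ip d b x) ` B) \<in> (\<lambda>b. ip d b x) ` B" using assms by (intro Max_in) auto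
  then obtain a where a: "a \<in> B" "ip d a x = Max ((\<lambda>b. ip d b x) ` B)" by auto
  have "ip d b x \<le> ip d a x" if "b \<in> B" for b using assms that by (simp add: a(2))
  then have "\<forall>b\<in>B. ip d b x - ip d a x \<le> 2 * eps l" using eps(1)[of l] by (smt (verit))
  then show ?thesis using a(1) mem_survivors_iff[OF assms] by blast
qed

definition phase_good :: "nat \<Rightarrow> vec set \<Rightarrow> (nat \<Rightarrow> vec) \<Rightarrow> bool" where
  "phase_good l B \<omega> \<longleftrightarrow>
     (\<forall>a\<in>set (supp_list B). good_estimate (eps l) a (fst (variance_phase l B \<omega>) a)) \<and>
     (\<forall>b\<in>B. \<bar>ip d b (estimate l B (fst (variance_phase l B \<omega>))
          (sshift (length (snd (variance_phase l B \<omega>))) \<omega>)) - mean b\<bar> \<le> eps l)"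

context
  fixes B l assumes B: "B \<subseteq> A" "B \<noteq> {}" and l: "1 \<le> (l::nat)"
begin

lemma countable_valued_variance_phase: "countable_valued (variance_phase l B)"
  unfolding variance_phase_def[abs_def] by (rule countable_valued_vest)

lemma variance_phase_stopping:
  assumes "\<And>i. i < length (snd (variance_phase l B \<omega>)) \<Longrightarrow> \<omega> i = \<omega>' i"
  shows "variance_phase l B \<omega>' = variance_phase l B \<omega>"
  using assms unfolding variance_phase_def by (rule vest_stopping[OF eps(1)])

lemma variance_phase_estimates:
  "\<And>a. a \<in> set (supp_list B) \<Longrightarrow> 0 < fst (variance_phase l B \<omega>) a"
  "set (snd (variance_phase l B \<omega>)) \<subseteq> set (supp_list B)"
  "real (length (snd (variance_phase l B \<omega>)))
     = (\<Sum>a\<in>set (supp_list B). 2 * sr_threshold (gam l) / fst (variance_phase l B \<omega>) a)"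
  using vest_estimates[OF eps(1)[of l] gam[OF l] supp_list(1)[OF B], of \<omega>] unfolding variance_phase_def by blast+

text \<open>At most d(d+1)/2 variance estimates fail with probability \<open>gam l\<close> each, in
  total \<delta>/(l(l+1)); the two-sided error bounds cost 2 \<delta>/(l(l+1)).\<close>

lemma bad_phase:
  "\<exists>E\<in>sets S. emeasure S E \<le> ennreal (3 * \<delta> / (real l * (real l + 1))) \<and>
    (\<forall>\<omega>\<in>space S - E. phase_good l B \<omega>)"
proof -
  have sA: "set (supp_list B) \<subseteq> A" using supp_list_subset[OF B] B by blast
  obtain E1 where E1: "E1 \<in> sets S"
    "emeasure S E1 \<le> ennreal (real (length (supp_list B)) * gam l)"
    "\<And>\<omega> a. \<omega> \<in> space S - E1 \<Longrightarrow> a \<in> set (supp_list B) \<Longrightarrow> good_estimate (eps l) a (fst (variance_phase l B \<omega>) a)"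
    using bad_vest[OF eps[of l] gam[OF l] supp_list(1)[OF B] sA] unfolding variance_phase_def by blast
  let ?good = "\<lambda>\<sigma>2. \<forall>a\<in>set (supp_list B). good_estimate (eps l) a (\<sigma>2 a)"
  \<comment> \<open>Conditioning requires a bound for every value of the variance phase; bad
    estimates get the empty set, as they are already counted in \<open>E1\<close>.\<close>
  let ?ok = "\<lambda>\<sigma>2 E. E \<in> sets S \<and> emeasure S E \<le> ennreal (2 * \<delta> / (real l * (real l + 1))) \<and>
    (?good \<sigma>2 \<longrightarrow> (\<forall>\<omega>\<in>space S - E. \<forall>b\<in>B. \<bar>ip d b (estimate l B \<sigma>2 \<omega>) - mean b\<bar> \<le> eps l))"
  have "\<exists>E. ?ok \<sigma>2 E" for \<sigma>2
  proof (cases "?good \<sigma>2")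
    case True
    then have "\<And>a. a \<in> set (supp_list B) \<Longrightarrow> good_estimate (eps l) a (\<sigma>2 a)" by blast
    from bad_estimate[OF B l this] show ?thesis by blast
  next
    case False
    then show ?thesis by (intro exI[of _ "{}"]) auto
  qed
  then obtain E2 where E2: "\<And>\<sigma>2. ?ok \<sigma>2 (E2 \<sigma>2)" by metis
  let ?v = "variance_phase l B"
  let ?C = "{\<omega>\<in>space S. sshift (length (snd (?v \<omega>))) \<omega> \<in> E2 (fst (?v \<omega>))}"
  have C: "?C \<in> sets S"
    by (rule sets_countable_valued_bind[OF countable_valued_variance_phase, where n="\<lambda>v. length (snd v)" and B="\<lambda>v. E2 (fst v)"])
      (use E2 in blast)
  have mC: "emeasure S ?C \<le> ennreal (2 * \<delta> / (real l * (real l + 1)))"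
  proof (rule emeasure_countable_valued_bind_le[OF countable_valued_variance_phase, where n="\<lambda>v. length (snd v)" and B="\<lambda>v. E2 (fst v)"])
    fix \<omega> \<omega>' :: "nat \<Rightarrow> vec" assume "\<And>i. i < length (snd (?v \<omega>)) \<Longrightarrow> \<omega> i = \<omega>' i"
    then show "?v \<omega>' = ?v \<omega>" by (rule variance_phase_stopping)
  qed (use E2 in blast)
  have g: "real (length (supp_list B)) * gam l \<le> \<delta> / (real l * (real l + 1))"
  proof -
    have "real (length (supp_list B)) * gam l \<le> real d * (real d + 1) / 2 * gam l"
      using card_supp(1)[OF B] gam(1)[OF l] by (intro mult_right_mono) auto
    also have "\<dots> = \<delta> / (real l * (real l + 1))" using d by (simp add: gam_def)
    finally show ?thesis .
  qed
  have "emeasure S (E1 \<union> ?C) \<le> emeasure S E1 + emeasure S ?C" by (rule emeasure_subadditive[OF E1(1) C])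
  also have "\<dots> \<le> ennreal (\<delta> / (real l * (real l + 1))) + ennreal (2 * \<delta> / (real l * (real l + 1)))"
    by (intro add_mono mC order_trans[OF E1(2)] ennreal_leI g)
  also have "\<dots> = ennreal (3 * \<delta> / (real l * (real l + 1)))"
    using \<delta> by (simp add: add_divide_distrib[symmetric] flip: ennreal_plus)
  finally have m: "emeasure S (E1 \<union> ?C) \<le> ennreal (3 * \<delta> / (real l * (real l + 1)))" .
  have "phase_good l B \<omega>" if \<omega>: "\<omega> \<in> space S - (E1 \<union> ?C)" for \<omega>
  proof -
    have 1: "?good (fst (?v \<omega>))" using E1(3)[of \<omega>] \<omega> by blast
    have "sshift (length (snd (?v \<omega>))) \<omega> \<in> space S - E2 (fst (?v \<omega>))"
      using \<omega> sshift_in_space by auto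
    then show ?thesis using 1 E2[of "fst (?v \<omega>)"] unfolding phase_good_def by blast
  qed
  then show ?thesis using m E1(1) C by (intro bexI[of _ "E1 \<union> ?C"]) auto
qed

lemma estimate_cong:
  assumes "\<And>j. j < length (plays l B \<sigma>2) \<Longrightarrow> \<omega> j = \<omega>' j"
  shows "estimate l B \<sigma>2 \<omega> = estimate l B \<sigma>2 \<omega>'"
  unfolding estimate_def by (rule lse_cong) (simp add: assms)

lemma run_phase_stopping:
  assumes eq: "\<And>i. i < length (fst (run_phase l B \<omega>)) \<Longrightarrow> \<omega> i = \<omega>' i"
  shows "run_phase l B \<omega>' = run_phase l B \<omega>"
proof -
  let ?v = "variance_phase l B \<omega>"
  have len: "length (fst (run_phase l B \<omega>)) = length (snd ?v) + length (plays l B (fst ?v))"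
    by (simp add: run_phase_def Let_def)
  have v: "variance_phase l B \<omega>' = ?v"
    by (rule variance_phase_stopping) (use eq len in auto)
  have "estimate l B (fst ?v) (sshift (length (snd ?v)) \<omega>') = estimate l B (fst ?v) (sshift (length (snd ?v)) \<omega>)"
    by (rule estimate_cong) (use eq len in \<open>auto simp: sshift_def\<close>)
  then show ?thesis by (simp only: run_phase_def Let_def v)
qed

text \<open>Survival of \<open>a\<close> is a finite conjunction of inequalities between linear
  functions of the rewards, so measurability never refers to the estimate as a vector.\<close>

lemma countable_valued_survivors:
  assumes \<sigma>2: "\<And>a. a \<in> set (supp_list B) \<Longrightarrow> 0 < \<sigma>2 a"
  shows "countable_valued (\<lambda>\<omega>. survivors l B (estimate l B \<sigma>2 \<omega>))"
proof (rule countable_valuedI[of "Pow B"])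
  have fin: "finite B" by (rule finite_B[OF B])
  show "countable (Pow B)" using fin by (intro countable_finite) simp
  show "survivors l B (estimate l B \<sigma>2 \<omega>) \<in> Pow B" for \<omega> using survivors_subset by blast
  fix Y assume Y: "Y \<in> Pow B"
  have meas: "(\<lambda>\<omega>. ip d b (estimate l B \<sigma>2 \<omega>)) \<in> borel_measurable S" if b: "b \<in> B" for b
  proof -
    obtain c where "\<And>\<omega>. ip d b (estimate l B \<sigma>2 \<omega>) = (\<Sum>j<length (plays l B \<sigma>2). c j * ip d (plays l B \<sigma>2 ! j) (\<omega> j))"
      using estimate_coefficients[OF B, of l \<sigma>2 b, OF l \<sigma>2 b] by blast
    then show ?thesis by simp
  qed
  have pair: "{\<omega>\<in>space S. ip d b (estimate l B \<sigma>2 \<omega>) - ip d a (estimate l B \<sigma>2 \<omega>) \<le> 2 * eps l} \<in> sets S"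
    if "a \<in> B" "b \<in> B" for a b
    using meas[OF that(1)] meas[OF that(2)] by measurable
  have surv: "{\<omega>\<in>space S. a \<in> survivors l B (estimate l B \<sigma>2 \<omega>)} \<in> sets S" if a: "a \<in> B" for a
  proof -
    have "{\<omega>\<in>space S. \<forall>b\<in>B. ip d b (estimate l B \<sigma>2 \<omega>) - ip d a (estimate l B \<sigma>2 \<omega>) \<le> 2 * eps l} \<in> sets S"
      using pair[OF a] fin by (intro sets.sets_Collect_finite_All) auto
    then show ?thesis using a mem_survivors_iff[OF fin B(2)] by simp
  qed
  have "{\<omega>\<in>space S. \<forall>a\<in>B. (a \<in> survivors l B (estimate l B \<sigma>2 \<omega>)) = (a \<in> Y)} \<in> sets S"
  proof (intro sets.sets_Collect_finite_All fin)
    fix a assume a: "a \<in> B"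
    show "{\<omega>\<in>space S. (a \<in> survivors l B (estimate l B \<sigma>2 \<omega>)) = (a \<in> Y)} \<in> sets S"
      using surv[OF a] sets.sets_Collect_neg[OF surv[OF a]] by (cases "a \<in> Y") simp_all
  qed
  also have "{\<omega>\<in>space S. \<forall>a\<in>B. (a \<in> survivors l B (estimate l B \<sigma>2 \<omega>)) = (a \<in> Y)}
     = {\<omega>\<in>space S. survivors l B (estimate l B \<sigma>2 \<omega>) = Y}"
    using Y survivors_subset by blast
  finally show "{\<omega>\<in>space S. survivors l B (estimate l B \<sigma>2 \<omega>) = Y} \<in> sets S" .
qed

lemma countable_valued_run_phase: "countable_valued (run_phase l B)"
proof -
  have "countable_valued (\<lambda>\<omega>. (\<lambda>v \<omega>'. (\<lambda>Y. (snd v @ plays l B (fst v), Y)) (survivors l B (estimate l B (fst v) \<omega>')))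
     (variance_phase l B \<omega>) (sshift (length (snd (variance_phase l B \<omega>))) \<omega>))"
  proof (rule countable_valued_bind[where n="\<lambda>v. length (snd v)", OF countable_valued_variance_phase])
    fix v assume v: "v \<in> variance_phase l B ` space S"
    show "countable_valued (\<lambda>\<omega>'. (\<lambda>Y. (snd v @ plays l B (fst v), Y)) (survivors l B (estimate l B (fst v) \<omega>')))"
      by (rule countable_valued_map[OF countable_valued_survivors]) (use v variance_phase_estimates(1) in blast)
  qed
  then show ?thesis by (simp only: run_phase_def[abs_def] Let_def)
qed

lemma set_run_phase: "set (fst (run_phase l B \<omega>)) \<subseteq> B"
  using variance_phase_estimates(2)[of \<omega>] set_plays[OF B] supp_list_subset[OF B]
  by (auto simp: run_phase_def Let_def) blast+

text \<open>Progress in every phase, good or bad, so that \<open>T\<close> phases always cover the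
  horizon.\<close>

lemma run_phase_nonempty: "fst (run_phase l B \<omega>) \<noteq> []"
proof -
  have "0 < (\<Sum>a\<in>set (supp_list B). 2 * sr_threshold (gam l) / fst (variance_phase l B \<omega>) a)"
    using variance_phase_estimates(1)[of _ \<omega>] sr_threshold_pos[OF gam[OF l]] supp_list_nonempty[OF B]
    by (intro sum_pos) auto
  then have "snd (variance_phase l B \<omega>) \<noteq> []" using variance_phase_estimates(3)[of \<omega>] by auto
  then show ?thesis by (simp add: run_phase_def Let_def)
qed

text \<open>Clipping makes every estimate at least eps l / 4, hence at least 49 d log(1/\<delta>_l)
  / (4 eps l) plays. Only about log T phases can therefore start before \<open>T\<close>.\<close>

lemma good_phase_length_ge:
  assumes "phase_good l B \<omega>"
  shows "2^l \<le> length (fst (run_phase l B \<omega>))"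
proof -
  let ?\<sigma>2 = "fst (variance_phase l B \<omega>)" and ?c = "49 * real d / (eps l)^2 * ln (1 / delta l)"
  have L: "2/3 \<le> ln (1 / delta l)" by (rule delta(3)[OF l])
  have g: "eps l / 4 \<le> ?\<sigma>2 a" if "a \<in> set (supp_list B)" for a
    using assms that supp_list_subset[OF B] B good_estimateD(1)[OF _ eps[of l]] unfolding phase_good_def by blast
  have "1 / eps l \<le> ?c * (eps l / 4)"
  proof -
    have "1 * (2/3) \<le> real d * ln (1 / delta l)" using d L by (intro mult_mono) auto
    then show ?thesis using eps(1)[of l] by (simp add: field_simps power2_eq_square)
  qed
  also have "\<dots> = (\<Sum>a\<in>set (supp_list B). ?c * (eps l / 4) * design B a)"
    unfolding sum_distrib_left[symmetric] sum_design[OF B] by simp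
  also have "\<dots> \<le> (\<Sum>a\<in>set (supp_list B). real (num_plays l B ?\<sigma>2 a))"
  proof (rule sum_mono)
    fix a assume a: "a \<in> set (supp_list B)"
    have "?c * (eps l / 4) * design B a \<le> ?c * ?\<sigma>2 a * design B a"
      using g[OF a] L design_pos[OF B a] by (intro mult_right_mono mult_left_mono) auto
    also have "\<dots> \<le> real (num_plays l B ?\<sigma>2 a)"
      by (rule num_plays_bounds(1)[OF B, of l ?\<sigma>2 a, OF l variance_phase_estimates(1)[OF a]])
    finally show "?c * (eps l / 4) * design B a \<le> real (num_plays l B ?\<sigma>2 a)" .
  qed
  also have "\<dots> = real (length (plays l B ?\<sigma>2))" by (rule length_plays[OF B, symmetric])
  also have "\<dots> \<le> real (length (fst (run_phase l B \<omega>)))" by (simp add: run_phase_def Let_def)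
  finally have "(2::real)^l \<le> real (length (fst (run_phase l B \<omega>)))" by (simp add: eps_def power_one_over)
  then show ?thesis by (metis of_nat_le_iff of_nat_numeral of_nat_power)
qed

text \<open>Variance estimation takes at most 8 U / eps l rounds per supported action. In the plays
  \<open>?\<sigma>2 a \<le> ?M + eps l\<close>, where the eps l and the rounding up are of lower
  order. The factor eps l on the left anticipates that a round costs at most a multiple of
  it.\<close>

lemma good_phase_length_le:
  assumes "phase_good l B \<omega>"
  shows "eps l * real (length (fst (run_phase l B \<omega>)))
    \<le> real d ^ 2 * (8 * sr_threshold (gam l) + 1) + 49 * real d * ln (1 / delta l)
      + 49 * real d * ln (1 / delta l) * M_sigma d A \<nu> / eps l"
proof -
  let ?\<sigma>2 = "fst (variance_phase l B \<omega>)" and ?c = "49 * real d / (eps l)^2 * ln (1 / delta l)"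
  let ?U = "sr_threshold (gam l)" and ?M = "M_sigma d A \<nu>"
  have e: "0 < eps l" "eps l \<le> 1" by (rule eps)+
  have L: "2/3 \<le> ln (1 / delta l)" by (rule delta(3)[OF l])
  have U: "1 \<le> ?U" by (rule sr_threshold_pos[OF gam[OF l]])
  have sA: "a \<in> A" if "a \<in> set (supp_list B)" for a using that supp_list_subset[OF B] B by blast
  have g: "eps l / 4 \<le> ?\<sigma>2 a" "?\<sigma>2 a \<le> ?M + eps l" if a: "a \<in> set (supp_list B)" for a
    using good_estimateD[OF sA[OF a] eps[of l], of "?\<sigma>2 a"] assms a rvar_le_M_sigma[OF sA[OF a]]
    unfolding phase_good_def by force+
  have card: "real (card (set (supp_list B))) \<le> real d ^ 2"
  proof -
    have "real d * (real d + 1) \<le> 2 * real d ^ 2" using d by (simp add: power2_eq_square algebra_simps)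
    then show ?thesis using card_supp(1)[OF B] unfolding card_supp(2)[OF B] by linarith
  qed
  have "eps l * (\<Sum>a\<in>set (supp_list B). 2 * ?U / ?\<sigma>2 a) \<le> eps l * (\<Sum>a\<in>set (supp_list B). 8 * ?U / eps l)"
  proof (intro mult_left_mono sum_mono)
    fix a assume a: "a \<in> set (supp_list B)"
    have "2 * ?U / ?\<sigma>2 a \<le> 2 * ?U / (eps l / 4)"
      using g(1)[OF a] e U variance_phase_estimates(1)[OF a] by (intro divide_left_mono) auto
    then show "2 * ?U / ?\<sigma>2 a \<le> 8 * ?U / eps l" by simp
  qed (use e in auto)
  also have "\<dots> = real (card (set (supp_list B))) * (8 * ?U)" using e by simp
  also have "\<dots> \<le> real d ^ 2 * (8 * ?U)" using card U by (intro mult_right_mono) auto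
  finally have 1: "eps l * real (length (snd (variance_phase l B \<omega>))) \<le> real d ^ 2 * (8 * ?U)"
    by (simp only: variance_phase_estimates(3))
  have c0: "0 \<le> ?c" using L by simp
  have "real (length (plays l B ?\<sigma>2)) \<le> (\<Sum>a\<in>set (supp_list B). 1 + ?c * (?M + eps l) * design B a)"
    unfolding length_plays[OF B]
  proof (rule sum_mono)
    fix a assume a: "a \<in> set (supp_list B)"
    have "real (num_plays l B ?\<sigma>2 a) \<le> 1 + ?c * ?\<sigma>2 a * design B a"
      by (rule num_plays_bounds(2)[OF B, of l ?\<sigma>2 a, OF l variance_phase_estimates(1)[OF a]])
    also have "\<dots> \<le> 1 + ?c * (?M + eps l) * design B a"
      using g(2)[OF a] c0 design_pos[OF B a] by (intro add_left_mono mult_right_mono mult_left_mono) auto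
    finally show "real (num_plays l B ?\<sigma>2 a) \<le> 1 + ?c * (?M + eps l) * design B a" .
  qed
  also have "\<dots> = real (card (set (supp_list B))) + ?c * (?M + eps l)"
    unfolding sum.distrib sum_distrib_left[symmetric] sum_design[OF B] by simp
  finally have "eps l * real (length (plays l B ?\<sigma>2)) \<le> eps l * (real d ^ 2 + ?c * (?M + eps l))"
    using card e by (intro mult_left_mono) linarith+
  also have "\<dots> \<le> real d ^ 2 + eps l * (?c * (?M + eps l))"
    using e by (simp add: distrib_left mult_left_le_one_le)
  also have "eps l * (?c * (?M + eps l)) = 49 * real d * ln (1 / delta l) * ?M / eps l + 49 * real d * ln (1 / delta l)"
    using e by (simp add: power2_eq_square field_simps)
  finally have 2: "eps l * real (length (plays l B ?\<sigma>2))
     \<le> real d ^ 2 + (49 * real d * ln (1 / delta l) * ?M / eps l + 49 * real d * ln (1 / delta l))" .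
  have "eps l * real (length (fst (run_phase l B \<omega>)))
     = eps l * real (length (snd (variance_phase l B \<omega>))) + eps l * real (length (plays l B ?\<sigma>2))"
    by (simp add: run_phase_def Let_def distrib_left)
  then show ?thesis using 1 2 by (simp add: distrib_left)
qed

text \<open>Two estimation errors of eps l each: the threshold 2 * eps l spares the optimal action,
  and a survivor is worse by at most twice that.\<close>

lemma good_phase_survivors:
  assumes "phase_good l B \<omega>" and opt: "a0 \<in> B" "\<And>a. a \<in> B \<Longrightarrow> mean a \<le> mean a0"
  shows "a0 \<in> snd (run_phase l B \<omega>)"
    "\<And>a. a \<in> snd (run_phase l B \<omega>) \<Longrightarrow> mean a0 - mean a \<le> 4 * eps l"
proof -
  obtain x where x: "snd (run_phase l B \<omega>) = survivors l B x" "\<And>b. b \<in> B \<Longrightarrow> \<bar>ip d b x - mean b\<bar> \<le> eps l"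
    using assms(1) unfolding phase_good_def run_phase_def Let_def snd_conv by blast
  note mem = mem_survivors_iff[OF finite_B[OF B] B(2), of _ l x]
  have "ip d b x - ip d a0 x \<le> 2 * eps l" if "b \<in> B" for b
    using x(2)[OF that] x(2)[OF opt(1)] opt(2)[OF that] by linarith
  then show "a0 \<in> snd (run_phase l B \<omega>)" unfolding x(1) mem using opt(1) by blast
  fix a assume "a \<in> snd (run_phase l B \<omega>)"
  then have "a \<in> B" "ip d a0 x - ip d a x \<le> 2 * eps l" unfolding x(1) mem using opt(1) by auto
  then show "mean a0 - mean a \<le> 4 * eps l" using x(2)[of a] x(2)[OF opt(1)] by linarith
qed

end

end

subsection \<open>Regret of a good run\<close>

text \<open>The smaller of e T and Q / e is at most their geometric mean sqrt (Q T).\<close>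

lemma le_sqrt_tradeoff:
  fixes x e T D Q :: real
  assumes "x \<le> e * T" "x \<le> D + Q / e" "0 \<le> D" "0 \<le> Q" "0 < e" "0 \<le> T"
  shows "x \<le> D + sqrt (Q * T)"
proof (cases "e * T \<le> sqrt (Q * T)")
  case True then show ?thesis using assms by linarith
next
  case False
  let ?s = "sqrt (Q * T)"
  have s: "0 \<le> ?s" "?s * ?s = Q * T" using assms by auto
  have T: "0 < T" using False s(1) assms by (cases "T = 0") auto
  have "Q * T \<le> (e * T) * ?s" using False s mult_right_mono[of ?s "e * T" ?s] by simp
  then have "Q \<le> e * ?s" using T by (simp add: field_simps)
  then have "Q / e \<le> ?s" using assms(5) by (simp add: field_simps)
  then show ?thesis using assms by linarith
qed

section \<open>Runs of several phases\<close>

context vase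
begin

definition active :: "(nat \<Rightarrow> vec) \<Rightarrow> nat \<Rightarrow> vec set" where
  "active \<omega> n = fst (vase_state d \<delta> A \<omega> n)"
definition next_round :: "(nat \<Rightarrow> vec) \<Rightarrow> nat \<Rightarrow> nat" where
  "next_round \<omega> n = fst (snd (vase_state d \<delta> A \<omega> n))"
definition played :: "(nat \<Rightarrow> vec) \<Rightarrow> nat \<Rightarrow> vec list" where
  "played \<omega> n = snd (snd (vase_state d \<delta> A \<omega> n))"

lemma vase_state_Suc:
  "vase_state d \<delta> A \<omega> (Suc n) = (let s = vase_state d \<delta> A \<omega> n;
      r = run_phase (Suc n) (fst s) (sshift (fst (snd s)) \<omega>)
    in (snd r, fst (snd s) + length (fst r), snd (snd s) @ fst r))"
  by (simp add: phase_eq Let_def split_beta)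

lemma state_0: "active \<omega> 0 = A" "played \<omega> 0 = []"
  by (simp_all add: active_def played_def)

lemma state_Suc:
  "active \<omega> (Suc n) = snd (run_phase (Suc n) (active \<omega> n) (sshift (next_round \<omega> n) \<omega>))"
  "played \<omega> (Suc n) = played \<omega> n @ fst (run_phase (Suc n) (active \<omega> n) (sshift (next_round \<omega> n) \<omega>))"
  unfolding active_def next_round_def played_def vase_state_Suc by (simp_all only: Let_def fst_conv snd_conv)

lemma active: "active \<omega> n \<subseteq> A \<and> active \<omega> n \<noteq> {}"
proof (induction n)
  case 0 then show ?case using A by (simp add: state_0)
next
  case (Suc n)
  then have "finite (active \<omega> n)" using A finite_subset by blast
  then show ?case
    using Suc survivors_subset survivors_nonempty unfolding state_Suc run_phase_def Let_def snd_conv by blast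
qed

text \<open>Rounds are numbered from 1, so the round counter also counts coordinate 0, which no
  phase reads; it is the length of the prefix that determines the state.\<close>

lemma vase_state_stopping:
  assumes "\<And>i. i < fst (snd (vase_state d \<delta> A \<omega> n)) \<Longrightarrow> \<omega> i = \<omega>' i"
  shows "vase_state d \<delta> A \<omega>' n = vase_state d \<delta> A \<omega> n"
  using assms
proof (induction n)
  case (Suc n)
  let ?s = "vase_state d \<delta> A \<omega> n"
  let ?r = "run_phase (Suc n) (fst ?s) (sshift (fst (snd ?s)) \<omega>)"
  have t: "fst (snd (vase_state d \<delta> A \<omega> (Suc n))) = fst (snd ?s) + length (fst ?r)"
    by (simp only: vase_state_Suc Let_def fst_conv snd_conv)
  have p: "\<And>i. i < fst (snd ?s) + length (fst ?r) \<Longrightarrow> \<omega> i = \<omega>' i"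
    using Suc.prems unfolding t .
  have s: "vase_state d \<delta> A \<omega>' n = ?s" by (rule Suc.IH, rule p) simp
  have B: "fst ?s \<subseteq> A" "fst ?s \<noteq> {}" using active[of \<omega> n] by (simp_all add: active_def)
  have "run_phase (Suc n) (fst ?s) (sshift (fst (snd ?s)) \<omega>') = ?r"
    by (rule run_phase_stopping[OF B]) (simp_all add: sshift_def p)
  then show ?case by (simp only: vase_state_Suc Let_def s)
qed simp

lemma countable_valued_vase_state: "countable_valued (\<lambda>\<omega>. vase_state d \<delta> A \<omega> n)"
proof (induction n)
  case 0 then show ?case by (simp add: countable_valued_const)
next
  case (Suc n)
  have "countable_valued (\<lambda>\<omega>. (\<lambda>s \<omega>'. (\<lambda>r. (snd r, fst (snd s) + length (fst r), snd (snd s) @ fst r)) (run_phase (Suc n) (fst s) \<omega>'))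
      (vase_state d \<delta> A \<omega> n) (sshift (fst (snd (vase_state d \<delta> A \<omega> n))) \<omega>))"
  proof (rule countable_valued_bind[where n="\<lambda>s. fst (snd s)", OF Suc.IH])
    fix s assume "s \<in> (\<lambda>\<omega>. vase_state d \<delta> A \<omega> n) ` space S"
    then have B: "fst s \<subseteq> A" "fst s \<noteq> {}" using active[of _ n] by (auto simp: active_def)
    show "countable_valued (\<lambda>\<omega>'. (\<lambda>r. (snd r, fst (snd s) + length (fst r), snd (snd s) @ fst r)) (run_phase (Suc n) (fst s) \<omega>'))"
      by (rule countable_valued_map[OF countable_valued_run_phase[OF B]]) simp
  qed
  then show ?case by (simp only: vase_state_Suc Let_def)
qed

definition good_run :: "nat \<Rightarrow> (nat \<Rightarrow> vec) \<Rightarrow> bool" where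
  "good_run n \<omega> \<longleftrightarrow> (\<forall>k<n. phase_good (Suc k) (active \<omega> k) (sshift (next_round \<omega> k) \<omega>))"

text \<open>The sum of 1/(l(l+1)) telescopes to 1 - 1/(n+1), so the bound stays below 3 \<delta> for
  every number of phases.\<close>

lemma bad_run:
  "\<exists>E\<in>sets S. emeasure S E \<le> ennreal (3 * \<delta> * (1 - 1 / (real n + 1))) \<and> (\<forall>\<omega>\<in>space S - E. good_run n \<omega>)"
proof (induction n)
  case 0 then show ?case by (intro bexI[of _ "{}"]) (auto simp: good_run_def)
next
  case (Suc n)
  obtain E where E: "E \<in> sets S" "emeasure S E \<le> ennreal (3 * \<delta> * (1 - 1 / (real n + 1)))"
    "\<And>\<omega>. \<omega> \<in> space S - E \<Longrightarrow> good_run n \<omega>" using Suc.IH by blast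
  let ?q = "3 * \<delta> / (real (Suc n) * (real (Suc n) + 1))"
  let ?ok = "\<lambda>B F. F \<in> sets S \<and> emeasure S F \<le> ennreal ?q \<and>
     (B \<subseteq> A \<and> B \<noteq> {} \<longrightarrow> (\<forall>\<omega>\<in>space S - F. phase_good (Suc n) B \<omega>))"
  have "\<exists>F. ?ok B F" for B
  proof (cases "B \<subseteq> A \<and> B \<noteq> {}")
    case True
    then show ?thesis using bad_phase[of B "Suc n"] by auto
  next
    case False
    then show ?thesis by (intro exI[of _ "{}"]) auto
  qed
  then obtain F where F: "\<And>B. ?ok B (F B)" by metis
  let ?s = "\<lambda>\<omega>. vase_state d \<delta> A \<omega> n"
  let ?C = "{\<omega>\<in>space S. sshift (fst (snd (?s \<omega>))) \<omega> \<in> F (fst (?s \<omega>))}"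
  have C: "?C \<in> sets S"
    by (rule sets_countable_valued_bind[OF countable_valued_vase_state, where n="\<lambda>s. fst (snd s)" and B="\<lambda>s. F (fst s)"])
      (use F in blast)
  have mC: "emeasure S ?C \<le> ennreal ?q"
  proof (rule emeasure_countable_valued_bind_le[OF countable_valued_vase_state, where n="\<lambda>s. fst (snd s)" and B="\<lambda>s. F (fst s)"])
    fix \<omega> \<omega>' :: "nat \<Rightarrow> vec" assume "\<And>i. i < fst (snd (?s \<omega>)) \<Longrightarrow> \<omega> i = \<omega>' i"
    then show "?s \<omega>' = ?s \<omega>" by (rule vase_state_stopping)
  qed (use F in blast)
  have "emeasure S (E \<union> ?C) \<le> emeasure S E + emeasure S ?C" by (rule emeasure_subadditive[OF E(1) C])
  also have "\<dots> \<le> ennreal (3 * \<delta> * (1 - 1 / (real n + 1))) + ennreal ?q" by (intro add_mono E(2) mC)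
  also have "\<dots> = ennreal (3 * \<delta> * (1 - 1 / (real n + 1)) + ?q)"
    using \<delta> by (intro ennreal_plus[symmetric]) auto
  also have "3 * \<delta> * (1 - 1 / (real n + 1)) + ?q = 3 * \<delta> * (1 - 1 / (real (Suc n) + 1))"
  proof -
    have "1 / (x * (x + 1)) = 1 / x - 1 / (x + 1)" if "0 < x" for x :: real
      using that by (simp add: field_simps)
    from this[of "real (Suc n)"] have "?q = 3 * \<delta> * (1 / real (Suc n) - 1 / (real (Suc n) + 1))"
      by (metis of_nat_0_less_iff times_divide_eq_right mult.right_neutral zero_less_Suc)
    then show ?thesis by (simp add: algebra_simps)
  qed
  finally have m: "emeasure S (E \<union> ?C) \<le> ennreal (3 * \<delta> * (1 - 1 / (real (Suc n) + 1)))" .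
  have "good_run (Suc n) \<omega>" if \<omega>: "\<omega> \<in> space S - (E \<union> ?C)" for \<omega>
  proof -
    have "phase_good (Suc n) (active \<omega> n) (sshift (next_round \<omega> n) \<omega>)"
      using F[of "active \<omega> n"] active[of \<omega> n] \<omega> sshift_in_space[of \<omega>] unfolding active_def next_round_def by blast
    then show ?thesis using E(3)[of \<omega>] \<omega> by (auto simp: good_run_def less_Suc_eq)
  qed
  then show ?case using m E(1) C by (intro bexI[of _ "E \<union> ?C"]) blast+
qed

definition gap :: "vec \<Rightarrow> real" where "gap a = (MAX b\<in>A. mean b) - mean a"

text \<open>An action active after n > 0 phases survived phase \<open>n\<close>, so its gap is at
  most 4 * eps n = 8 * eps (Suc n).\<close>

lemma good_run_gap:
  assumes "good_run n \<omega>"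
  shows "\<forall>a\<in>active \<omega> n. gap a \<le> 8 * eps (Suc n)"
proof -
  have "Max (mean ` A) \<in> mean ` A" using A by (intro Max_in) auto
  then obtain a0 where a0: "a0 \<in> A" "mean a0 = (MAX b\<in>A. mean b)" by auto
  have opt: "mean a \<le> mean a0" if "a \<in> A" for a using A that by (simp add: a0(2))
  have "a0 \<in> active \<omega> n \<and> (\<forall>a\<in>active \<omega> n. mean a0 - mean a \<le> 8 * eps (Suc n))"
    using assms
  proof (induction n)
    case 0
    \<comment> \<open>Before any phase the bound reads 8 * eps 1 = 4, and means lie in
      [-1,1].\<close>
    have "mean a0 - mean a \<le> 4" if "a \<in> A" for a
      using abs_mean_le_1[OF that] abs_mean_le_1[OF a0(1)] by linarith
    then show ?case using a0 by (simp add: state_0 eps_def)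
  next
    case (Suc n)
    then have IH: "a0 \<in> active \<omega> n" by (simp add: good_run_def)
    have B: "active \<omega> n \<subseteq> A" "active \<omega> n \<noteq> {}" using active by blast+
    have g: "phase_good (Suc n) (active \<omega> n) (sshift (next_round \<omega> n) \<omega>)" using Suc.prems by (simp add: good_run_def)
    have "mean a \<le> mean a0" if "a \<in> active \<omega> n" for a using opt that B by blast
    note gs = good_phase_survivors[OF B _ g IH this]
    have "4 * eps (Suc n) = 8 * eps (Suc (Suc n))" by (simp add: eps_def)
    then show ?case unfolding state_Suc using gs by fastforce
  qed
  then show ?thesis by (simp add: gap_def a0(2))
qed

text \<open>The last phase alone is long enough; \<open>Suc\<close> covers n = 0, where nothing has
  been played. If fewer than \<open>T\<close> rounds are over, it yields 2^n \<le> T.\<close>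

lemma good_run_length:
  assumes "good_run n \<omega>"
  shows "2 ^ n \<le> Suc (length (played \<omega> n))"
  using assms
proof (induction n)
  case (Suc n)
  have B: "active \<omega> n \<subseteq> A" "active \<omega> n \<noteq> {}" using active by blast+
  have "phase_good (Suc n) (active \<omega> n) (sshift (next_round \<omega> n) \<omega>)" using Suc.prems by (simp add: good_run_def)
  from good_phase_length_ge[OF B _ this] show ?case unfolding state_Suc by simp
qed simp

lemma set_played: "set (played \<omega> n) \<subseteq> A"
proof (induction n)
  case (Suc n)
  have B: "active \<omega> n \<subseteq> A" "active \<omega> n \<noteq> {}" using active by blast+
  then show ?case unfolding state_Suc using set_run_phase[OF B, of "Suc n"] Suc by fastforce
qed (simp add: state_0)

lemma length_played_ge: "n \<le> length (played \<omega> n)"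
proof (induction n)
  case (Suc n)
  have B: "active \<omega> n \<subseteq> A" "active \<omega> n \<noteq> {}" using active by blast+
  have "0 < length (fst (run_phase (Suc n) (active \<omega> n) (sshift (next_round \<omega> n) \<omega>)))"
    using run_phase_nonempty[OF B] by simp
  then show ?case unfolding state_Suc length_append using Suc by linarith
qed simp

lemma vase_regret_eq: "vase_regret d \<delta> A T \<omega> (param_mean d \<nu>) = sum_list (map gap (take T (played \<omega> T)))"
proof -
  have len: "T \<le> length (played \<omega> T)" by (rule length_played_ge)
  have "vase_regret d \<delta> A T \<omega> (param_mean d \<nu>) = (\<Sum>t=1..T. gap (played \<omega> T ! (t - 1)))"
    by (simp add: vase_regret_def vase_action_def gap_def played_def)
  also have "\<dots> = (\<Sum>t<T. gap (played \<omega> T ! t))"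
    by (rule sum.reindex_bij_witness[of _ Suc "\<lambda>t. t - 1"]) auto
  also have "\<dots> = (\<Sum>t<T. map gap (take T (played \<omega> T)) ! t)" using len by (intro sum.cong) auto
  also have "\<dots> = sum_list (map gap (take T (played \<omega> T)))"
    using len by (simp add: sum_list_sum_nth atLeast0LessThan min_absorb2)
  finally show ?thesis .
qed

text \<open>This is 8 (D + sqrt (Q T)): gap 8 * eps l per round, and \<open>le_sqrt_tradeoff\<close>
  with the D and Q of \<open>good_phase_length_le\<close>.\<close>

definition phase_cost :: "nat \<Rightarrow> nat \<Rightarrow> real" where
  "phase_cost T l = 8 * (real d ^ 2 * (8 * sr_threshold (gam l) + 1) + 49 * real d * ln (1 / delta l)
      + sqrt (49 * real d * ln (1 / delta l) * M_sigma d A \<nu> * real T))"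

lemma phase_cost_nonneg:
  assumes l: "1 \<le> l"
  shows "0 \<le> phase_cost T l"
  using delta(3)[OF l] sr_threshold_pos[OF gam[OF l]] M_sigma_nonneg unfolding phase_cost_def
  by (intro mult_nonneg_nonneg add_nonneg_nonneg real_sqrt_ge_zero) auto

text \<open>A phase is charged only if it starts within the horizon, and by
  \<open>good_run_length\<close> this forces 2 ^ k \<le> T.\<close>

lemma good_run_regret:
  assumes "good_run n \<omega>"
  shows "sum_list (map gap (take T (played \<omega> n))) \<le> (\<Sum>k<n. if 2 ^ k \<le> T then phase_cost T (Suc k) else 0)"
  using assms
proof (induction n)
  case (Suc n)
  have gr: "good_run n \<omega>" using Suc.prems by (simp add: good_run_def)
  have B: "active \<omega> n \<subseteq> A" "active \<omega> n \<noteq> {}" using active by blast+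
  have g: "phase_good (Suc n) (active \<omega> n) (sshift (next_round \<omega> n) \<omega>)" using Suc.prems by (simp add: good_run_def)
  let ?p = "fst (run_phase (Suc n) (active \<omega> n) (sshift (next_round \<omega> n) \<omega>))"
  \<comment> \<open>Truncated subtraction: the rounds of the horizon left for this phase, zero if it
    starts too late.\<close>
  let ?m = "T - length (played \<omega> n)" and ?e = "eps (Suc n)"
  let ?D = "real d ^ 2 * (8 * sr_threshold (gam (Suc n)) + 1) + 49 * real d * ln (1 / delta (Suc n))"
  let ?Q = "49 * real d * ln (1 / delta (Suc n)) * M_sigma d A \<nu>"
  have "sum_list (map gap (take ?m ?p)) \<le> (if 2 ^ n \<le> T then phase_cost T (Suc n) else 0)"
  proof (cases "T \<le> length (played \<omega> n)")
    case True
    then show ?thesis using phase_cost_nonneg[of "Suc n" T] by simp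
  next
    case False
    then have T: "2 ^ n \<le> T" using good_run_length[OF gr] by linarith
    have "sum_list (map gap (take ?m ?p)) \<le> sum_list (map (\<lambda>_. 8 * ?e) (take ?m ?p))"
    proof (rule sum_list_mono)
      fix a assume "a \<in> set (take ?m ?p)"
      then have "a \<in> active \<omega> n" using set_run_phase[OF B, of "Suc n"] set_take_subset by fastforce
      then show "gap a \<le> 8 * ?e" using good_run_gap[OF gr] by blast
    qed
    also have "\<dots> = 8 * (?e * real (length (take ?m ?p)))" by (simp add: sum_list_triv)
    also have "?e * real (length (take ?m ?p)) \<le> ?D + sqrt (?Q * real T)"
    proof (rule le_sqrt_tradeoff[where e="?e"])
      show "?e * real (length (take ?m ?p)) \<le> ?e * real T"
        using eps(1)[of "Suc n"] by (intro mult_left_mono) auto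
      have "?e * real (length (take ?m ?p)) \<le> ?e * real (length ?p)"
        using eps(1)[of "Suc n"] by (intro mult_left_mono) auto
      also have "\<dots> \<le> ?D + ?Q / ?e" using good_phase_length_le[OF B _ g] by simp
      finally show "?e * real (length (take ?m ?p)) \<le> ?D + ?Q / ?e" .
      have L: "0 \<le> ln (1 / delta (Suc n))" using delta(3)[of "Suc n"] by simp
      show "0 \<le> ?D" using L sr_threshold_pos[OF gam[of "Suc n"]] by (intro add_nonneg_nonneg mult_nonneg_nonneg) auto
      show "0 \<le> ?Q" using L M_sigma_nonneg by simp
    qed (use eps(1)[of "Suc n"] in auto)
    finally show ?thesis using T by (simp add: phase_cost_def)
  qed
  then show ?case using Suc.IH[OF gr] unfolding state_Suc by simp
qed (simp add: state_0)

section \<open>Constants of the final bound\<close>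

lemma log_bounds:
  fixes T :: nat
  defines "\<Lambda> \<equiv> ln (real d + real (card A) + real T + 1 / \<delta> + 2)"
  shows "1 \<le> \<Lambda>" "ln (real d + 1) \<le> \<Lambda>" "ln (real (card A)) \<le> \<Lambda>" "ln (real T + 1) \<le> \<Lambda>" "ln (1 / \<delta>) \<le> \<Lambda>"
proof -
  let ?x = "real d + real (card A) + real T + 1 / \<delta> + 2"
  have p: "1 \<le> real d" "1 \<le> real (card A)" "0 \<le> real T" "1 < 1 / \<delta>" using d card_A \<delta> by auto
  have mono: "y \<le> ?x \<Longrightarrow> 0 < y \<Longrightarrow> ln y \<le> \<Lambda>" for y unfolding \<Lambda>_def by simp
  have "exp 1 \<le> ?x" using p e_less_272 by linarith
  then show "1 \<le> \<Lambda>" using mono[of "exp 1"] by simp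
  show "ln (real d + 1) \<le> \<Lambda>" "ln (real (card A)) \<le> \<Lambda>" "ln (real T + 1) \<le> \<Lambda>" "ln (1 / \<delta>) \<le> \<Lambda>"
    using p by (intro mono; linarith)+
qed

text \<open>Origin of 7400: log(1/\<delta>_l) is a sum of 4 logarithms, each at most \<Lambda>, and
  log(2/\<gamma>_l) of 5, so the stopping level is at most 91 \<Lambda>; then 8 * 91 + 1 = 729, 49 *
  4 = 196 and 8 * (729 + 196) = 7400.\<close>

lemma phase_cost_le:
  fixes T :: nat
  defines "\<Lambda> \<equiv> ln (real d + real (card A) + real T + 1 / \<delta> + 2)"
  assumes K: "2 \<le> card A" and k: "2 ^ k \<le> T"
  shows "phase_cost T (Suc k) \<le> 7400 * \<Lambda> * (real d ^ 2 + sqrt (real d * real T * ln (real (card A) / \<delta>) * M_sigma d A \<nu>))"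
proof -
  let ?l = "real (Suc k)" and ?L = "ln (1 / delta (Suc k))" and ?M = "M_sigma d A \<nu>"
  note \<Lambda> = log_bounds[of T, folded \<Lambda>_def]
  \<comment> \<open>The phase index is at most \<open>T\<close>, so its logarithms are absorbed by
    \<Lambda>.\<close>
  have "Suc k \<le> 2 ^ k" by (induction k) auto
  then have lT: "Suc k \<le> T" using k by simp
  have l1: "ln (?l + 1) \<le> \<Lambda>" 
  proof -
    have "ln (?l + 1) \<le> ln (real T + 1)" using lT by simp
    then show ?thesis using \<Lambda>(4) by linarith
  qed
  have l0: "ln ?l \<le> \<Lambda>" 
  proof -
    have "ln ?l \<le> ln (?l + 1)" by simp
    then show ?thesis using l1 by linarith
  qed
  have d0: "ln (real d) \<le> \<Lambda>" 
  proof -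
    have "ln (real d) \<le> ln (real d + 1)" using d by simp
    then show ?thesis using \<Lambda>(2) by linarith
  qed
  have L: "?L \<le> 4 * \<Lambda>" "2/3 \<le> ?L"
  proof -
    have "1 / delta (Suc k) = real (card A) * ?l * (?l + 1) * (1 / \<delta>)" by (simp add: delta_def)
    moreover have "ln (x * y * z * w) = ln x + ln y + ln z + ln w" if "0 < x" "0 < y" "0 < z" "0 < w" for x y z w :: real
      using that by (simp add: ln_mult_pos)
    from this[of "real (card A)" ?l "?l + 1" "1 / \<delta>"]
    have "ln (real (card A) * ?l * (?l + 1) * (1 / \<delta>)) = ln (real (card A)) + ln ?l + ln (?l + 1) + ln (1 / \<delta>)"
      using K \<delta> by simp
    ultimately have "?L = ln (real (card A)) + ln ?l + ln (?l + 1) + ln (1 / \<delta>)"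
      by simp
    then show "?L \<le> 4 * \<Lambda>" using \<Lambda> l0 l1 by linarith
    show "2/3 \<le> ?L" by (rule delta(3)) simp
  qed
  have U: "sr_threshold (gam (Suc k)) \<le> 91 * \<Lambda>" "1 \<le> sr_threshold (gam (Suc k))"
  proof -
    have "2 / gam (Suc k) = ?l * (?l + 1) * real d * (real d + 1) * (1 / \<delta>)" by (simp add: gam_def)
    moreover have "ln (x * y * z * w * v) = ln x + ln y + ln z + ln w + ln v"
      if "0 < x" "0 < y" "0 < z" "0 < w" "0 < v" for x y z w v :: real
      using that by (simp add: ln_mult_pos)
    from this[of ?l "?l + 1" "real d" "real d + 1" "1 / \<delta>"]
    have "ln (?l * (?l + 1) * real d * (real d + 1) * (1 / \<delta>))
        = ln ?l + ln (?l + 1) + ln (real d) + ln (real d + 1) + ln (1 / \<delta>)"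
      using d \<delta> by simp
    ultimately have "ln (2 / gam (Suc k)) = ln ?l + ln (?l + 1) + ln (real d) + ln (real d + 1) + ln (1 / \<delta>)"
      by simp
    then have "ln (2 / gam (Suc k)) \<le> 5 * \<Lambda>" using \<Lambda> l0 l1 d0 by linarith
    then show "sr_threshold (gam (Suc k)) \<le> 91 * \<Lambda>"
      using sr_threshold_le[OF gam[of "Suc k"]] \<Lambda>(1) by simp
    show "1 \<le> sr_threshold (gam (Suc k))" by (rule sr_threshold_pos[OF gam]) auto
  qed
  have 1: "real d ^ 2 * (8 * sr_threshold (gam (Suc k)) + 1) \<le> real d ^ 2 * (729 * \<Lambda>)"
    using U \<Lambda>(1) by (intro mult_left_mono) auto
  have 2: "49 * real d * ?L \<le> real d ^ 2 * (196 * \<Lambda>)"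
  proof -
    have "49 * real d * ?L \<le> 49 * real d * (4 * \<Lambda>)" using L by (intro mult_left_mono) auto
    also have "\<dots> \<le> 49 * real d ^ 2 * (4 * \<Lambda>)"
      using d \<Lambda>(1) by (intro mult_right_mono mult_left_mono) (auto simp: power2_eq_square)
    finally show ?thesis by simp
  qed
  let ?R = "real d * real T * ln (real (card A) / \<delta>) * ?M"
  \<comment> \<open>Two actions keep ln (K/\<delta>) away from 0, so that it can be inserted as a
    factor beside \<Lambda>.\<close>
  have lnK: "2/3 \<le> ln (real (card A) / \<delta>)"
  proof -
    have "2 * \<delta> \<le> 2 * 1" using \<delta> by simp
    also have "\<dots> \<le> real (card A)" using K by simp
    finally have "2 \<le> real (card A) / \<delta>" using \<delta> by (simp add: field_simps)
    then have "ln 2 \<le> ln (real (card A) / \<delta>)" by (subst ln_le_cancel_iff) auto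
    then show ?thesis using ln2_ge_two_thirds by linarith
  qed
  have 3: "sqrt (49 * real d * ?L * ?M * real T) \<le> 18 * \<Lambda> * sqrt ?R"
  proof -
    have "?L \<le> 6 * \<Lambda> * ln (real (card A) / \<delta>)"
    proof -
      have "6 * \<Lambda> * (2/3) \<le> 6 * \<Lambda> * ln (real (card A) / \<delta>)" using lnK \<Lambda>(1) by (intro mult_left_mono) auto
      then show ?thesis using L(1) by linarith
    qed
    then have "(49 * real d * ?M * real T) * ?L \<le> (49 * real d * ?M * real T) * (6 * \<Lambda> * ln (real (card A) / \<delta>))"
      using M_sigma_nonneg by (intro mult_left_mono) auto
    then have "49 * real d * ?L * ?M * real T \<le> (294 * \<Lambda>) * ?R" by (simp add: algebra_simps)
    \<comment> \<open>Here 294 = 49 * 6 and 18^2 = 324; a spare factor \<Lambda> makes it a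
      square.\<close>
    also have "\<dots> \<le> (18 * \<Lambda>)^2 * ?R"
    proof (rule mult_right_mono)
      have "294 * \<Lambda> * 1 \<le> 324 * \<Lambda> * \<Lambda>" using \<Lambda>(1) by (intro mult_mono) auto
      then show "294 * \<Lambda> \<le> (18 * \<Lambda>)^2" by (simp add: power2_eq_square)
      show "0 \<le> ?R" using lnK M_sigma_nonneg by (intro mult_nonneg_nonneg) auto
    qed
    finally have "sqrt (49 * real d * ?L * ?M * real T) \<le> sqrt ((18 * \<Lambda>)^2 * ?R)" by (rule real_sqrt_le_mono)
    also have "\<dots> = 18 * \<Lambda> * sqrt ?R" using \<Lambda>(1) by (simp add: real_sqrt_mult)
    finally show ?thesis .
  qed
  have "0 \<le> sqrt ?R" using lnK M_sigma_nonneg by (intro real_sqrt_ge_zero mult_nonneg_nonneg) auto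
  \<comment> \<open>18 is raised to 925 = 729 + 196, the coefficient of d^2.\<close>
  then have 4: "18 * \<Lambda> * sqrt ?R \<le> 925 * \<Lambda> * sqrt ?R" using \<Lambda>(1) by (intro mult_right_mono) auto
  have "phase_cost T (Suc k) \<le> 8 * (real d ^ 2 * (729 * \<Lambda>) + real d ^ 2 * (196 * \<Lambda>) + 925 * \<Lambda> * sqrt ?R)"
    unfolding phase_cost_def by (intro mult_left_mono add_mono 1 2 order_trans[OF 3 4]) auto
  also have "\<dots> = 7400 * \<Lambda> * (real d ^ 2 + sqrt ?R)" by (simp add: algebra_simps)
  finally show ?thesis .
qed

text \<open>At most log2 T + 1 \<le> 5/2 \<Lambda> phases start within the horizon, each costing
  7400 \<Lambda> times the bracket: this gives 18500 and the second logarithm.\<close>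

lemma good_run_regret_bound:
  fixes T :: nat
  defines "\<Lambda> \<equiv> ln (real d + real (card A) + real T + 1 / \<delta> + 2)"
  assumes K: "2 \<le> card A" and gr: "good_run T \<omega>"
  shows "vase_regret d \<delta> A T \<omega> (param_mean d \<nu>)
    \<le> 18500 * \<Lambda> ^ 2 * (real d ^ 2 + sqrt (real d * real T * ln (real (card A) / \<delta>) * M_sigma d A \<nu>))"
    (is "_ \<le> _ * ?X")
proof -
  note \<Lambda> = log_bounds[of T, folded \<Lambda>_def]
  have "0 \<le> ln (real (card A) / \<delta>)" using card_A \<delta> by (intro ln_ge_zero) (simp add: field_simps)
  then have X: "0 \<le> ?X" using M_sigma_nonneg by (intro add_nonneg_nonneg real_sqrt_ge_zero mult_nonneg_nonneg) auto
  let ?I = "{k. k < T \<and> 2 ^ k \<le> T}"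
  have "vase_regret d \<delta> A T \<omega> (param_mean d \<nu>) \<le> (\<Sum>k<T. if 2 ^ k \<le> T then phase_cost T (Suc k) else 0)"
    unfolding vase_regret_eq by (rule good_run_regret[OF gr])
  also have "\<dots> = (\<Sum>k\<in>?I. phase_cost T (Suc k))"
    by (subst sum.inter_filter[symmetric]) auto
  also have "\<dots> \<le> (\<Sum>k\<in>?I. 7400 * \<Lambda> * ?X)"
    unfolding \<Lambda>_def by (intro sum_mono phase_cost_le[OF K]) auto
  also have "\<dots> = real (card ?I) * (7400 * \<Lambda> * ?X)" by simp
  also have "\<dots> \<le> (5/2 * \<Lambda>) * (7400 * \<Lambda> * ?X)"
  proof (rule mult_right_mono)
    show "real (card ?I) \<le> 5/2 * \<Lambda>"
    proof (cases "T = 0")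
      case True then show ?thesis using \<Lambda>(1) by simp
    next
      case False
      let ?m = "nat \<lfloor>log 2 (real T)\<rfloor>"
      have "k \<le> ?m" if "2 ^ k \<le> T" for k
      proof -
        have "(2::real) ^ k \<le> real T" using that by (metis of_nat_le_iff of_nat_numeral of_nat_power)
        then have "real k \<le> log 2 (real T)" using False by (subst le_log_iff) (auto simp: powr_realpow)
        then show ?thesis by linarith
      qed
      then have "card ?I \<le> card {..?m}" by (intro card_mono) auto
      then have "real (card ?I) \<le> real ?m + 1" by simp
      also have "real ?m \<le> log 2 (real T)" using False by simp
      also have "log 2 (real T) \<le> 3/2 * \<Lambda>"
      proof -
        have "ln (real T) \<le> ln (real T + 1)" using False by simp
        then have "ln (real T) \<le> \<Lambda>" using \<Lambda>(4) by linarith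
        then have "ln (real T) / ln 2 \<le> \<Lambda> / (2/3)"
          using \<Lambda>(1) ln2_ge_two_thirds by (intro frac_le) auto
        then show ?thesis by (simp add: log_def)
      qed
      finally show ?thesis using \<Lambda>(1) by linarith
    qed
    show "0 \<le> 7400 * \<Lambda> * ?X" using \<Lambda>(1) X by simp
  qed
  finally show ?thesis by (simp add: power2_eq_square algebra_simps)
qed

text \<open>A single action has regret 0. It is treated apart because ln (K/\<delta>) may then be
  arbitrarily close to 0.\<close>

lemma regret_high_probability:
  "\<exists>E\<in>sets S. 1 - 3 * \<delta> \<le> measure S E \<and> (\<forall>\<omega>\<in>E. vase_regret d \<delta> A T \<omega> (param_mean d \<nu>)
     \<le> 18500 * (ln (real d + real (card A) + real T + 1 / \<delta> + 2)) ^ 2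
       * (real d ^ 2 + sqrt (real d * real T * ln (real (card A) / \<delta>) * M_sigma d A \<nu>)))"
proof (cases "2 \<le> card A")
  case True
  obtain E where E: "E \<in> sets S" "emeasure S E \<le> ennreal (3 * \<delta> * (1 - 1 / (real T + 1)))"
    "\<And>\<omega>. \<omega> \<in> space S - E \<Longrightarrow> good_run T \<omega>" using bad_run[of T] by blast
  have "3 * \<delta> * (1 - 1 / (real T + 1)) \<le> 3 * \<delta>" using \<delta> by (simp add: mult_left_le)
  then have "emeasure S E \<le> ennreal (3 * \<delta>)" using E(2) by (meson ennreal_leI order_trans)
  then have "measure S E \<le> 3 * \<delta>" using \<delta> by (simp add: P.emeasure_eq_measure)
  then have "1 - 3 * \<delta> \<le> measure S (space S - E)" using P.prob_compl[OF E(1)] by simp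
  then show ?thesis using E(1,3) good_run_regret_bound[OF True] by (intro bexI[of _ "space S - E"]) auto
next
  case False
  then have "card A = 1" using card_A by simp
  then obtain a where a: "A = {a}" by (auto simp: card_1_singleton_iff)
  have "vase_regret d \<delta> A T \<omega> (param_mean d \<nu>) = 0" for \<omega>
  proof -
    have "gap b = 0" if "b \<in> A" for b
      using that unfolding gap_def by (simp add: a)
    then have "gap b = 0" if "b \<in> set (take T (played \<omega> T))" for b
      using that set_played[of \<omega> T] set_take_subset[of T "played \<omega> T"] by blast
    then have "sum_list (map gap (take T (played \<omega> T))) = sum_list (map (\<lambda>_. 0) (take T (played \<omega> T)))"
      by (intro arg_cong[where f=sum_list] map_cong) auto
    then show ?thesis unfolding vase_regret_eq by (simp add: sum_list_triv)
  qed
  moreover have "0 \<le> ln (real (card A) / \<delta>)" using card_A \<delta> by (intro ln_ge_zero) (simp add: field_simps)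
  then have "0 \<le> 18500 * (ln (real d + real (card A) + real T + 1 / \<delta> + 2)) ^ 2
       * (real d ^ 2 + sqrt (real d * real T * ln (real (card A) / \<delta>) * M_sigma d A \<nu>))"
    using M_sigma_nonneg by (intro mult_nonneg_nonneg add_nonneg_nonneg real_sqrt_ge_zero) auto
  ultimately show ?thesis using \<delta> by (intro bexI[of _ "space S"]) (auto simp: P.prob_space)
qed

end

theorem theorem3p1:
  shows "\<exists>(C::real) (p::nat). \<forall>(d::nat) (A::vec set) (\<nu>::vec measure) (\<delta>::real) (T::nat).
     (1 \<le> d \<and> finite A \<and> A \<noteq> {} \<and> (\<forall>a\<in>A. \<forall>i. d \<le> i \<longrightarrow> a i = 0)
      \<and> 0 < \<delta> \<and> \<delta> < 1
      \<and> prob_space \<nu> \<and> sets \<nu> = sets (\<Pi>\<^sub>M i\<in>{..<d}. (borel :: real measure))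
      \<and> (\<forall>i<d. integrable \<nu> (\<lambda>\<theta>. \<theta> i) \<and> integrable \<nu> (\<lambda>\<theta>. (\<theta> i)^2))
      \<and> (AE \<theta> in \<nu>. \<forall>a\<in>A. \<bar>ip d a \<theta>\<bar> \<le> 1))
     \<longrightarrow> (\<exists>E\<in>sets (\<Pi>\<^sub>M t\<in>(UNIV::nat set). \<nu>).
            1 - 3 * \<delta> \<le> measure (\<Pi>\<^sub>M t\<in>(UNIV::nat set). \<nu>) E
          \<and> (\<forall>\<omega>\<in>E. vase_regret d \<delta> A T \<omega> (param_mean d \<nu>)
                \<le> C * (ln (real d + real (card A) + real T + 1 / \<delta> + 2)) ^ p
                    * (real d ^ 2 + sqrt (real d * real T * ln (real (card A) / \<delta>) * M_sigma d A \<nu>))))"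
proof (rule exI[of _ 18500], rule exI[of _ 2], intro allI impI, elim conjE)
  fix d :: nat and A :: "vec set" and \<nu> :: "vec measure" and \<delta> :: real and T :: nat
  assume *: "1 \<le> d" "finite A" "A \<noteq> {}" "0 < \<delta>" "\<delta> < 1" "prob_space \<nu>"
    "sets \<nu> = sets (\<Pi>\<^sub>M i\<in>{..<d}. (borel :: real measure))"
    "\<forall>i<d. integrable \<nu> (\<lambda>\<theta>. \<theta> i) \<and> integrable \<nu> (\<lambda>\<theta>. (\<theta> i)^2)"
    "AE \<theta> in \<nu>. \<forall>a\<in>A. \<bar>ip d a \<theta>\<bar> \<le> 1"
  interpret product_prob_space "\<lambda>_. \<nu>" "UNIV :: nat set"
    by (rule product_prob_spaceI) (rule *(6))
  interpret vase \<nu> d A \<delta>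
    by unfold_locales (use * in auto)
  show "\<exists>E\<in>sets (\<Pi>\<^sub>M t\<in>(UNIV::nat set). \<nu>).
            1 - 3 * \<delta> \<le> measure (\<Pi>\<^sub>M t\<in>(UNIV::nat set). \<nu>) E
          \<and> (\<forall>\<omega>\<in>E. vase_regret d \<delta> A T \<omega> (param_mean d \<nu>)
                \<le> 18500 * (ln (real d + real (card A) + real T + 1 / \<delta> + 2)) ^ 2
                    * (real d ^ 2 + sqrt (real d * real T * ln (real (card A) / \<delta>) * M_sigma d A \<nu>)))"
    by (rule regret_high_probability)
qed

end
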